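(* Let $X_1,\dots,X_n$ be i.i.d. $N_p(\theta,\Sigma)$ with $\Sigma$ an unknown arbitrary positive definite matrix. For the problem of testing $H_0:\theta=0$ against $H_1:\theta\in\mathcal{C}\setminus\{0\}$, where $\mathcal{C}$ is either the positive orthant $\mathcal{O}_p^+=\{\theta\in\mathbb{R}^p:\theta\ge0\}$ or the halfspace $\mathcal{H}_p^*=\{\theta\in\mathbb{R}^p:\theta_p\ge0\}$, the likelihood ratio test (LRT) and the union-intersection test (UIT) are versions of the integrated LRT and the integrated UIT, respectively; that is, the integrated LRT statistic is a strictly increasing function of the LRT statistic, and the integrated UIT statistic is a strictly increasing function of the UIT statistic.
   Context: Setting: $n>p$; $\mathcal{M}$ is the set of $p\times p$ positive definite matrices. Put $\bar X_n=n^{-1}\sum_i X_i$ and $S_n=\sum_{i=1}^n(X_i-\bar X_n)(X_i-\bar X_n)'$ (positive definite almost surely). Notation: $P=\{1,\dots,p\}$, $P_1=P\setminus\{p\}$; for $\emptyset\subseteq a\subseteq P$, $a'$ is the complement of $a$, and $\bar X_n,S_n$ are partitioned accordingly. Define $\bar X_{na:a'}=\bar X_{na}-S_{naa'}S_{na'a'}^{-1}\bar X_{na'}$ and $S_{naa:a'}=S_{naa}-S_{naa'}S_{na'a'}^{-1}S_{na'a}$ (for $a=P$ these are $\bar X_n,S_n$; quadratic forms indexed by $\emptyset$ are $0$). Inequalities between vectors are coordinatewise. Index family: for $\mathcal{C}=\mathcal{O}_p^+$ let $\mathcal{F}$ be all subsets $a$ of $P$ and $I_{na}=1\{\bar X_{na:a'}>0,\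 S_{na'a'}^{-1}\bar X_{na'}\le0\}$. For $\mathcal{C}=\mathcal{H}_p^*$ let $\mathcal{F}=\{P_1,P\}$, $I_{nP}=1\{\bar X_{np}>0\}$ and $I_{nP_1}=1\{\bar X_{np}\le0\}$. Almost surely exactly one $I_{na}$, $a\in\mathcal{F}$, equals $1$. LRT and UIT statistics: $$L=\sum_{a\in\mathcal{F}}\frac{n\bar X_{na:a'}'S_{naa:a'}^{-1}\bar X_{na:a'}}{1+n\bar X_{na'}'S_{na'a'}^{-1}\bar X_{na'}}I_{na},\qquad U=\sum_{a\in\mathcal{F}}n\bar X_{na:a'}'S_{naa:a'}^{-1}\bar X_{na:a'}\,I_{na}.$$ The LRT and UIT reject for large values of $L$ and $U$ respectively. Integrated LRT: let $P_1(\theta\mid\bar X_n,S_n)=\int_{\mathcal{M}}f(\bar X_n,S_n\mid\theta,\Sigma)\,|\Sigma|^{-(p+1)/2}d\Sigma$ be the likelihood integrated with respect to the Haar (invariant) measure $|\Sigma|^{-(p+1)/2}d\Sigma$ on $\mathcal{M}$, where $f$ is the joint density of $(\bar X_n,S_n)$. The integrated LRT statistic is $\sup_{\theta\in\mathcal{C}}P_1(\theta\mid\bar X_n,S_n)/P_1(0\mid\bar X_n,S_n)$. Integrated UIT: for $b\in\mathbb{R}^p\setminus\{0\}$ let $$P_2(\theta\mid\bar X_n,S_n,b)\propto(b'S_nb)^{-(p+1)/2}\Bigl[1+\frac{n\{b'(\bar X_n-\theta)\}^2}{b'S_nb}\Bigr]^{-n/2}$$ and $R(b)=\sup_{\theta\in\mathcal{C}}P_2(\theta\mid\bar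 X_n,S_n,b)/P_2(0\mid\bar X_n,S_n,b)$. When $I_{na}=1$, the integrated UIT statistic is the supremum of $R(b)$ over all $b$ with $b_a\ne0$ and $b_{a'}=-S_{na'a'}^{-1}S_{na'a}b_a$ (and it is $1$ if $a=\emptyset$). The integrated tests reject for large values of these statistics. *)

theory Defs
  imports "HOL-Probability.Probability"
begin

text \<open>
  The coordinate set \<open>P = {1,\<dots>,p}\<close> is a finite linearly ordered index type \<open>'p\<close>, so that
  \<open>p = CARD('p)\<close> and the last coordinate is \<open>Max UNIV\<close>.
\<close>

type_synonym 'p rvec = "(real, 'p) vec"
type_synonym 'p rmat = "((real, 'p) vec, 'p) vec"

subsection \<open>Positive definite matrices and Lebesgue measure on symmetric matrices\<close>

definition posdef :: "('p::finite) rmat \<Rightarrow> bool" where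
  "posdef A \<longleftrightarrow> transpose A = A \<and> (\<forall>x. x \<noteq> 0 \<longrightarrow> x \<bullet> (A *v x) > 0)"

text \<open>The measure \<open>d\<Sigma> = \<Prod>\<^bsub>i\<le>j\<^esub> d\<sigma>\<^bsub>ij\<^esub>\<close>, carried to the space of matrices; it is concentrated on
  the symmetric ones.\<close>

definition sym_lborel :: "('p::{finite,linorder}) rmat measure" where
  "sym_lborel =
     distr (PiM {(i, j). i \<le> j} (\<lambda>_. lborel)) borel (\<lambda>u. \<chi> i j. u (min i j, max i j))"

subsection \<open>The sample\<close>

definition mvn_density :: "('p::finite) rvec \<Rightarrow> 'p rmat \<Rightarrow> 'p rvec \<Rightarrow> real" where
  "mvn_density \<theta> \<Sigma> x =
     exp (- ((x - \<theta>) \<bullet> (matrix_inv \<Sigma> *v (x - \<theta>))) / 2) / sqrt ((2 * pi) ^ CARD('p) * det \<Sigma>)"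

definition iid_normal ::
  "nat \<Rightarrow> ('p::finite) rvec \<Rightarrow> 'p rmat \<Rightarrow> 'w measure \<Rightarrow> (nat \<Rightarrow> 'w \<Rightarrow> 'p rvec) \<Rightarrow> bool" where
  "iid_normal n \<theta> \<Sigma> M X \<longleftrightarrow>
     prob_space M \<and> prob_space.indep_vars M (\<lambda>_. borel) X {1..n} \<and>
     (\<forall>i\<in>{1..n}. distributed M lborel (X i) (\<lambda>x. ennreal (mvn_density \<theta> \<Sigma> x)))"

definition sample_mean :: "nat \<Rightarrow> (nat \<Rightarrow> ('p::finite) rvec) \<Rightarrow> 'p rvec" where
  "sample_mean n xs = (1 / real n) *\<^sub>R (\<Sum>i=1..n. xs i)"

definition scatter :: "nat \<Rightarrow> (nat \<Rightarrow> ('p::finite) rvec) \<Rightarrow> 'p rmat" where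
  "scatter n xs =
     (\<chi> j k. \<Sum>i=1..n. (xs i - sample_mean n xs) $ j * (xs i - sample_mean n xs) $ k)"

text \<open>
  \<open>f x S \<theta> \<Sigma>\<close> is the joint density of mean and scatter matrix of an i.i.d. \<open>N(\<theta>,\<Sigma>)\<close> sample. A density
  is determined only almost everywhere, whereas the likelihood is evaluated at a fixed \<open>(x,S)\<close>
  for all \<open>(\<theta>,\<Sigma>)\<close> at once. The version meant is therefore the one continuous in \<open>(x,S)\<close>, for \<open>S\<close>
  positive definite, and there it is unique.
\<close>

definition joint_density ::
  "nat \<Rightarrow> (('p::{finite,linorder}) rvec \<Rightarrow> 'p rmat \<Rightarrow> 'p rvec \<Rightarrow> 'p rmat \<Rightarrow> real) \<Rightarrow> bool" where
  "joint_density n f \<longleftrightarrow>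
     (\<forall>\<theta> \<Sigma>. posdef \<Sigma> \<longrightarrow>
        (\<forall>x S. f x S \<theta> \<Sigma> \<ge> 0) \<and>
        continuous_on (UNIV \<times> {S. posdef S}) (\<lambda>(x, S). f x S \<theta> \<Sigma>) \<and>
        distributed
          (PiM {1..n} (\<lambda>_. density lborel (\<lambda>x. ennreal (mvn_density \<theta> \<Sigma> x))))
          (lborel \<Otimes>\<^sub>M sym_lborel)
          (\<lambda>xs. (sample_mean n xs, scatter n xs))
          (\<lambda>(x, S). ennreal (f x S \<theta> \<Sigma>)))"

subsection \<open>Partitioned vectors and matrices\<close>

text \<open>
  Subvectors and blocks keep the full index type and are padded by zeros. The inverse of the block
  \<open>A\<^bsub>aa\<^esub>\<close> is read off from \<open>diag (A\<^bsub>aa\<^esub>, I)\<close>, whose inverse is \<open>diag (A\<^bsub>aa\<^esub>\<^sup>-\<^sup>1, I)\<close>.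
\<close>

definition subvec :: "('p::finite) set \<Rightarrow> 'p rvec \<Rightarrow> 'p rvec" where
  "subvec a x = (\<chi> i. if i \<in> a then x $ i else 0)"

definition block :: "('p::finite) set \<Rightarrow> 'p set \<Rightarrow> 'p rmat \<Rightarrow> 'p rmat" where
  "block a c A = (\<chi> i j. if i \<in> a \<and> j \<in> c then A $ i $ j else 0)"

definition block_inv :: "('p::finite) set \<Rightarrow> 'p rmat \<Rightarrow> 'p rmat" where
  "block_inv a A = block a a (matrix_inv (block a a A + block (- a) (- a) (mat 1)))"

definition mean_given :: "('p::finite) set \<Rightarrow> 'p rvec \<Rightarrow> 'p rmat \<Rightarrow> 'p rvec" where
  "mean_given a x S =
     subvec a x - block a (- a) S *v (block_inv (- a) S *v subvec (- a) x)"

definition scatter_given :: "('p::finite) set \<Rightarrow> 'p rmat \<Rightarrow> 'p rmat" where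
  "scatter_given a S =
     block a a S - block a (- a) S ** block_inv (- a) S ** block (- a) a S"

subsection \<open>The two alternatives, the LRT and the UIT\<close>

datatype alternative = Orthant | Halfspace

fun cone :: "alternative \<Rightarrow> ('p::{finite,linorder}) rvec set" where
  "cone Orthant = {\<theta>. \<forall>i. \<theta> $ i \<ge> 0}"
| "cone Halfspace = {\<theta>. \<theta> $ Max UNIV \<ge> 0}"

fun family :: "alternative \<Rightarrow> 'p::{finite,linorder} set set" where
  "family Orthant = UNIV"
| "family Halfspace = {UNIV - {Max UNIV}, UNIV}"

fun ind :: "alternative \<Rightarrow> 'p set \<Rightarrow> ('p::{finite,linorder}) rvec \<Rightarrow> 'p rmat \<Rightarrow> real" where
  "ind Orthant a x S =
     of_bool ((\<forall>i\<in>a. mean_given a x S $ i > 0) \<and>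
              (\<forall>i\<in>- a. (block_inv (- a) S *v subvec (- a) x) $ i \<le> 0))"
| "ind Halfspace a x S =
     (if a = UNIV then of_bool (x $ Max UNIV > 0) else of_bool (x $ Max UNIV \<le> 0))"

definition quad_given :: "('p::finite) set \<Rightarrow> 'p rvec \<Rightarrow> 'p rmat \<Rightarrow> real" where
  "quad_given a x S =
     mean_given a x S \<bullet> (block_inv a (scatter_given a S) *v mean_given a x S)"

definition LRT ::
  "alternative \<Rightarrow> nat \<Rightarrow> ('p::{finite,linorder}) rvec \<Rightarrow> 'p rmat \<Rightarrow> real" where
  "LRT K n x S =
     (\<Sum>a\<in>family K.
        real n * quad_given a x S /
          (1 + real n * (subvec (- a) x \<bullet> (block_inv (- a) S *v subvec (- a) x))) * ind K a x S)"

definition UIT ::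
  "alternative \<Rightarrow> nat \<Rightarrow> ('p::{finite,linorder}) rvec \<Rightarrow> 'p rmat \<Rightarrow> real" where
  "UIT K n x S = (\<Sum>a\<in>family K. real n * quad_given a x S * ind K a x S)"

subsection \<open>The integrated LRT\<close>

definition integrated_lik ::
  "(('p::{finite,linorder}) rvec \<Rightarrow> 'p rmat \<Rightarrow> 'p rvec \<Rightarrow> 'p rmat \<Rightarrow> real)
     \<Rightarrow> 'p rvec \<Rightarrow> 'p rvec \<Rightarrow> 'p rmat \<Rightarrow> real" where
  "integrated_lik f \<theta> x S =
     (LINT \<Sigma>:{\<Sigma>. posdef \<Sigma>}|sym_lborel. f x S \<theta> \<Sigma> * det \<Sigma> powr (- (real CARD('p) + 1) / 2))"

definition integrated_LRT ::
  "alternative \<Rightarrow> (('p::{finite,linorder}) rvec \<Rightarrow> 'p rmat \<Rightarrow> 'p rvec \<Rightarrow> 'p rmat \<Rightarrow> real)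
     \<Rightarrow> 'p rvec \<Rightarrow> 'p rmat \<Rightarrow> real" where
  "integrated_LRT K f x S =
     (SUP \<theta>\<in>cone K. integrated_lik f \<theta> x S / integrated_lik f 0 x S)"

subsection \<open>The integrated UIT\<close>

text \<open>The factor of proportionality does not involve \<open>\<theta>\<close> and cancels in \<open>dir_ratio\<close>.\<close>

definition dir_lik :: "nat \<Rightarrow> ('p::finite) rvec \<Rightarrow> 'p rvec \<Rightarrow> 'p rmat \<Rightarrow> 'p rvec \<Rightarrow> real" where
  "dir_lik n \<theta> x S b =
     (b \<bullet> (S *v b)) powr (- (real CARD('p) + 1) / 2) *
     (1 + real n * (b \<bullet> (x - \<theta>))\<^sup>2 / (b \<bullet> (S *v b))) powr (- real n / 2)"

definition dir_ratio ::
  "alternative \<Rightarrow> nat \<Rightarrow> ('p::{finite,linorder}) rvec \<Rightarrow> 'p rmat \<Rightarrow> 'p rvec \<Rightarrow> real" where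
  "dir_ratio K n x S b = (SUP \<theta>\<in>cone K. dir_lik n \<theta> x S b / dir_lik n 0 x S b)"

definition directions :: "('p::finite) set \<Rightarrow> 'p rmat \<Rightarrow> 'p rvec set" where
  "directions a S =
     {b. subvec a b \<noteq> 0 \<and>
         subvec (- a) b = - (block_inv (- a) S *v (block (- a) a S *v subvec a b))}"

definition integrated_UIT ::
  "alternative \<Rightarrow> nat \<Rightarrow> ('p::{finite,linorder}) rvec \<Rightarrow> 'p rmat \<Rightarrow> real" where
  "integrated_UIT K n x S =
     (\<Sum>a\<in>family K.
        (if a = {} then 1 else (SUP b\<in>directions a S. dir_ratio K n x S b)) * ind K a x S)"

end

theory Submission
  imports Defs
begin

text \<open>
  By sufficiency \<open>f(x,S|\<theta>,\<Sigma>) = f(x,S|0,I) \<cdot> r\<close> with an explicit likelihood ratio \<open>r\<close>, which as a function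
  of \<open>\<Sigma>\<close> is a multiple of \<open>|\<Sigma>|\<^sup>-\<^sup>n\<^sup>/\<^sup>2 exp (- tr (\<Sigma>\<^sup>-\<^sup>1 A) / 2)\<close> with \<open>A = S + n (x - \<theta>) (x - \<theta>)'\<close>. Invariance
  of the Haar measure under congruence makes the integrated likelihood proportional to
  \<open>|A|\<^sup>-\<^sup>n\<^sup>/\<^sup>2 = |S|\<^sup>-\<^sup>n\<^sup>/\<^sup>2 (1 + n (x - \<theta>)' S\<^sup>-\<^sup>1 (x - \<theta>))\<^sup>-\<^sup>n\<^sup>/\<^sup>2\<close>. Maximising it over the cone is the projection
  of \<open>x\<close> in the metric of \<open>S\<^sup>-\<^sup>1\<close>; the Kuhn--Tucker conditions for the face \<open>a\<close> are exactly the event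
  \<open>I\<^bsub>na\<^esub> = 1\<close>, with minimiser \<open>(x\<^bsub>a:a'\<^esub>, 0)\<close>. The same point annihilates \<open>b'(x - \<theta>)\<close> for every admissible
  direction \<open>b\<close>, and Cauchy--Schwarz does the rest. Both integrated statistics come out as
  \<open>u \<mapsto> (1 + u)\<^sup>n\<^sup>/\<^sup>2\<close> of the original ones.
\<close>

subsection \<open>Positive definite matrices\<close>

text \<open>Both suprema keep (x, S) fixed while \<theta> and \<Sigma> run through uncountably many
  values, whereas a density is determined only almost everywhere for each parameter separately. The
  factorisation is therefore obtained as an almost-everywhere identity and made pointwise by
  continuity on the positive definite cone; this needs that every ball around a symmetric matrix has
  positive measure. Dividing by the integrated likelihood at 0 is meaningful only if the Haar
  integral is neither 0 nor infinite, since the Bochner integral and \<open>enn2real\<close> both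
  turn infinity into 0; n > p enters through this finiteness. Positive definiteness of the scatter
  matrix is derived rather than assumed: its law has a density, and the boundary of the semidefinite
  cone is null. What remains is deterministic, because for positive definite S exactly one face is
  active at every x.\<close>

lemma matrix_inv_mult:
  fixes A :: "real^'n^'n"
  assumes "invertible A"
  shows "A ** matrix_inv A = mat 1" "matrix_inv A ** A = mat 1"
proof -
  have "A ** matrix_inv A = mat 1 \<and> matrix_inv A ** A = mat 1"
    using assms unfolding matrix_inv_def invertible_def by (rule someI_ex)
  then show "A ** matrix_inv A = mat 1" "matrix_inv A ** A = mat 1" by auto
qed

lemma matrix_inv_eqI:
  fixes A B :: "real^'n^'n"
  assumes "A ** B = mat 1"
  shows "matrix_inv A = B"
proof -
  have "invertible A" using assms by (simp add: invertible_right_inverse) blast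
  then have "matrix_inv A ** A = mat 1" by (rule matrix_inv_mult)
  then show ?thesis using assms by (metis matrix_mul_assoc matrix_mul_lid matrix_mul_rid)
qed

lemma matrix_inv_prod:
  fixes A B :: "real^'n^'n"
  assumes "invertible A" "invertible B"
  shows "matrix_inv (A ** B) = matrix_inv B ** matrix_inv A"
proof (rule matrix_inv_eqI)
  have "A ** B ** (matrix_inv B ** matrix_inv A) = A ** (B ** matrix_inv B) ** matrix_inv A"
    by (simp add: matrix_mul_assoc)
  then show "A ** B ** (matrix_inv B ** matrix_inv A) = mat 1"
    using assms by (simp add: matrix_inv_mult)
qed

lemma matrix_inv_transpose:
  fixes A :: "real^'n^'n"
  assumes "invertible A"
  shows "matrix_inv (transpose A) = transpose (matrix_inv A)"
  by (rule matrix_inv_eqI) (metis assms matrix_inv_mult(2) matrix_transpose_mul transpose_mat)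

lemma matrix_inv_mult_vec:
  fixes A :: "real^'n^'n"
  assumes "invertible A"
  shows "A *v (matrix_inv A *v x) = x" "matrix_inv A *v (A *v x) = x"
  using assms by (simp_all add: matrix_vector_mul_assoc matrix_inv_mult)

lemma invertible_matrix_inv:
  fixes A :: "real^'n^'n"
  assumes "invertible A"
  shows "invertible (matrix_inv A)"
  using matrix_inv_mult[OF assms] unfolding invertible_def by blast

lemma dot_matrix_vector_sym:
  fixes A :: "real^'n^'n"
  assumes "transpose A = A"
  shows "x \<bullet> (A *v y) = (A *v x) \<bullet> y"
  by (metis assms dot_lmul_matrix transpose_matrix_vector)

lemma dot_matrix_transpose:
  fixes A :: "real^'n^'m"
  shows "x \<bullet> (A *v y) = (transpose A *v x) \<bullet> y"
  by (metis dot_lmul_matrix transpose_matrix_vector)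

lemma pos_quadratic_imp_invertible:
  fixes A :: "real^'n^'n"
  assumes "\<And>x. x \<noteq> 0 \<Longrightarrow> x \<bullet> (A *v x) > 0"
  shows "invertible A"
proof -
  have "\<forall>x. A *v x = 0 \<longrightarrow> x = 0"
    using assms by (metis inner_zero_right less_irrefl)
  then show ?thesis by (simp add: invertible_left_inverse matrix_left_invertible_ker)
qed

lemma posdef_sym: "posdef A \<Longrightarrow> transpose A = A"
  and posdef_pos: "posdef A \<Longrightarrow> x \<noteq> 0 \<Longrightarrow> x \<bullet> (A *v x) > 0"
  by (auto simp: posdef_def)

lemma posdef_nonneg: "posdef A \<Longrightarrow> x \<bullet> (A *v x) \<ge> 0"
  using posdef_pos[of A x] by (cases "x = 0") auto

lemma posdef_invertible: "posdef A \<Longrightarrow> invertible A"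
  by (rule pos_quadratic_imp_invertible) (rule posdef_pos)

lemma transpose_invertible:
  fixes A :: "real^'n^'n"
  shows "invertible A \<Longrightarrow> invertible (transpose A)"
  by (simp add: invertible_det_nz)

lemma invertible_mult_eq_0:
  fixes A :: "real^'n^'n"
  assumes "invertible A" "A *v x = 0"
  shows "x = 0"
  using assms by (metis matrix_inv_mult_vec(2) matrix_vector_mult_0_right)

lemma posdef_congruence:
  fixes A B :: "'n::finite rmat"
  assumes "posdef A" "invertible B"
  shows "posdef (B ** A ** transpose B)"
  unfolding posdef_def
proof (intro conjI allI impI)
  show "transpose (B ** A ** transpose B) = B ** A ** transpose B"
    using posdef_sym[OF assms(1)] by (simp add: matrix_transpose_mul matrix_mul_assoc)
  fix x :: "real^'n" assume "x \<noteq> 0"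
  then have "transpose B *v x \<noteq> 0"
    using invertible_mult_eq_0[OF transpose_invertible[OF assms(2)]] by blast
  moreover have "x \<bullet> (B ** A ** transpose B *v x) = (transpose B *v x) \<bullet> (A *v (transpose B *v x))"
    by (simp add: dot_matrix_transpose[of x B] flip: matrix_vector_mul_assoc)
  ultimately show "x \<bullet> (B ** A ** transpose B *v x) > 0"
    using posdef_pos[OF assms(1)] by metis
qed

lemma posdef_congruence_iff:
  fixes A B :: "'n::finite rmat"
  assumes "invertible B"
  shows "posdef (B ** A ** transpose B) \<longleftrightarrow> posdef A"
proof
  assume *: "posdef (B ** A ** transpose B)"
  let ?C = "matrix_inv B"
  have "?C ** (B ** A ** transpose B) ** transpose ?C
      = (?C ** B) ** A ** transpose (?C ** B)"
    by (simp add: matrix_transpose_mul matrix_mul_assoc)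
  also have "\<dots> = A" by (simp add: matrix_inv_mult assms transpose_mat)
  finally show "posdef A"
    using posdef_congruence[OF * invertible_matrix_inv[OF assms]] by simp
qed (rule posdef_congruence[OF _ assms])

lemma posdef_mat_1: "posdef (mat 1)"
  by (simp add: posdef_def transpose_mat)

text \<open>Gram-Schmidt for the inner product x'Ay: an A-orthonormal basis, written as the rows of
  \<open>C\<close>, satisfies CAC' = I, and B is the inverse of C. This factor makes questions about
  A Euclidean and carries the congruence arguments below.\<close>

lemma posdef_factor:
  fixes A :: "'n::finite rmat"
  assumes "posdef A"
  obtains B :: "'n rmat" where "invertible B" "A = B ** transpose B"
proof -
  have ortho: "\<exists>b :: 'n \<Rightarrow> real^'n. \<forall>i\<in>K. \<forall>j\<in>K. b i \<bullet> (A *v b j) = (if i = j then 1 else 0)" for K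
    using finite[of K]
  proof (induction K)
    case (insert k K)
    then obtain b :: "'n \<Rightarrow> real^'n"
      where b: "\<forall>i\<in>K. \<forall>j\<in>K. b i \<bullet> (A *v b j) = (if i = j then 1 else 0)" by blast
    \<comment> \<open>Fewer than n vectors \<open>A *v b i\<close> cannot span the space, and a
      vector orthogonal to all of them in the Euclidean sense is A-orthogonal to all the
      \<open>b i\<close>.\<close>
    have "dim ((\<lambda>i. A *v b i) ` K) \<le> card ((\<lambda>i. A *v b i) ` K)"
      by (rule dim_le_card') simp
    also have "\<dots> \<le> card K" by (rule card_image_le) simp
    also have "\<dots> < CARD('n)" by (rule psubset_card_mono) (use insert in auto)
    finally have "dim ((\<lambda>i. A *v b i) ` K) < DIM(real^'n)" by simp
    then obtain v where v: "v \<noteq> 0" "\<And>y. y \<in> span ((\<lambda>i. A *v b i) ` K) \<Longrightarrow> orthogonal v y"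
      using orthogonal_to_subspace_exists by blast
    have vb: "v \<bullet> (A *v b i) = 0" if "i \<in> K" for i
      using v(2)[of "A *v b i"] that by (auto simp: orthogonal_def intro: span_base)
    have bv: "b i \<bullet> (A *v v) = 0" if "i \<in> K" for i
      using vb[OF that] dot_matrix_vector_sym[OF posdef_sym[OF assms]] by (metis inner_commute)
    define c where "c = v \<bullet> (A *v v)"
    have c: "c > 0" unfolding c_def using assms v by (simp add: posdef_pos)
    define b' where "b' = b(k := (1 / sqrt c) *\<^sub>R v)"
    have "b' i \<bullet> (A *v b' j) = (if i = j then 1 else 0)" if "i \<in> insert k K" "j \<in> insert k K" for i j
      using that b vb bv insert(2) c
      by (auto simp: b'_def matrix_vector_mult_scaleR simp flip: c_def)
    then show ?case by blast
  qed auto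
  obtain b :: "'n \<Rightarrow> real^'n" where b: "\<And>i j. b i \<bullet> (A *v b j) = (if i = j then 1 else 0)"
    using ortho[of UNIV] by auto
  define C where "C = (\<chi> i. b i)"
  have C: "C ** A ** transpose C = mat 1"
  proof -
    have "(C ** A ** transpose C) $ i $ j = b i \<bullet> (A *v b j)" for i j
      unfolding C_def matrix_mul_assoc[symmetric]
      by (simp add: matrix_matrix_mult_def matrix_vector_mult_def inner_vec_def transpose_def)
    then show ?thesis by (simp add: vec_eq_iff b mat_def)
  qed
  then have "C ** (A ** transpose C) = mat 1" by (simp add: matrix_mul_assoc)
  then have inv: "invertible C" by (simp add: invertible_right_inverse) blast
  let ?B = "matrix_inv C"
  have "A = (?B ** C) ** A ** transpose (?B ** C)" by (simp add: matrix_inv_mult inv transpose_mat)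
  also have "\<dots> = ?B ** (C ** A ** transpose C) ** transpose ?B"
    by (simp add: matrix_transpose_mul matrix_mul_assoc)
  finally have "A = ?B ** transpose ?B" by (simp add: C)
  then show thesis using invertible_matrix_inv[OF inv] that by blast
qed

lemma posdef_det_pos: "posdef A \<Longrightarrow> det A > 0"
  by (erule posdef_factor) (auto simp: det_mul invertible_det_nz zero_less_mult_iff)

lemma posdef_mult_transpose:
  fixes B :: "'n::finite rmat"
  assumes "invertible B"
  shows "posdef (B ** transpose B)"
  using posdef_congruence[OF posdef_mat_1 assms] by simp

lemma posdef_matrix_inv:
  fixes A :: "'n::finite rmat"
  assumes "posdef A"
  shows "posdef (matrix_inv A)"
proof -
  obtain B :: "'n rmat" where B: "invertible B" "A = B ** transpose B" using posdef_factor[OF assms] .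
  then have "matrix_inv A = transpose (matrix_inv B) ** transpose (transpose (matrix_inv B))"
    by (simp add: matrix_inv_prod matrix_inv_transpose transpose_invertible)
  then show ?thesis
    using posdef_mult_transpose[of "transpose (matrix_inv B)"] B(1)
    by (simp add: transpose_invertible invertible_matrix_inv)
qed

lemma posdef_Cauchy_Schwarz:
  fixes A :: "'n::finite rmat"
  assumes "posdef A"
  shows "(x \<bullet> (A *v y))\<^sup>2 \<le> (x \<bullet> (A *v x)) * (y \<bullet> (A *v y))"
proof -
  obtain B :: "'n rmat" where B: "invertible B" "A = B ** transpose B" using posdef_factor[OF assms] .
  have "u \<bullet> (A *v v) = (transpose B *v u) \<bullet> (transpose B *v v)" for u v
    unfolding B(2) by (simp add: dot_matrix_transpose[of u B] flip: matrix_vector_mul_assoc)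
  then show ?thesis by (simp add: Cauchy_Schwarz_ineq)
qed

section \<open>Frobenius norm, trace and determinant estimates\<close>

lemma norm_matrix_sq: "(norm (A :: real^'n^'m))\<^sup>2 = (\<Sum>i\<in>UNIV. \<Sum>j\<in>UNIV. (A $ i $ j)\<^sup>2)"
  by (simp add: norm_vec_def L2_set_def sum_nonneg)

lemma norm_matrix_sq_trace: "(norm (A :: real^'n^'m))\<^sup>2 = trace (A ** transpose A)"
  unfolding norm_matrix_sq by (simp add: trace_def matrix_matrix_mult_def transpose_def power2_eq_square)

lemma norm_matrix_mult_le:
  fixes A :: "real^'n^'m" and B :: "real^'k^'n"
  shows "norm (A ** B) \<le> norm A * norm B"
proof (rule power2_le_imp_le)
  have "((A ** B) $ i $ j)\<^sup>2 \<le> (\<Sum>l\<in>UNIV. (A $ i $ l)\<^sup>2) * (\<Sum>l\<in>UNIV. (B $ l $ j)\<^sup>2)" for i j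
    unfolding matrix_matrix_mult_def by (simp add: Cauchy_Schwarz_ineq_sum)
  then have "(norm (A ** B))\<^sup>2 \<le> (\<Sum>i\<in>UNIV. \<Sum>j\<in>UNIV. (\<Sum>l\<in>UNIV. (A $ i $ l)\<^sup>2) * (\<Sum>l\<in>UNIV. (B $ l $ j)\<^sup>2))"
    unfolding norm_matrix_sq by (intro sum_mono)
  also have "\<dots> = (norm A)\<^sup>2 * (norm B)\<^sup>2"
    unfolding norm_matrix_sq by (subst (3) sum.swap) (simp add: sum_product)
  finally show "(norm (A ** B))\<^sup>2 \<le> (norm A * norm B)\<^sup>2" by (simp add: power_mult_distrib)
qed (simp)

lemma abs_quadratic_le: "\<bar>x \<bullet> (A *v x)\<bar> \<le> norm (A :: real^'n^'n) * (norm x)\<^sup>2"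
proof -
  have "norm (A *v x) \<le> norm A * norm x"
  proof (rule power2_le_imp_le)
    have "((A *v x) $ i)\<^sup>2 \<le> (\<Sum>l\<in>UNIV. (A $ i $ l)\<^sup>2) * (\<Sum>l\<in>UNIV. (x $ l)\<^sup>2)" for i
      unfolding matrix_vector_mult_def by (simp add: Cauchy_Schwarz_ineq_sum)
    then have "(norm (A *v x))\<^sup>2 \<le> (\<Sum>i\<in>UNIV. (\<Sum>l\<in>UNIV. (A $ i $ l)\<^sup>2) * (\<Sum>l\<in>UNIV. (x $ l)\<^sup>2))"
      by (simp add: norm_vec_def L2_set_def sum_nonneg sum_mono)
    also have "\<dots> = (norm A)\<^sup>2 * (norm x)\<^sup>2"
      unfolding norm_matrix_sq by (simp add: norm_vec_def L2_set_def sum_nonneg sum_distrib_right)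
    finally show "(norm (A *v x))\<^sup>2 \<le> (norm A * norm x)\<^sup>2" by (simp add: power_mult_distrib)
  qed simp
  then have "norm x * norm (A *v x) \<le> norm x * (norm A * norm x)"
    by (intro mult_left_mono) auto
  then show ?thesis
    using Cauchy_Schwarz_ineq2[of x "A *v x"] by (simp add: power2_eq_square mult_ac)
qed

text \<open>With S = TT' and V = RR', write R as the inverse of T' times T'R. Submultiplicativity of
  the Frobenius norm gives the bound, since the squared norms of the three matrices are the three
  traces. It later trades decay of the Haar integrand in S^{-1} for decay in V.\<close>

lemma trace_le_trace_inv_mult:
  fixes S V :: "'n::finite rmat"
  assumes "posdef S" "posdef V"
  shows "trace V \<le> trace (matrix_inv S) * trace (S ** V)"
proof -
  obtain T :: "'n rmat" where T: "invertible T" "S = T ** transpose T" using posdef_factor[OF assms(1)] .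
  obtain R :: "'n rmat" where R: "invertible R" "V = R ** transpose R" using posdef_factor[OF assms(2)] .
  let ?U = "matrix_inv (transpose T)"
  have U: "matrix_inv S = ?U ** transpose ?U"
    using T by (simp add: matrix_inv_prod transpose_invertible matrix_inv_transpose)
  have "R = ?U ** (transpose T ** R)"
    using T(1) by (simp add: matrix_mul_assoc matrix_inv_mult transpose_invertible)
  then have "norm R \<le> norm ?U * norm (transpose T ** R)"
    by (metis norm_matrix_mult_le)
  then have "(norm R)\<^sup>2 \<le> (norm ?U)\<^sup>2 * (norm (transpose T ** R))\<^sup>2"
    by (metis norm_ge_zero power_mono power_mult_distrib)
  moreover have "(norm (transpose T ** R))\<^sup>2 = trace (S ** V)"
  proof -
    have "(norm (transpose T ** R))\<^sup>2 = trace (transpose T ** (R ** transpose R ** T))"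
      by (simp add: norm_matrix_sq_trace matrix_transpose_mul matrix_mul_assoc)
    also have "\<dots> = trace (R ** transpose R ** T ** transpose T)"
      by (rule trace_mul_sym)
    also have "\<dots> = trace (V ** S)" by (simp add: R T matrix_mul_assoc)
    finally show ?thesis using trace_mul_sym[of V S] by simp
  qed
  moreover have "trace V = (norm R)\<^sup>2" "trace (matrix_inv S) = (norm ?U)\<^sup>2"
    by (simp_all only: U R(2) norm_matrix_sq_trace)
  ultimately show ?thesis by simp
qed

text \<open>V = RR' is a Gram matrix, so its entries are inner products of rows of R, whose norms
  are at most the Frobenius norm of R. The trace thus controls the whole matrix, which bounds the
  kernel set and supplies the majorant in \<open>gamma_integral_finite\<close>.\<close>

lemma posdef_entry_le_trace:
  fixes V :: "'n::finite rmat"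
  assumes "posdef V"
  shows "\<bar>V $ i $ j\<bar> \<le> trace V"
proof -
  obtain R :: "'n rmat" where R: "invertible R" "V = R ** transpose R" using posdef_factor[OF assms] .
  have n: "trace V = (norm R)\<^sup>2" by (simp add: R norm_matrix_sq_trace)
  have "V $ i $ j = (R $ i) \<bullet> (R $ j)"
    by (simp add: R matrix_matrix_mult_def transpose_def inner_vec_def)
  then have "\<bar>V $ i $ j\<bar> \<le> norm (R $ i) * norm (R $ j)" by (simp add: Cauchy_Schwarz_ineq2)
  also have "\<dots> \<le> norm R * norm R" by (intro mult_mono Finite_Cartesian_Product.norm_nth_le) auto
  finally show ?thesis by (simp add: n power2_eq_square)
qed

lemma posdef_trace_nonneg: "posdef V \<Longrightarrow> trace V \<ge> 0"
  using posdef_entry_le_trace[of V undefined undefined] by linarith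

lemma abs_det_le:
  fixes A :: "real^'n^'n"
  assumes "\<And>i j. \<bar>A $ i $ j\<bar> \<le> t"
  shows "\<bar>det A\<bar> \<le> fact CARD('n) * t ^ CARD('n)"
proof -
  have "\<bar>det A\<bar> \<le> (\<Sum>p | p permutes (UNIV::'n set). \<bar>of_int (sign p) * (\<Prod>i\<in>UNIV. A $ i $ p i)\<bar>)"
    unfolding det_def by (rule sum_abs)
  also have "\<dots> \<le> (\<Sum>p | p permutes (UNIV::'n set). t ^ CARD('n))"
  proof (rule sum_mono)
    fix p :: "'n \<Rightarrow> 'n"
    have "(\<Prod>i\<in>UNIV. \<bar>A $ i $ p i\<bar>) \<le> (\<Prod>i\<in>(UNIV::'n set). t)"
      by (rule prod_mono) (auto simp: assms)
    then show "\<bar>of_int (sign p) * (\<Prod>i\<in>UNIV. A $ i $ p i)\<bar> \<le> t ^ CARD('n)"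
      by (simp add: abs_mult abs_prod sign_def)
  qed
  also have "\<dots> = fact CARD('n) * t ^ CARD('n)"
    by (simp add: card_permutations)
  finally show ?thesis .
qed

text \<open>The minimum e of the quadratic form on the unit sphere is positive by compactness, and a
  perturbation of Frobenius norm below e cannot cancel it. Openness is relative to the symmetric
  matrices because \<open>posdef\<close> includes symmetry.\<close>

lemma posdef_open_in_symmetric:
  fixes A :: "'n::finite rmat"
  assumes "posdef A"
  obtains e where "e > 0" "\<And>B. transpose B = B \<Longrightarrow> dist B A < e \<Longrightarrow> posdef B"
proof -
  have "compact (sphere (0::real^'n) 1)" "sphere (0::real^'n) 1 \<noteq> {}" by auto
  moreover have "continuous_on (sphere (0::real^'n) 1) (\<lambda>x. x \<bullet> (A *v x))"
    by (intro continuous_intros matrix_vector_mult_linear_continuous_on)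
  ultimately have "\<exists>z\<in>sphere 0 1. \<forall>x\<in>sphere 0 1. z \<bullet> (A *v z) \<le> x \<bullet> (A *v x)"
    by (rule continuous_attains_inf)
  then obtain z where z: "z \<in> sphere 0 1" "\<And>x. x \<in> sphere 0 1 \<Longrightarrow> z \<bullet> (A *v z) \<le> x \<bullet> (A *v x)"
    by blast
  define e where "e = z \<bullet> (A *v z)"
  have "e > 0" unfolding e_def using z assms by (intro posdef_pos) auto
  moreover have "posdef B" if B: "transpose B = B" "dist B A < e" for B
    unfolding posdef_def
  proof (intro conjI allI impI B)
    fix x :: "real^'n" assume x: "x \<noteq> 0"
    have "e \<le> ((1 / norm x) *\<^sub>R x) \<bullet> (A *v ((1 / norm x) *\<^sub>R x))"
      unfolding e_def by (rule z(2)) (simp add: x)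
    also have "\<dots> = (x \<bullet> (A *v x)) / (norm x)\<^sup>2"
      by (simp add: matrix_vector_mult_scaleR power2_eq_square)
    finally have 1: "e * (norm x)\<^sup>2 \<le> x \<bullet> (A *v x)"
      using x by (simp add: pos_le_divide_eq)
    have "\<bar>x \<bullet> ((B - A) *v x)\<bar> \<le> norm (B - A) * (norm x)\<^sup>2" by (rule abs_quadratic_le)
    also have "\<dots> < e * (norm x)\<^sup>2" using B(2) x by (intro mult_strict_right_mono) (auto simp: dist_norm)
    finally have "- (x \<bullet> ((B - A) *v x)) < e * (norm x)\<^sup>2" by linarith
    moreover have "x \<bullet> ((B - A) *v x) = x \<bullet> (B *v x) - x \<bullet> (A *v x)"
      by (simp add: matrix_vector_mult_diff_rdistrib inner_diff_right)
    ultimately show "x \<bullet> (B *v x) > 0" using 1 by linarith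
  qed
  ultimately show thesis using that by blast
qed

text \<open>The closed counterpart of \<open>posdef\<close>: every scatter matrix lies in it, and
  \<open>posdef\<close> becomes a difference of two closed sets, which settles its
  measurability.\<close>

definition psd :: "('p::finite) rmat \<Rightarrow> bool" where
  "psd A \<longleftrightarrow> transpose A = A \<and> (\<forall>x. x \<bullet> (A *v x) \<ge> 0)"

text \<open>If the form vanished at x, moving from x by a small multiple of -Ax would make it
  negative, because the first-order change is proportional to -|Ax|^2.\<close>

lemma psd_invertible_imp_posdef:
  assumes "psd A" "invertible A"
  shows "posdef A"
  unfolding posdef_def
proof (intro conjI allI impI)
  show sym: "transpose A = A" using assms(1) by (simp add: psd_def)
  fix x :: "real^'a" assume x: "x \<noteq> 0"
  have ge: "y \<bullet> (A *v y) \<ge> 0" for y using assms(1) by (simp add: psd_def)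
  show "x \<bullet> (A *v x) > 0"
  proof (rule ccontr)
    assume "\<not> x \<bullet> (A *v x) > 0"
    then have 0: "x \<bullet> (A *v x) = 0" using ge[of x] by linarith
    let ?y = "A *v x" let ?c = "?y \<bullet> (A *v ?y)"
    have ny: "?y \<bullet> ?y > 0"
      using invertible_mult_eq_0[OF assms(2)] x by auto
    have exp: "(x + t *\<^sub>R ?y) \<bullet> (A *v (x + t *\<^sub>R ?y)) = 2 * t * (?y \<bullet> ?y) + t\<^sup>2 * ?c" for t
      using 0 dot_matrix_vector_sym[OF sym, of x ?y]
      by (simp add: matrix_vector_right_distrib matrix_vector_mult_scaleR inner_add_left inner_add_right
          power2_eq_square algebra_simps)
    have "?c \<ge> 0" by (rule ge)
    \<comment> \<open>This step length keeps the quadratic term below the linear one; the summand 1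
      covers the case that \<open>?c\<close> is 0.\<close>
    define t where "t = - (?y \<bullet> ?y) / (?c + 1)"
    have "t < 0" using ny \<open>?c \<ge> 0\<close> by (simp add: t_def divide_neg_pos)
    have "0 \<le> t * (2 * (?y \<bullet> ?y) + t * ?c)"
      using ge[of "x + t *\<^sub>R ?y"] unfolding exp by (simp add: power2_eq_square algebra_simps)
    then have "2 * (?y \<bullet> ?y) + t * ?c \<le> 0" using \<open>t < 0\<close> by (simp add: zero_le_mult_iff)
    moreover have "t * ?c \<ge> - (?y \<bullet> ?y)"
    proof -
      have "(?y \<bullet> ?y) * (?c / (?c + 1)) \<le> (?y \<bullet> ?y) * 1"
        using \<open>?c \<ge> 0\<close> ny by (intro mult_left_mono) (auto simp: field_simps)
      then show ?thesis by (simp add: t_def)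
    qed
    ultimately show False using ny by linarith
  qed
qed

lemma posdef_iff_psd_det: "posdef A \<longleftrightarrow> psd A \<and> det A \<noteq> 0"
  using psd_invertible_imp_posdef posdef_nonneg posdef_det_pos posdef_sym
  by (metis invertible_det_nz less_irrefl psd_def)

section \<open>Continuity and measurability of matrix operations\<close>

lemma continuous_on_transpose [continuous_intros]:
  fixes f :: "'a::topological_space \<Rightarrow> real^'n^'m"
  shows "continuous_on S f \<Longrightarrow> continuous_on S (\<lambda>x. transpose (f x))"
  unfolding transpose_def by (intro continuous_intros)

lemma continuous_on_det [continuous_intros]:
  fixes f :: "'a::topological_space \<Rightarrow> real^'n^'n"
  shows "continuous_on S f \<Longrightarrow> continuous_on S (\<lambda>x. det (f x))"
  unfolding det_def by (intro continuous_intros)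

lemma continuous_on_matrix_mult [continuous_intros]:
  fixes f :: "'a::topological_space \<Rightarrow> real^'n^'m" and g :: "'a \<Rightarrow> real^'k^'n"
  shows "continuous_on S f \<Longrightarrow> continuous_on S g \<Longrightarrow> continuous_on S (\<lambda>x. f x ** g x)"
  unfolding matrix_matrix_mult_def by (intro continuous_intros)

lemma continuous_on_matrix_vector_mult [continuous_intros]:
  fixes f :: "'a::topological_space \<Rightarrow> real^'n^'m" and g :: "'a \<Rightarrow> real^'n"
  shows "continuous_on S f \<Longrightarrow> continuous_on S g \<Longrightarrow> continuous_on S (\<lambda>x. f x *v g x)"
  unfolding matrix_vector_mult_def by (intro continuous_intros)

lemma continuous_on_trace [continuous_intros]:
  fixes f :: "'a::topological_space \<Rightarrow> real^'n^'n"
  shows "continuous_on S f \<Longrightarrow> continuous_on S (\<lambda>x. trace (f x))"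
  unfolding trace_def by (intro continuous_intros)

text \<open>By Cramer's rule the entries of the inverse, collected in \<open>c\<close>, are
  quotients of determinants with nonvanishing denominator.\<close>

lemma continuous_on_matrix_inv:
  "continuous_on {A :: real^'n^'n. invertible A} matrix_inv"
proof -
  define c :: "real^'n^'n \<Rightarrow> real^'n^'n" where
    "c A = (\<chi> k l. det (\<chi> i j. if j = k then axis l 1 $ i else A $ i $ j) / det A)" for A
  have eq: "matrix_inv A = c A" if "invertible A" for A :: "real^'n^'n"
  proof -
    have "matrix_inv A *v axis l 1 = (\<chi> k. det (\<chi> i j. if j = k then axis l 1 $ i else A $ i $ j) / det A)" for l
    proof -
      have "A *v (matrix_inv A *v axis l 1) = axis l 1" using that by (simp add: matrix_inv_mult_vec)
      then show ?thesis using cramer[of A "matrix_inv A *v axis l 1" "axis l 1"] that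
        by (simp add: invertible_det_nz)
    qed
    then show ?thesis
      by (simp add: matrix_vector_mult_basis column_def vec_eq_iff c_def)
  qed
  have "continuous_on {A :: real^'n^'n. invertible A} c"
  proof -
    have "continuous_on {A :: real^'n^'n. invertible A} (\<lambda>A. if j = k then u else A $ i $ j)" for i j k u
      by (cases "j = k") (auto intro!: continuous_intros)
    then show ?thesis unfolding c_def by (intro continuous_intros) (auto simp: invertible_det_nz)
  qed
  then show ?thesis by (rule continuous_on_eq) (simp add: eq)
qed

lemma closed_psd: "closed {A. psd (A :: ('n::finite) rmat)}"
proof -
  have "{A. psd (A :: 'n rmat)} = {A. transpose A = A} \<inter> (\<Inter>x. {A. x \<bullet> (A *v x) \<ge> 0})"
    by (auto simp: psd_def)
  moreover have "closed {A :: 'n rmat. transpose A = A}"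
    by (intro closed_Collect_eq continuous_intros)
  moreover have "closed {A :: 'n rmat. x \<bullet> (A *v x) \<ge> 0}" for x
    by (intro closed_Collect_le continuous_intros)
  ultimately show ?thesis by (metis (no_types, lifting) closed_Int closed_INT)
qed

lemma posdef_borel [measurable]: "{A. posdef (A :: ('n::finite) rmat)} \<in> sets borel"
proof -
  have "{A. posdef (A :: 'n rmat)} = {A. psd A} - {A. det A = 0}"
    by (auto simp: posdef_iff_psd_det)
  moreover have "closed {A :: 'n rmat. det A = 0}" by (intro closed_Collect_eq continuous_intros)
  ultimately show ?thesis using closed_psd by (metis sets.Diff borel_closed)
qed

text \<open>The matrix determinant lemma. After factoring A = BB', an orthogonal Q rotates w =
  B^{-1} d onto a coordinate axis, so that the sum is congruent by BQ to a diagonal matrix with the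
  single nontrivial entry 1 + c|w|^2.\<close>

lemma det_add_rank_one:
  fixes A :: "'n::finite rmat" and d :: "'n rvec"
  assumes "posdef A" "c \<ge> 0"
  defines "R \<equiv> A + c *\<^sub>R (\<chi> i j. d $ i * d $ j)"
  shows "posdef R" "det R = det A * (1 + c * (d \<bullet> (matrix_inv A *v d)))"
proof -
  have outer_mult: "((\<chi> i j. u $ i * u $ j) :: 'n rmat) *v x = (u \<bullet> x) *\<^sub>R u" for u x :: "real^'n"
    by (simp add: vec_eq_iff matrix_vector_mult_def inner_vec_def sum_distrib_left sum_distrib_right mult_ac)
  show "posdef R"
    unfolding posdef_def
  proof (intro conjI allI impI)
    show "transpose R = R" using posdef_sym[OF assms(1)]
      by (simp add: R_def transpose_def vec_eq_iff mult_ac)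
    fix x :: "real^'n" assume "x \<noteq> 0"
    have "x \<bullet> (R *v x) = x \<bullet> (A *v x) + c * (d \<bullet> x)\<^sup>2"
      by (simp add: R_def matrix_vector_mult_add_rdistrib scaleR_matrix_vector_assoc[symmetric] outer_mult
          inner_add_right power2_eq_square inner_commute)
    then show "x \<bullet> (R *v x) > 0" using posdef_pos[OF assms(1) \<open>x \<noteq> 0\<close>] assms(2)
      by (simp add: add_pos_nonneg)
  qed
  obtain B :: "'n rmat" where B: "invertible B" "A = B ** transpose B" using posdef_factor[OF assms(1)] .
  define w where "w = matrix_inv B *v d"
  have dw: "d = B *v w" using B by (simp add: w_def matrix_inv_mult_vec)
  have quad: "d \<bullet> (matrix_inv A *v d) = (norm w)\<^sup>2"
  proof -
    have "matrix_inv A *v d = transpose (matrix_inv B) *v w"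
      unfolding w_def B(2) using B(1)
      by (simp add: matrix_inv_prod transpose_invertible matrix_inv_transpose matrix_vector_mul_assoc)
    then have "d \<bullet> (matrix_inv A *v d) = w \<bullet> w"
      using dot_matrix_transpose[of d "transpose (matrix_inv B)" w] unfolding w_def by simp
    then show ?thesis by (simp add: power2_norm_eq_inner)
  qed
  obtain Q k where Q: "orthogonal_matrix Q" "Q *v (norm w *\<^sub>R axis k 1) = w"
  proof (cases "w = 0")
    case True
    then show ?thesis using that[of "mat 1"] by (simp add: orthogonal_matrix_id)
  next
    case False
    then have "norm ((1 / norm w) *\<^sub>R w) = 1" by simp
    then obtain Q where "orthogonal_matrix Q" "Q *v (axis (undefined::'n) 1) = (1 / norm w) *\<^sub>R w"
      using orthogonal_matrix_exists_basis by blast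
    then show ?thesis using that[of Q undefined] False by (simp add: matrix_vector_mult_scaleR)
  qed
  define D :: "'n rmat" where "D = mat 1 + c *\<^sub>R (\<chi> i j. (norm w *\<^sub>R axis k 1) $ i * (norm w *\<^sub>R axis k 1) $ j)"
  have "R = (B ** Q) ** D ** transpose (B ** Q)"
  proof -
    \<comment> \<open>The matrices are compared as maps on vectors, where a rank-one matrix acts
      through an inner product.\<close>
    have e: "((B ** Q) ** D ** transpose (B ** Q)) *v x = R *v x" for x
    proof -
      have QQ: "Q ** transpose Q = mat 1" using Q(1) by (simp add: orthogonal_matrix_def)
      define e where "e = norm w *\<^sub>R axis k (1::real)"
      have BQ: "(B ** Q) *v e = d"
        using Q(2) dw by (simp add: e_def flip: matrix_vector_mul_assoc)
      have "D *v y = y + (c * (e \<bullet> y)) *\<^sub>R e" for y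
        unfolding D_def e_def[symmetric]
        by (simp add: matrix_vector_mult_add_rdistrib scaleR_matrix_vector_assoc[symmetric] outer_mult)
      then have "((B ** Q) ** D ** transpose (B ** Q)) *v x =
          (B ** Q) *v (transpose (B ** Q) *v x) + (c * (e \<bullet> (transpose (B ** Q) *v x))) *\<^sub>R d"
        by (simp add: matrix_vector_right_distrib matrix_vector_mult_scaleR BQ
            flip: matrix_vector_mul_assoc[of "(B ** Q) ** D"] matrix_vector_mul_assoc[of "B ** Q" D])
      also have "(B ** Q) *v (transpose (B ** Q) *v x) = A *v x"
      proof -
        have "B ** Q ** transpose (B ** Q) = B ** (Q ** transpose Q) ** transpose B"
          by (simp only: matrix_transpose_mul matrix_mul_assoc)
        then show ?thesis by (simp only: matrix_vector_mul_assoc QQ B(2) matrix_mul_rid)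
      qed
      also have "e \<bullet> (transpose (B ** Q) *v x) = d \<bullet> x"
        using dot_matrix_transpose[of e "transpose (B ** Q)" x] BQ by simp
      finally show ?thesis
        by (simp add: R_def matrix_vector_mult_add_rdistrib scaleR_matrix_vector_assoc[symmetric] outer_mult)
    qed
    then show ?thesis by (metis matrix_eq)
  qed
  then have "det R = (det B)\<^sup>2 * (det Q)\<^sup>2 * det D"
    by (simp add: det_mul power2_eq_square mult_ac)
  also have "(det Q)\<^sup>2 = 1" using det_orthogonal_matrix[OF Q(1)] by auto
  also have "det D = (\<Prod>i\<in>UNIV. D $ i $ i)"
    by (rule det_diagonal) (auto simp: D_def mat_def axis_def)
  also have "\<dots> = (\<Prod>i\<in>UNIV. if i = k then 1 + c * (norm w)\<^sup>2 else 1)"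
    by (rule prod.cong) (auto simp: D_def mat_def axis_def power2_eq_square)
  also have "\<dots> = 1 + c * (norm w)\<^sup>2" by simp
  also have "(det B)\<^sup>2 = det A" by (simp add: B(2) det_mul power2_eq_square)
  finally show "det R = det A * (1 + c * (d \<bullet> (matrix_inv A *v d)))" by (simp add: quad)
qed

subsection \<open>Partitioned quadratic forms and the optimality conditions\<close>

lemma subvec_nth [simp]: "subvec a x $ i = (if i \<in> a then x $ i else 0)"
  by (simp add: subvec_def)

lemma subvec_simps [simp]:
  "subvec a (subvec a x) = subvec a x" "subvec a (x + y) = subvec a x + subvec a y"
  "subvec a (x - y) = subvec a x - subvec a y" "subvec a (- x) = - subvec a x" "subvec a 0 = 0"
  "subvec (- a) (subvec a x) = 0" "subvec a (subvec (- a) x) = 0" "subvec UNIV x = x" "subvec {} x = 0"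
  by (auto simp: vec_eq_iff)

lemma subvec_split: "subvec a x + subvec (- a) x = x"
  by (auto simp: vec_eq_iff)

lemma subvec_inner: "subvec a x \<bullet> y = x \<bullet> subvec a y" "subvec a x \<bullet> y = subvec a x \<bullet> subvec a y"
  by (auto simp: inner_vec_def intro!: sum.cong)

lemma subvec_orthogonal:
  assumes "subvec a x = x" "subvec (- a) y = y"
  shows "x \<bullet> y = 0"
proof -
  have "x \<bullet> y = x \<bullet> subvec a (subvec (- a) y)" using assms by (metis subvec_inner(1))
  then show ?thesis by simp
qed

lemma block_mult_vec: "block a c A *v x = subvec a (A *v subvec c x)"
proof -
  have "(block a c A *v x) $ i = subvec a (A *v subvec c x) $ i" for i
    by (auto simp: block_def matrix_vector_mult_def intro!: sum.cong)
  then show ?thesis by (simp add: vec_eq_iff)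
qed

text \<open>Padding makes S_cc v = w_c a condition on full vectors: v is supported in c, and Sv
  agrees with w on c. Positivity is asked only of vectors supported in c, since the lemma also
  serves for \<open>scatter_given a S\<close>, which vanishes outside its block a.\<close>

lemma block_inv_char:
  assumes pos: "\<And>v. subvec c v = v \<Longrightarrow> v \<noteq> 0 \<Longrightarrow> v \<bullet> (S *v v) > 0"
  shows "v = block_inv c S *v subvec c w \<longleftrightarrow> subvec c v = v \<and> subvec c (S *v v) = subvec c w"
proof -
  define D where "D = block c c S + block (- c) (- c) (mat 1)"
  have D: "D *v u = subvec c (S *v subvec c u) + subvec (- c) u" for u
    by (simp add: D_def matrix_vector_mult_add_rdistrib block_mult_vec)
  have "u \<bullet> (D *v u) > 0" if "u \<noteq> 0" for u
  proof -
    have "u \<bullet> (D *v u) = subvec c u \<bullet> (S *v subvec c u) + subvec (- c) u \<bullet> subvec (- c) u"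
      by (simp add: D inner_add_right subvec_inner(1)[symmetric])
    moreover have "subvec c u \<noteq> 0 \<or> subvec (- c) u \<noteq> 0"
      using that subvec_split[of c u] by force
    moreover have "subvec c u \<bullet> (S *v subvec c u) \<ge> 0"
      using pos[of "subvec c u"] by (cases "subvec c u = 0") auto
    ultimately show ?thesis using pos[of "subvec c u"]
      by (metis add_nonneg_pos add_pos_nonneg inner_ge_zero inner_gt_zero_iff subvec_simps(1))
  qed
  then have inv: "invertible D" by (rule pos_quadratic_imp_invertible)
  define u where "u = matrix_inv D *v subvec c w"
  have Du: "D *v u = subvec c w" unfolding u_def using inv by (simp add: matrix_inv_mult_vec)
  have "subvec (- c) (D *v u) = subvec (- c) u"
    unfolding D by (simp add: vec_eq_iff)
  then have "subvec (- c) u = 0" unfolding Du by (simp add: vec_eq_iff)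
  then have u: "subvec c u = u" using subvec_split[of c u] by simp
  have bu: "block_inv c S *v subvec c w = u"
    unfolding block_inv_def D_def[symmetric] block_mult_vec by (simp add: u_def[symmetric] u)
  have Su: "subvec c (S *v u) = subvec c w"
    using Du unfolding D u using \<open>subvec (- c) u = 0\<close> by simp
  have "v = u" if "subvec c v = v" "subvec c (S *v v) = subvec c w"
  proof (rule ccontr)
    assume "v \<noteq> u"
    then have "(v - u) \<bullet> (S *v (v - u)) > 0" using that u by (intro pos) auto
    also have "(v - u) \<bullet> (S *v (v - u)) = (v - u) \<bullet> subvec c (S *v (v - u))"
      using that u subvec_inner(1)[of c "v - u"] by simp
    finally show False using that Su by (simp add: matrix_vector_mult_diff_distrib)
  qed
  then show ?thesis using bu u Su by auto
qed

lemma block_inv_char_posdef: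
  assumes "posdef S"
  shows "v = block_inv c S *v subvec c w \<longleftrightarrow> subvec c v = v \<and> subvec c (S *v v) = subvec c w"
  using assms by (intro block_inv_char) (simp add: posdef_pos)

text \<open>
  \<open>multiplier a x S\<close> is the Kuhn--Tucker multiplier \<open>S\<^sup>-\<^sup>1 (x - \<theta>)\<close> at the candidate
  \<open>\<theta> = mean_given a x S\<close> for the minimiser of \<open>(x - \<theta>)' S\<^sup>-\<^sup>1 (x - \<theta>)\<close>.
\<close>

definition multiplier :: "('p::finite) set \<Rightarrow> 'p rvec \<Rightarrow> 'p rmat \<Rightarrow> 'p rvec" where
  "multiplier a x S = block_inv (- a) S *v subvec (- a) x"

lemma multiplier:
  assumes "posdef S"
  shows "subvec (- a) (multiplier a x S) = multiplier a x S"
    and "subvec a (mean_given a x S) = mean_given a x S"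
    and "S *v multiplier a x S = x - mean_given a x S"
proof -
  let ?l = "multiplier a x S"
  have l: "subvec (- a) ?l = ?l" "subvec (- a) (S *v ?l) = subvec (- a) x"
    using block_inv_char_posdef[OF assms, of ?l "- a" x] by (auto simp: multiplier_def)
  have m: "mean_given a x S = subvec a (x - S *v ?l)"
    unfolding mean_given_def multiplier_def[symmetric] block_mult_vec by (simp add: l)
  show "subvec (- a) ?l = ?l" "subvec a (mean_given a x S) = mean_given a x S"
    using l m by simp_all
  show "S *v ?l = x - mean_given a x S"
  proof -
    have "x - subvec a x = subvec (- a) x" "subvec a (S *v ?l) + subvec (- a) x = S *v ?l"
      using subvec_split[of a "S *v ?l"] subvec_split[of a x] by (auto simp: l(2) algebra_simps)
    then show ?thesis unfolding m subvec_simps(3) by (metis add.commute diff_diff_eq2 diff_add_eq)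
  qed
qed

text \<open>A decomposition x = t + Sl with complementary supports determines both parts: outside a
  it is a linear system for l whose matrix is a principal block of S. In \<open>ex1_ind\<close> this
  recognises the projection as the candidate of its face.\<close>

lemma multiplier_unique:
  assumes "posdef S" "subvec (- a) l = l" "subvec a t = t" "S *v l = x - t"
  shows "multiplier a x S = l" "mean_given a x S = t"
proof -
  have "subvec (- a) (S *v l) = subvec (- a) x"
    using assms(3,4) by (metis diff_zero subvec_simps(3) subvec_simps(6))
  then show l: "multiplier a x S = l"
    using block_inv_char_posdef[OF assms(1), of l "- a" x] assms(2) by (simp add: multiplier_def)
  show "mean_given a x S = t"
    using multiplier(3)[OF assms(1), of a x] unfolding l assms(4) by simp
qed

text \<open>Block elimination: the coordinates of w outside a are chosen so that Sw vanishes outside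
  a, and on such vectors S acts as its Schur complement. The elements of
  \<open>directions a S\<close> have the same form.\<close>

lemma scatter_given_mult_vec:
  assumes "posdef S" "subvec a v = v"
  defines "w \<equiv> v - block_inv (- a) S *v subvec (- a) (S *v v)"
  shows "subvec a w = v" "S *v w = scatter_given a S *v v" "subvec a (S *v w) = S *v w"
proof -
  let ?l = "block_inv (- a) S *v subvec (- a) (S *v v)"
  have l: "subvec (- a) ?l = ?l" "subvec (- a) (S *v ?l) = subvec (- a) (S *v v)"
    using block_inv_char_posdef[OF assms(1), of ?l "- a" "S *v v"] by auto
  have "subvec a ?l = 0" using l(1) by (metis subvec_simps(7))
  then show "subvec a w = v" by (simp add: w_def assms(2))
  have 0: "subvec (- a) (S *v w) = 0"
    unfolding w_def by (simp add: matrix_vector_mult_diff_distrib l(2))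
  then show "subvec a (S *v w) = S *v w" using subvec_split[of a "S *v w"] by simp
  moreover have "scatter_given a S *v v = subvec a (S *v w)"
    unfolding scatter_given_def w_def
    by (simp add: matrix_vector_mult_diff_rdistrib block_mult_vec assms(2) l(1) matrix_vector_mult_diff_distrib
        flip: matrix_vector_mul_assoc)
  ultimately show "S *v w = scatter_given a S *v v" by simp
qed

text \<open>The (a, a) block of S^{-1} is the inverse of the Schur complement. Block elimination
  produces w with Sw = \<open>mean_given a x S\<close>, and on a this w agrees with the vector built
  from the block inverse.\<close>

lemma quad_given_eq:
  assumes "posdef S"
  shows "quad_given a x S = mean_given a x S \<bullet> (matrix_inv S *v mean_given a x S)"
proof -
  let ?G = "scatter_given a S" and ?t = "mean_given a x S"
  have pos: "v \<bullet> (?G *v v) > 0" if v: "subvec a v = v" "v \<noteq> 0" for v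
  proof -
    define w where "w = v - block_inv (- a) S *v subvec (- a) (S *v v)"
    note w = scatter_given_mult_vec[OF assms v(1), folded w_def]
    have "w \<noteq> 0" using w(1) v(2) by force
    have "v \<bullet> (?G *v v) = subvec a w \<bullet> (S *v w)" by (simp add: w)
    also have "\<dots> = w \<bullet> (S *v w)" by (metis subvec_inner(1) w(3))
    finally show ?thesis using posdef_pos[OF assms \<open>w \<noteq> 0\<close>] by simp
  qed
  define m where "m = block_inv a ?G *v subvec a ?t"
  have m: "subvec a m = m" "subvec a (?G *v m) = subvec a ?t"
    using block_inv_char[OF pos, of a m ?t] by (auto simp: m_def)
  define w where "w = m - block_inv (- a) S *v subvec (- a) (S *v m)"
  note w = scatter_given_mult_vec[OF assms m(1), folded w_def]
  have "S *v w = ?t" using w m(2) multiplier(2)[OF assms] by metis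
  then have "matrix_inv S *v ?t = w"
    using matrix_inv_mult_vec(2)[OF posdef_invertible[OF assms]] by metis
  moreover have "?t \<bullet> w = ?t \<bullet> m"
    using w(1) multiplier(2)[OF assms] by (metis subvec_inner(1))
  ultimately show ?thesis
    unfolding quad_given_def by (simp add: m_def multiplier(2)[OF assms])
qed

lemma quad_given_nonneg: "posdef S \<Longrightarrow> quad_given a x S \<ge> 0"
  by (simp add: quad_given_eq posdef_nonneg posdef_matrix_inv)

text \<open>Expand x - t = Sl - d with l the multiplier and d = t - \<open>mean_given a x S\<close>.
  The first term is free of t, the cross term is nonnegative on the cone by
  \<open>ind_optimality\<close>, and so is the last, which identifies the minimum.\<close>

lemma quad_split:
  assumes "posdef S"
  shows "(x - t) \<bullet> (matrix_inv S *v (x - t))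
       = subvec (- a) x \<bullet> multiplier a x S - 2 * (multiplier a x S \<bullet> (t - mean_given a x S))
         + (t - mean_given a x S) \<bullet> (matrix_inv S *v (t - mean_given a x S))"
proof -
  define l where "l = multiplier a x S"
  define d where "d = t - mean_given a x S"
  note m = multiplier[OF assms, where a = a and x = x, folded l_def]
  have x: "x - t = S *v l - d" using m(3) by (simp add: d_def)
  have "subvec (- a) x \<bullet> l = (S *v l) \<bullet> l"
  proof -
    have "subvec (- a) (S *v l) = subvec (- a) x" by (metis m(2) m(3) diff_zero subvec_simps(3,6))
    then show ?thesis using m(1) by (metis subvec_inner(1))
  qed
  moreover have "matrix_inv S *v (S *v l) = l"
    by (simp add: matrix_inv_mult_vec posdef_invertible assms)
  moreover have "(S *v l) \<bullet> (matrix_inv S *v d) = l \<bullet> d"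
    using dot_matrix_vector_sym[OF posdef_sym[OF posdef_matrix_inv[OF assms]], of "S *v l" d]
    by (simp add: matrix_inv_mult_vec posdef_invertible assms)
  ultimately show ?thesis unfolding x l_def[symmetric] d_def[symmetric]
    by (simp add: matrix_vector_mult_diff_distrib inner_diff_left inner_diff_right inner_commute)
qed

lemma matrix_vector_mult_minus: "(A :: real^'n^'m) *v (- x) = - (A *v x)"
  using matrix_vector_mult_scaleR[of A "-1" x] by simp

lemma quad_total:
  assumes "posdef S"
  shows "x \<bullet> (matrix_inv S *v x) = subvec (- a) x \<bullet> multiplier a x S + quad_given a x S"
  using quad_split[OF assms, of x 0 a] subvec_orthogonal[OF multiplier(2)[OF assms] multiplier(1)[OF assms], of a x x]
  by (simp add: quad_given_eq[OF assms] inner_commute matrix_vector_mult_minus)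

lemma multiplier_quad_nonneg:
  assumes "posdef S"
  shows "subvec (- a) x \<bullet> multiplier a x S \<ge> 0"
proof -
  have "0 \<le> (x - mean_given a x S) \<bullet> (matrix_inv S *v (x - mean_given a x S))"
    by (intro posdef_nonneg posdef_matrix_inv assms)
  then show ?thesis by (simp add: quad_split[OF assms, of x "mean_given a x S" a])
qed

text \<open>Multiplier and candidate have complementary supports and are orthogonal, so it suffices
  that the multiplier has nonpositive inner product with the cone. For the orthant this is a matter
  of signs of coordinates; for the halfspace the multiplier has to be a nonpositive multiple of the
  last axis.\<close>

lemma ind_optimality:
  fixes x :: "'p::{finite,linorder} rvec"
  assumes "posdef S" "a \<in> family K" "ind K a x S = 1"
  shows "mean_given a x S \<in> cone K"
    and "t \<in> cone K \<Longrightarrow> multiplier a x S \<bullet> (t - mean_given a x S) \<le> 0"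
proof -
  let ?l = "multiplier a x S" and ?m = "mean_given a x S"
  note m = multiplier[OF assms(1), where a = a and x = x]
  have lm: "?l \<bullet> ?m = 0" using subvec_orthogonal[OF m(2) m(1)] by (simp add: inner_commute)
  have "?m \<in> cone K \<and> (t \<in> cone K \<longrightarrow> ?l \<bullet> t \<le> 0)"
  proof (cases K)
    case Orthant
    then have 1: "\<forall>i\<in>a. ?m $ i > 0" "\<forall>i\<in>- a. ?l $ i \<le> 0"
      using assms(3) by (auto simp: multiplier_def split: if_splits)
    have "?m $ i = 0" if "i \<notin> a" for i using m(2) that by (metis subvec_nth)
    moreover have "?l $ i = 0" if "i \<in> a" for i using m(1) that by (metis ComplD subvec_nth)
    ultimately have *: "?m $ i \<ge> 0" "?l $ i \<le> 0" for i
      using 1 by (metis less_eq_real_def, metis Compl_iff order_refl)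
    show ?thesis unfolding Orthant
      using * by (auto simp: inner_vec_def intro!: sum_nonpos mult_nonpos_nonneg)
  next
    case Halfspace
    let ?k = "Max (UNIV :: 'p set)"
    consider "a = UNIV" | "a = UNIV - {?k}" using assms(2) Halfspace by auto
    then show ?thesis
    proof cases
      case 1
      then have "?l = 0" using m(1) by simp
      then have "?m = x" using m(3) by simp
      then show ?thesis using 1 assms(3) Halfspace \<open>?l = 0\<close> by (auto split: if_splits)
    next
      case 2
      then have a: "- a = {?k}" by auto
      have l: "?l = (?l $ ?k) *\<^sub>R axis ?k 1"
        using m(1) unfolding a by (auto simp: vec_eq_iff axis_def) (metis singletonD subvec_nth)
      have m0: "?m $ ?k = 0" using m(2) 2 by (metis DiffE insertI1 subvec_nth)
      \<comment> \<open>At the last coordinate the candidate vanishes, so Sl = x - m reads l_p S_pp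
        = x_p there, and l_p inherits the sign of x_p.\<close>
      have "(S *v ?l) $ ?k = x $ ?k" unfolding m(3) by (simp add: m0)
      then have "?l $ ?k * (axis ?k 1 \<bullet> (S *v axis ?k 1)) = x $ ?k"
        by (subst (asm) l) (simp add: matrix_vector_mult_scaleR inner_axis' )
      moreover have "axis ?k 1 \<bullet> (S *v axis ?k (1::real)) > 0"
        using assms(1) by (intro posdef_pos) (auto simp: axis_eq_0_iff)
      moreover have "x $ ?k \<le> 0" using assms(3) Halfspace 2 by (auto split: if_splits)
      ultimately have "?l $ ?k \<le> 0"
        by (metis linorder_not_less mult_pos_pos)
      moreover have "?l \<bullet> t = ?l $ ?k * t $ ?k" by (subst l) (simp add: inner_axis')
      ultimately show ?thesis using Halfspace m0 by (auto intro: mult_nonpos_nonneg)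
    qed
  qed
  then show "?m \<in> cone K" "t \<in> cone K \<Longrightarrow> ?l \<bullet> (t - ?m) \<le> 0"
    by (auto simp: inner_diff_right lm)
qed

text \<open>With S = BB', applying B^{-1} makes the metric of S^{-1} Euclidean and maps the orthant
  to a closed convex set, so a closest point exists. Its variational inequality, tested at 0, 2t and
  t + e_i, gives complementarity and the signs of l.\<close>

lemma orthant_projection_exists:
  fixes x :: "'p::{finite,linorder} rvec"
  assumes "posdef S"
  obtains t l where "\<And>i. t $ i \<ge> 0" "\<And>i. l $ i \<le> 0" "l \<bullet> t = 0" "S *v l = x - t"
proof -
  obtain B :: "'p rmat" where B: "invertible B" "S = B ** transpose B"
    using posdef_factor[OF assms] .
  let ?C = "matrix_inv B"
  define Pos :: "'p rvec set" where "Pos = {t. \<forall>i. t $ i \<ge> 0}"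
  define Z where "Z = (\<lambda>t. ?C *v t) ` Pos"
  have "Pos = (\<Inter>i. {t. t $ i \<ge> 0})" by (auto simp: Pos_def)
  then have "closed Pos" by (auto intro!: closed_INT closed_Collect_le continuous_intros)
  moreover have "inj (\<lambda>t. ?C *v t)"
    using B(1) by (metis injI invertible_matrix_inv matrix_inv_mult_vec(2))
  ultimately have clZ: "closed Z"
    unfolding Z_def by (intro closed_injective_linear_image) auto
  have "convex Pos" unfolding Pos_def by (auto simp: convex_def)
  then have cvZ: "convex Z" unfolding Z_def by (intro convex_linear_image) auto
  have "0 \<in> Pos" by (simp add: Pos_def)
  then have ne: "Z \<noteq> {}" by (auto simp: Z_def)
  define z where "z = closest_point Z (?C *v x)"
  have "z \<in> Z" unfolding z_def using clZ ne by (rule closest_point_in_set)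
  then obtain t where t: "t \<in> Pos" "z = ?C *v t" by (auto simp: Z_def)
  define l where "l = transpose ?C *v (?C *v (x - t))"
  have "transpose B ** transpose ?C = mat 1"
    using B(1) by (metis matrix_inv_mult(2) matrix_transpose_mul transpose_mat)
  then have Sl: "S *v l = x - t"
    unfolding l_def B(2) using B(1)
    by (metis matrix_inv_mult_vec(1) matrix_vector_mul_assoc matrix_vector_mul_lid)
  have var: "l \<bullet> (s - t) \<le> 0" if "s \<in> Pos" for s
  proof -
    have "(?C *v x - z) \<bullet> (?C *v s - z) \<le> 0"
      unfolding z_def by (rule closest_point_dot[OF cvZ clZ]) (auto simp: Z_def that)
    then have "(?C *v (s - t)) \<bullet> (?C *v (x - t)) \<le> 0"
      by (simp add: t(2) matrix_vector_mult_diff_distrib inner_commute)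
    moreover have "l \<bullet> (s - t) = (?C *v (x - t)) \<bullet> (?C *v (s - t))"
      unfolding l_def by (rule dot_matrix_transpose[symmetric])
    ultimately show ?thesis by (simp add: inner_commute)
  qed
  have "l \<bullet> t = 0"
  proof -
    have "2 *\<^sub>R t \<in> Pos" using t(1) by (simp add: Pos_def)
    then show ?thesis using var[of 0] var[of "2 *\<^sub>R t"] \<open>0 \<in> Pos\<close>
      by (simp add: scaleR_2)
  qed
  moreover have "l $ i \<le> 0" for i
  proof -
    have "t + axis i 1 \<in> Pos" using t(1) by (auto simp: Pos_def axis_def)
    then show ?thesis using var[of "t + axis i 1"] by (simp add: inner_axis)
  qed
  ultimately show thesis using that[of t l] t(1) Sl by (auto simp: Pos_def)
qed

text \<open>For positive definite S this holds at every x, because pairing a strict inequality with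
  a weak one leaves no ties. The active face of the orthant is the set of positive coordinates of
  the projection.\<close>

lemma ex1_ind:
  fixes x :: "'p::{finite,linorder} rvec"
  assumes "posdef S"
  obtains a where "a \<in> family K" "ind K a x S = 1" "\<And>b. b \<in> family K \<Longrightarrow> b \<noteq> a \<Longrightarrow> ind K b x S = 0"
proof (cases K)
  case Halfspace
  have ne: "UNIV - {Max (UNIV :: 'p set)} \<noteq> UNIV" by blast
  show ?thesis
    by (cases "x $ Max UNIV > 0") (use that[of UNIV] that[of "UNIV - {Max UNIV}"] Halfspace ne in auto)
next
  case Orthant
  obtain t l where tl: "\<And>i. t $ i \<ge> 0" "\<And>i. l $ i \<le> 0" "l \<bullet> t = 0" "S *v l = x - t"
    using orthant_projection_exists[OF assms, of x] by blast
  define a where "a = {i. t $ i > 0}"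
  have "l $ i = 0" if "i \<in> a" for i
  proof -
    have "(\<Sum>i\<in>UNIV. - (l $ i * t $ i)) = 0" using tl(3) by (simp add: inner_vec_def sum_negf)
    then have "l $ i * t $ i = 0"
      using tl(1,2) by (subst (asm) sum_nonneg_eq_0_iff) (auto simp: mult_nonpos_nonneg)
    then show ?thesis using that by (simp add: a_def)
  qed
  then have 1: "subvec (- a) l = l" "subvec a t = t"
    using tl(1) by (auto simp: vec_eq_iff a_def less_le)
  note m = multiplier_unique[OF assms 1 tl(4)]
  have ind1: "ind K a x S = 1"
  proof -
    have "\<forall>i\<in>a. t $ i > 0" by (simp add: a_def)
    then show ?thesis using tl(2) by (simp add: Orthant m multiplier_def[symmetric])
  qed
  have "b = a" if "ind K b x S = 1" for b
  proof -
    let ?l = "multiplier b x S" and ?t = "mean_given b x S"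
    have F: "b \<in> family K" "a \<in> family K" by (simp_all add: Orthant)
    \<comment> \<open>The optimality inequalities of the two active faces are added. Since S maps
      the difference of the multipliers to the reversed difference of the candidates, the form of S
      is nonpositive at that difference.\<close>
    have "l \<bullet> (?t - t) \<le> 0" "?l \<bullet> (t - ?t) \<le> 0"
      using ind_optimality[OF assms F(1) that] ind_optimality[OF assms F(2) ind1] m by auto
    then have "(l - ?l) \<bullet> (S *v (l - ?l)) \<le> 0"
      using tl(4) multiplier(3)[OF assms, of b x]
      by (simp add: matrix_vector_mult_diff_distrib inner_diff_left inner_diff_right)
    then have "l = ?l" using posdef_pos[OF assms, of "l - ?l"] by force
    then have "?t = t" using tl(4) multiplier(3)[OF assms, of b x] by simp
    \<comment> \<open>The strict inequality in the indicator lets the face be recovered from its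
      candidate.\<close>
    moreover have "b = {i. ?t $ i > 0}"
      using that multiplier(2)[OF assms, of b x] Orthant
      by (auto split: if_splits) (metis less_irrefl subvec_nth)
    ultimately show ?thesis by (simp add: a_def)
  qed
  moreover have "ind K b x S = 0 \<or> ind K b x S = 1" for b by (simp add: Orthant) blast
  ultimately have "ind K b x S = 0" if "b \<noteq> a" for b using that by blast
  moreover have "a \<in> family K" by (simp add: Orthant)
  ultimately show ?thesis using that ind1 by blast
qed

lemma sum_ind:
  fixes x :: "'p::{finite,linorder} rvec"
  assumes "a \<in> family K" "ind K a x S = 1" "\<And>b. b \<in> family K \<Longrightarrow> b \<noteq> a \<Longrightarrow> ind K b x S = 0"
  shows "(\<Sum>b\<in>family K. F b * ind K b x S) = F a"
proof -
  have "(\<Sum>b\<in>family K. F b * ind K b x S) = (\<Sum>b\<in>family K. if b = a then F b else 0)"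
    using assms by (intro sum.cong) auto
  then show ?thesis using assms(1) by simp
qed

section \<open>Admissible directions and the two suprema\<close>

lemma directions_properties:
  assumes "posdef S" "b \<in> directions a S"
  shows "b \<noteq> 0" "b \<bullet> (x - mean_given a x S) = 0"
proof -
  have b: "subvec a b \<noteq> 0"
    "subvec (- a) b = - (block_inv (- a) S *v (block (- a) a S *v subvec a b))"
    using assms(2) by (auto simp: directions_def)
  show "b \<noteq> 0" using b(1) by auto
  have "b = subvec a b - block_inv (- a) S *v subvec (- a) (S *v subvec a b)"
    using subvec_split[of a b] b(2) by (simp add: block_mult_vec)
  \<comment> \<open>Admissibility of b amounts to Sb being supported in a, whereas the multiplier
    lives outside a.\<close>
  then have Sb: "subvec a (S *v b) = S *v b"
    using scatter_given_mult_vec(3)[OF assms(1), of a "subvec a b"] by simp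
  have "b \<bullet> (x - mean_given a x S) = b \<bullet> (S *v multiplier a x S)"
    by (simp add: multiplier(3)[OF assms(1)])
  also have "\<dots> = (S *v b) \<bullet> multiplier a x S"
    by (rule dot_matrix_vector_sym[OF posdef_sym[OF assms(1)]])
  also have "\<dots> = 0" by (rule subvec_orthogonal[OF Sb multiplier(1)[OF assms(1)]])
  finally show "b \<bullet> (x - mean_given a x S) = 0" .
qed

text \<open>The first claim supplies the maximising direction S^{-1} t for the candidate t. The
  second covers t = 0, where that vector is no direction but some direction is still needed for the
  supremum.\<close>

lemma directions_cases:
  assumes "posdef S"
  shows "v \<noteq> 0 \<Longrightarrow> subvec a (S *v v) = S *v v \<Longrightarrow> v \<in> directions a S"
    and "a \<noteq> {} \<Longrightarrow> directions a S \<noteq> {}"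
proof -
  have dirI: "v \<in> directions a S" if "subvec a v \<noteq> 0" "subvec a (S *v v) = S *v v" for v
  proof -
    have "subvec (- a) (S *v subvec (- a) v) = - subvec (- a) (S *v subvec a v)"
    proof -
      have "subvec (- a) (S *v v) = 0" using that(2) by (metis subvec_simps(6))
      then have "subvec (- a) (S *v subvec a v) + subvec (- a) (S *v subvec (- a) v) = 0"
        by (metis matrix_vector_right_distrib subvec_simps(2) subvec_split)
      then show ?thesis by (simp add: add_eq_0_iff)
    qed
    then have "subvec (- a) (S *v (- subvec (- a) v)) = subvec (- a) (S *v subvec a v)"
      by (simp add: matrix_vector_mult_minus)
    then have "- subvec (- a) v = block_inv (- a) S *v subvec (- a) (S *v subvec a v)"
      by (subst block_inv_char_posdef[OF assms]) simp
    then show ?thesis using that(1) by (simp add: directions_def block_mult_vec) (metis minus_minus)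
  qed
  show "v \<in> directions a S" if v: "v \<noteq> 0" "subvec a (S *v v) = S *v v"
  proof (rule dirI[OF _ v(2)])
    show "subvec a v \<noteq> 0"
    proof
      assume "subvec a v = 0"
      then have "v \<bullet> (S *v v) = 0" using v(2) by (metis inner_zero_left subvec_inner(1))
      then show False using posdef_pos[OF assms v(1)] by simp
    qed
  qed
  show "directions a S \<noteq> {}" if "a \<noteq> {}"
  proof -
    from \<open>a \<noteq> {}\<close> obtain i where "i \<in> a" by blast
    define v :: "(real, 'a) vec" where "v = axis i 1"
    have v: "subvec a v = v" "v \<noteq> 0" using \<open>i \<in> a\<close> by (auto simp: v_def vec_eq_iff axis_def)
    define w where "w = v - block_inv (- a) S *v subvec (- a) (S *v v)"
    note w = scatter_given_mult_vec[OF assms v(1), folded w_def]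
    have "w \<in> directions a S" using w v(2) by (intro dirI) auto
    then show ?thesis by blast
  qed
qed

text \<open>The directional likelihood is largest where b'(x - \<theta>) = 0. As the cone contains
  such a point, the supremum is attained there and only the denominator survives.\<close>

lemma dir_ratio_eq:
  fixes x :: "'p::{finite,linorder} rvec"
  assumes "posdef S" "b \<noteq> 0" "t \<in> cone K" "b \<bullet> (x - t) = 0"
  shows "dir_ratio K n x S b = (1 + real n * (b \<bullet> x)\<^sup>2 / (b \<bullet> (S *v b))) powr (real n / 2)"
  unfolding dir_ratio_def
proof (rule cSup_eq_maximum)
  define q where "q = b \<bullet> (S *v b)"
  have q: "q > 0" unfolding q_def using assms by (intro posdef_pos)
  define y where "y = 1 + real n * (b \<bullet> x)\<^sup>2 / q"
  have y: "y > 0" using q by (auto simp: y_def intro!: add_pos_nonneg)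
  have ratio: "dir_lik n s x S b / dir_lik n 0 x S b
      = (1 + real n * (b \<bullet> (x - s))\<^sup>2 / q) powr (- real n / 2) * y powr (real n / 2)" for s
    using q y by (simp add: dir_lik_def q_def[symmetric] y_def[symmetric] powr_minus_divide powr_minus field_simps)
  show "(1 + real n * (b \<bullet> x)\<^sup>2 / (b \<bullet> (S *v b))) powr (real n / 2)
      \<in> (\<lambda>\<theta>. dir_lik n \<theta> x S b / dir_lik n 0 x S b) ` cone K"
    using assms(3,4) ratio[of t] by (auto simp: y_def q_def intro!: image_eqI[of _ _ t])
  fix r assume "r \<in> (\<lambda>\<theta>. dir_lik n \<theta> x S b / dir_lik n 0 x S b) ` cone K"
  then obtain s where r: "r = (1 + real n * (b \<bullet> (x - s))\<^sup>2 / q) powr (- real n / 2) * y powr (real n / 2)"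
    using ratio by auto
  have "(1 + real n * (b \<bullet> (x - s))\<^sup>2 / q) powr (- real n / 2) \<le> 1"
    using powr_mono[of "- real n / 2" 0 "1 + real n * (b \<bullet> (x - s))\<^sup>2 / q"] q by (simp split: if_splits)
  then have "r \<le> 1 * y powr (real n / 2)" unfolding r by (intro mult_right_mono) auto
  then show "r \<le> (1 + real n * (b \<bullet> x)\<^sup>2 / (b \<bullet> (S *v b))) powr (real n / 2)"
    by (simp add: y_def q_def)
qed

lemma integrated_UIT_eq:
  fixes x :: "'p::{finite,linorder} rvec"
  assumes "posdef S"
  shows "integrated_UIT K n x S = (1 + UIT K n x S) powr (real n / 2)" "UIT K n x S \<ge> 0"
proof -
  obtain a where a: "a \<in> family K" "ind K a x S = 1" "\<And>b. b \<in> family K \<Longrightarrow> b \<noteq> a \<Longrightarrow> ind K b x S = 0"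
    using ex1_ind[OF assms] by blast
  let ?t = "mean_given a x S"
  define Q where "Q = quad_given a x S"
  have U: "UIT K n x S = real n * Q"
    unfolding UIT_def Q_def by (rule sum_ind[OF a])
  show "UIT K n x S \<ge> 0" by (simp add: U Q_def quad_given_nonneg[OF assms])
  have Q: "Q = ?t \<bullet> (matrix_inv S *v ?t)" by (simp add: Q_def quad_given_eq[OF assms])
  have t: "?t \<in> cone K" by (rule ind_optimality(1)[OF assms a(1,2)])
  have "integrated_UIT K n x S = (if a = {} then 1 else (SUP b\<in>directions a S. dir_ratio K n x S b))"
    unfolding integrated_UIT_def by (rule sum_ind[OF a])
  also have "\<dots> = (1 + real n * Q) powr (real n / 2)"
  proof (cases "a = {}")
    case True
    then have "?t = 0" using multiplier(2)[OF assms, of a x] by simp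
    then show ?thesis using True by (simp add: Q)
  next
    case False
    have bx: "b \<bullet> x = b \<bullet> ?t" if "b \<in> directions a S" for b
      using directions_properties(2)[OF assms that, of x] by (simp add: inner_diff_right)
    have ratio: "dir_ratio K n x S b = (1 + real n * ((b \<bullet> ?t)\<^sup>2 / (b \<bullet> (S *v b)))) powr (real n / 2)"
      if "b \<in> directions a S" for b
      using dir_ratio_eq[OF assms directions_properties(1)[OF assms that] t directions_properties(2)[OF assms that]]
      by (simp add: bx[OF that])
    \<comment> \<open>The vector of equality in the Cauchy-Schwarz inequality for the inner product
      of S, because b't = b'Sv.\<close>
    define v where "v = matrix_inv S *v ?t"
    have Sv: "S *v v = ?t" unfolding v_def by (simp add: matrix_inv_mult_vec posdef_invertible assms)
    have "\<exists>b\<in>directions a S. (b \<bullet> ?t)\<^sup>2 / (b \<bullet> (S *v b)) = Q"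
    proof (cases "?t = 0")
      case True
      then show ?thesis using directions_cases(2)[OF assms False] by (auto simp: Q)
    next
      case nz: False
      then have "v \<noteq> 0" using Sv by force
      then have "v \<in> directions a S"
        using directions_cases(1)[OF assms] Sv multiplier(2)[OF assms] by metis
      moreover have "(v \<bullet> ?t)\<^sup>2 / (v \<bullet> (S *v v)) = Q"
        unfolding Sv Q v_def[symmetric] by (simp add: inner_commute power2_eq_square)
      ultimately show ?thesis by blast
    qed
    then obtain b0 where b0: "b0 \<in> directions a S" "(b0 \<bullet> ?t)\<^sup>2 / (b0 \<bullet> (S *v b0)) = Q" by blast
    have "(SUP b\<in>directions a S. dir_ratio K n x S b) = (1 + real n * Q) powr (real n / 2)"
    proof (rule cSup_eq_maximum)
      show "(1 + real n * Q) powr (real n / 2) \<in> dir_ratio K n x S ` directions a S"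
        using b0 ratio by (intro image_eqI[of _ _ b0]) auto
      fix r assume "r \<in> dir_ratio K n x S ` directions a S"
      then obtain b where b: "b \<in> directions a S" "r = (1 + real n * ((b \<bullet> ?t)\<^sup>2 / (b \<bullet> (S *v b)))) powr (real n / 2)"
        using ratio by auto
      have pos: "b \<bullet> (S *v b) > 0"
        using directions_properties(1)[OF assms b(1)] assms by (intro posdef_pos)
      have "(b \<bullet> ?t)\<^sup>2 \<le> (b \<bullet> (S *v b)) * (v \<bullet> (S *v v))"
        using posdef_Cauchy_Schwarz[OF assms, of b v] by (simp add: Sv)
      also have "v \<bullet> (S *v v) = Q" by (simp only: Sv) (simp add: Q v_def inner_commute)
      finally have "(b \<bullet> ?t)\<^sup>2 / (b \<bullet> (S *v b)) \<le> Q" using pos by (simp add: field_simps)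
      then show "r \<le> (1 + real n * Q) powr (real n / 2)"
        unfolding b(2) using pos by (intro powr_mono2 add_left_mono mult_left_mono add_nonneg_nonneg) auto
    qed
    then show ?thesis using False by simp
  qed
  finally show "integrated_UIT K n x S = (1 + UIT K n x S) powr (real n / 2)" by (simp add: U)
qed

text \<open>The quadratic form has minimum R over the cone and value R + Q at 0. Since the statistic
  is nQ/(1 + nR), the quotient (1 + n(R + Q))/(1 + nR) is 1 plus the statistic.\<close>

lemma LRT_sup:
  fixes x :: "'p::{finite,linorder} rvec"
  assumes "posdef S"
  shows "(SUP t\<in>cone K. ((1 + real n * ((x - t) \<bullet> (matrix_inv S *v (x - t))))
             / (1 + real n * (x \<bullet> (matrix_inv S *v x)))) powr (- real n / 2))
         = (1 + LRT K n x S) powr (real n / 2)"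
    and "LRT K n x S \<ge> 0"
proof -
  obtain a where a: "a \<in> family K" "ind K a x S = 1" "\<And>b. b \<in> family K \<Longrightarrow> b \<noteq> a \<Longrightarrow> ind K b x S = 0"
    using ex1_ind[OF assms] by blast
  define Q where "Q = quad_given a x S"
  define R where "R = subvec (- a) x \<bullet> multiplier a x S"
  let ?q = "\<lambda>t. (x - t) \<bullet> (matrix_inv S *v (x - t))"
  have QR: "Q \<ge> 0" "R \<ge> 0"
    unfolding Q_def R_def by (intro quad_given_nonneg multiplier_quad_nonneg assms)+
  have L: "LRT K n x S = real n * Q / (1 + real n * R)"
    unfolding LRT_def Q_def R_def multiplier_def by (rule sum_ind[OF a])
  then show "LRT K n x S \<ge> 0" using QR by simp
  have tot: "x \<bullet> (matrix_inv S *v x) = R + Q" by (simp add: R_def Q_def quad_total[OF assms, of x a])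
  have opt: "?q (mean_given a x S) = R" by (simp add: quad_split[OF assms, of x _ a] R_def)
  have ge: "?q t \<ge> R" if "t \<in> cone K" for t
    using ind_optimality(2)[OF assms a(1,2) that]
      posdef_nonneg[OF posdef_matrix_inv[OF assms], of "t - mean_given a x S"]
    by (simp add: quad_split[OF assms, of x _ a] R_def)
  have pos: "1 + real n * R > 0" "1 + real n * (R + Q) > 0" using QR by (auto intro!: add_pos_nonneg)
  have eq: "((1 + real n * R) / (1 + real n * (R + Q))) powr (- real n / 2) = (1 + LRT K n x S) powr (real n / 2)"
  proof -
    have "1 + LRT K n x S = inverse ((1 + real n * R) / (1 + real n * (R + Q)))"
      unfolding L using pos by (simp add: field_simps)
    then show ?thesis using pos by (simp add: powr_minus flip: inverse_powr)
  qed
  show "(SUP t\<in>cone K. ((1 + real n * ?q t) / (1 + real n * (x \<bullet> (matrix_inv S *v x)))) powr (- real n / 2))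
         = (1 + LRT K n x S) powr (real n / 2)"
    unfolding tot
  proof (rule cSup_eq_maximum)
    show "(1 + LRT K n x S) powr (real n / 2)
      \<in> (\<lambda>t. ((1 + real n * ?q t) / (1 + real n * (R + Q))) powr (- real n / 2)) ` cone K"
      using ind_optimality(1)[OF assms a(1,2)] eq opt by (intro image_eqI[of _ _ "mean_given a x S"]) auto
    fix r assume "r \<in> (\<lambda>t. ((1 + real n * ?q t) / (1 + real n * (R + Q))) powr (- real n / 2)) ` cone K"
    then obtain t where t: "t \<in> cone K" "r = ((1 + real n * ?q t) / (1 + real n * (R + Q))) powr (- real n / 2)"
      by auto
    have "r \<le> ((1 + real n * R) / (1 + real n * (R + Q))) powr (- real n / 2)"
      unfolding t(2) using ge[OF t(1)] pos
      by (intro powr_mono2' divide_right_mono add_left_mono mult_left_mono) auto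
    then show "r \<le> (1 + LRT K n x S) powr (real n / 2)" by (simp only: eq)
  qed
qed

subsection \<open>Lebesgue measure on symmetric matrices under congruence\<close>

interpretation lborel_PiM: product_sigma_finite "\<lambda>_ :: 'i. lborel :: real measure"
  by standard

text \<open>Scalings, shears and permutations of coordinates are what congruences by elementary
  matrices do to the entries of a symmetric matrix. This lemma covers the diagonal congruences and,
  with c = 1, the translations along the identity matrix.\<close>

lemma nn_integral_PiM_affine:
  fixes t c :: "'i \<Rightarrow> real"
  assumes "finite I" and F: "F \<in> borel_measurable (PiM I (\<lambda>_. lborel))" and "\<And>i. i \<in> I \<Longrightarrow> c i \<noteq> 0"
  shows "(\<integral>\<^sup>+u. F u \<partial>PiM I (\<lambda>_. lborel))
       = ennreal (\<Prod>i\<in>I. \<bar>c i\<bar>) * (\<integral>\<^sup>+u. F (\<lambda>i\<in>I. t i + c i * u i) \<partial>PiM I (\<lambda>_. lborel))"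
  using assms
proof (induction I arbitrary: F rule: finite_induct)
  case empty
  then show ?case by (simp add: PiM_empty nn_integral_count_space_finite)
next
  case (insert k I)
  note F[measurable] = insert.prems(1)
  have k: "k \<notin> I" by fact
  define F' where "F' x = (\<integral>\<^sup>+y. F (x(k := y)) \<partial>lborel)" for x
  have F'[measurable]: "F' \<in> borel_measurable (PiM I (\<lambda>_. lborel))" unfolding F'_def by measurable
  have [measurable]: "(\<lambda>u. F (\<lambda>i\<in>insert k I. t i + c i * u i)) \<in> borel_measurable (PiM (insert k I) (\<lambda>_. lborel))"
    by (rule measurable_compose[OF _ F]) measurable
  have inner: "F' x = ennreal \<bar>c k\<bar> * (\<integral>\<^sup>+y. F (x(k := t k + c k * y)) \<partial>lborel)"
    if x: "x \<in> space (PiM I (\<lambda>_. lborel))" for x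
  proof -
    have "(\<lambda>y. F (x(k := y))) \<in> borel_measurable lborel"
      using measurable_comp[OF measurable_component_update[OF x k] F] by (simp add: comp_def)
    then show ?thesis
      unfolding F'_def using insert.prems(2)[of k] by (intro nn_integral_real_affine) auto
  qed
  have upd: "(\<lambda>i\<in>insert k I. t i + c i * (x(k := y)) i) = (\<lambda>i\<in>I. t i + c i * x i)(k := t k + c k * y)"
    for x :: "'i \<Rightarrow> real" and y
    using k by (auto simp: fun_eq_iff)
  have "(\<integral>\<^sup>+u. F u \<partial>PiM (insert k I) (\<lambda>_. lborel)) = (\<integral>\<^sup>+x. F' x \<partial>PiM I (\<lambda>_. lborel))"
    unfolding F'_def by (rule lborel_PiM.product_nn_integral_insert[OF insert.hyps F])
  also have "\<dots> = ennreal (\<Prod>i\<in>I. \<bar>c i\<bar>) * (\<integral>\<^sup>+x. F' (\<lambda>i\<in>I. t i + c i * x i) \<partial>PiM I (\<lambda>_. lborel))"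
    by (rule insert.IH[OF F']) (use insert.prems in auto)
  also have "(\<integral>\<^sup>+x. F' (\<lambda>i\<in>I. t i + c i * x i) \<partial>PiM I (\<lambda>_. lborel))
    = (\<integral>\<^sup>+x. ennreal \<bar>c k\<bar> * (\<integral>\<^sup>+y. F ((\<lambda>i\<in>I. t i + c i * x i)(k := t k + c k * y)) \<partial>lborel) \<partial>PiM I (\<lambda>_. lborel))"
    by (intro nn_integral_cong inner) (auto simp: space_PiM)
  also have "\<dots> = ennreal \<bar>c k\<bar> * (\<integral>\<^sup>+x. \<integral>\<^sup>+y. F (\<lambda>i\<in>insert k I. t i + c i * (x(k := y)) i) \<partial>lborel \<partial>PiM I (\<lambda>_. lborel))"
    unfolding upd by (rule nn_integral_cmult) (unfold upd[symmetric], measurable)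
  also have "\<dots> = ennreal \<bar>c k\<bar> * (\<integral>\<^sup>+u. F (\<lambda>i\<in>insert k I. t i + c i * u i) \<partial>PiM (insert k I) (\<lambda>_. lborel))"
    by (subst lborel_PiM.product_nn_integral_insert[OF insert.hyps]) simp_all
  moreover have "ennreal (\<Prod>i\<in>insert k I. \<bar>c i\<bar>) = ennreal (\<Prod>i\<in>I. \<bar>c i\<bar>) * ennreal \<bar>c k\<bar>"
    using insert.hyps by (simp add: ennreal_mult prod_nonneg mult.commute)
  ultimately show ?case by (simp only: mult.assoc)
qed

text \<open>By \<open>indep\<close> the shift is constant once the other coordinates are fixed, so
  Tonelli reduces the claim to translation invariance on the line.\<close>

lemma nn_integral_PiM_shear:
  fixes F :: "('i \<Rightarrow> real) \<Rightarrow> ennreal"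
  assumes "finite I" "i \<in> I" and F[measurable]: "F \<in> borel_measurable (PiM I (\<lambda>_. lborel))"
    and \<phi>[measurable]: "\<phi> \<in> borel_measurable (PiM I (\<lambda>_. lborel))" and indep: "\<And>u y. \<phi> (u(i := y)) = \<phi> u"
  shows "(\<integral>\<^sup>+u. F (\<lambda>k\<in>I. u k + (if k = i then \<phi> u else 0)) \<partial>PiM I (\<lambda>_. lborel)) = (\<integral>\<^sup>+u. F u \<partial>PiM I (\<lambda>_. lborel))"
proof -
  define J where "J = I - {i}"
  have J: "I = insert i J" "i \<notin> J" "finite J" using assms by (auto simp: J_def)
  have m: "(\<lambda>u. F (\<lambda>k\<in>I. u k + (if k = i then \<phi> u else 0))) \<in> borel_measurable (PiM I (\<lambda>_. lborel))"
    by (rule measurable_compose[OF _ F]) measurable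
  have "(\<integral>\<^sup>+u. F (\<lambda>k\<in>I. u k + (if k = i then \<phi> u else 0)) \<partial>PiM I (\<lambda>_. lborel))
    = (\<integral>\<^sup>+x. \<integral>\<^sup>+y. F (\<lambda>k\<in>I. (x(i := y)) k + (if k = i then \<phi> (x(i := y)) else 0)) \<partial>lborel \<partial>PiM J (\<lambda>_. lborel))"
    using lborel_PiM.product_nn_integral_insert[OF J(3,2) m[unfolded J(1)]] unfolding J(1) .
  also have "\<dots> = (\<integral>\<^sup>+x. \<integral>\<^sup>+y. F (x(i := y)) \<partial>lborel \<partial>PiM J (\<lambda>_. lborel))"
  proof (rule nn_integral_cong)
    fix x assume x: "x \<in> space (PiM J (\<lambda>_. lborel :: real measure))"
    then have upd: "(\<lambda>k\<in>I. (x(i := y)) k + (if k = i then \<phi> (x(i := y)) else 0)) = x(i := \<phi> x + 1 * y)" for y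
      using J(1,2) by (auto simp: fun_eq_iff indep space_PiM PiE_def extensional_def)
    have "(\<lambda>y. F (x(i := y))) \<in> borel_measurable lborel"
      using measurable_comp[OF measurable_component_update[OF x J(2)] F[unfolded J(1)]] by (simp add: comp_def)
    then have "(\<integral>\<^sup>+y. F (x(i := y)) \<partial>lborel) = ennreal \<bar>1\<bar> * (\<integral>\<^sup>+y. F (x(i := \<phi> x + 1 * y)) \<partial>lborel)"
      by (intro nn_integral_real_affine) auto
    then show "(\<integral>\<^sup>+y. F (\<lambda>k\<in>I. (x(i := y)) k + (if k = i then \<phi> (x(i := y)) else 0)) \<partial>lborel)
      = (\<integral>\<^sup>+y. F (x(i := y)) \<partial>lborel)"
      unfolding upd by simp
  qed
  also have "\<dots> = (\<integral>\<^sup>+u. F u \<partial>PiM I (\<lambda>_. lborel))"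
    using lborel_PiM.product_nn_integral_insert[OF J(3,2) F[unfolded J(1)]] unfolding J(1) by simp
  finally show ?thesis .
qed

lemma nn_integral_PiM_permute:
  fixes F :: "('i \<Rightarrow> real) \<Rightarrow> ennreal"
  assumes "finite I" "bij_betw p I I" and F[measurable]: "F \<in> borel_measurable (PiM I (\<lambda>_. lborel))"
  shows "(\<integral>\<^sup>+u. F (\<lambda>k\<in>I. u (p k)) \<partial>PiM I (\<lambda>_. lborel)) = (\<integral>\<^sup>+u. F u \<partial>PiM I (\<lambda>_. lborel))"
proof -
  have p: "p k \<in> I" if "k \<in> I" for k using assms(2) that by (auto simp: bij_betw_def)
  let ?q = "inv_into I p"
  have q: "?q k \<in> I" "p (?q k) = k" if "k \<in> I" for k
    using assms(2) that by (auto simp: bij_betw_def inv_into_into f_inv_into_f)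
  have qp: "?q (p k) = k" if "k \<in> I" for k
    using assms(2) that by (auto simp: bij_betw_def)
  have meas[measurable]: "(\<lambda>u. \<lambda>k\<in>I. u (p k)) \<in> PiM I (\<lambda>_. lborel) \<rightarrow>\<^sub>M PiM I (\<lambda>_. lborel :: real measure)"
    using p by measurable
  have "distr (PiM I (\<lambda>_. lborel)) (PiM I (\<lambda>_. lborel :: real measure)) (\<lambda>u. \<lambda>k\<in>I. u (p k)) = PiM I (\<lambda>_. lborel)"
  proof (rule lborel_PiM.PiM_eqI[OF assms(1)])
    fix A :: "'i \<Rightarrow> real set" assume A: "\<And>i. i \<in> I \<Longrightarrow> A i \<in> sets lborel"
    have "(\<lambda>u. \<lambda>k\<in>I. u (p k)) -` Pi\<^sub>E I A \<inter> space (PiM I (\<lambda>_. lborel :: real measure)) = Pi\<^sub>E I (\<lambda>k. A (?q k))"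
      using p q qp by (auto simp: space_PiM PiE_iff) (metis)+
    then have "emeasure (distr (PiM I (\<lambda>_. lborel)) (PiM I (\<lambda>_. lborel)) (\<lambda>u. \<lambda>k\<in>I. u (p k))) (Pi\<^sub>E I A)
        = emeasure (PiM I (\<lambda>_. lborel)) (Pi\<^sub>E I (\<lambda>k. A (?q k)))"
      using A assms(1) by (subst emeasure_distr) auto
    also have "\<dots> = (\<Prod>k\<in>I. emeasure lborel (A (?q k)))"
      using A q assms(1) by (intro lborel_PiM.emeasure_PiM) auto
    also have "\<dots> = (\<Prod>k\<in>I. emeasure lborel (A k))"
      by (rule prod.reindex_bij_betw[OF bij_betw_inv_into[OF assms(2)]])
    finally show "emeasure (distr (PiM I (\<lambda>_. lborel)) (PiM I (\<lambda>_. lborel)) (\<lambda>u. \<lambda>k\<in>I. u (p k))) (Pi\<^sub>E I A)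
      = (\<Prod>k\<in>I. emeasure lborel (A k))" .
  qed simp
  then have "(\<integral>\<^sup>+u. F u \<partial>PiM I (\<lambda>_. lborel))
    = (\<integral>\<^sup>+u. F u \<partial>distr (PiM I (\<lambda>_. lborel)) (PiM I (\<lambda>_. lborel)) (\<lambda>u. \<lambda>k\<in>I. u (p k)))" by simp
  also have "\<dots> = (\<integral>\<^sup>+u. F (\<lambda>k\<in>I. u (p k)) \<partial>PiM I (\<lambda>_. lborel))"
    by (rule nn_integral_distr) measurable
  finally show ?thesis by simp
qed

section \<open>Upper-triangular coordinates and the Jacobian of congruences\<close>

definition upper_pairs :: "('p::{finite,linorder} \<times> 'p) set" where
  "upper_pairs = {(i, j). i \<le> j}"

definition sym_matrix :: "('p::{finite,linorder} \<times> 'p \<Rightarrow> real) \<Rightarrow> 'p rmat" where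
  "sym_matrix u = (\<chi> i j. u (min i j, max i j))"

abbreviation upper_lborel :: "('p::{finite,linorder} \<times> 'p \<Rightarrow> real) measure" where
  "upper_lborel \<equiv> PiM upper_pairs (\<lambda>_. lborel)"

lemma upper_pairs_iff [simp]: "(i, j) \<in> upper_pairs \<longleftrightarrow> i \<le> j"
  by (simp add: upper_pairs_def)

lemma min_le_max [simp]: "min i j \<le> max i (j :: 'a::linorder)"
  by (auto simp: min_def max_def)

lemma sym_matrix_nth [simp]: "sym_matrix u $ i $ j = u (min i j, max i j)"
  by (simp add: sym_matrix_def)

lemma transpose_sym_matrix [simp]: "transpose (sym_matrix u) = sym_matrix u"
  by (simp add: vec_eq_iff transpose_def min.commute max.commute)

lemma borel_measurable_matrixI:
  fixes f :: "'a \<Rightarrow> real^'n^'m"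
  assumes "\<And>i j. (\<lambda>x. f x $ i $ j) \<in> borel_measurable M"
  shows "f \<in> borel_measurable M"
  using assms by (subst borel_measurable_euclidean_space) (auto simp: Basis_vec_def inner_axis)

lemma measurable_sym_matrix [measurable]: "sym_matrix \<in> upper_lborel \<rightarrow>\<^sub>M borel"
  by (rule borel_measurable_matrixI) simp

lemma sym_lborel_distr: "sym_lborel = distr upper_lborel borel sym_matrix"
  by (simp add: sym_lborel_def upper_pairs_def sym_matrix_def[abs_def])

lemma space_sym_lborel [simp]: "space sym_lborel = UNIV"
  and sets_sym_lborel [simp, measurable_cong]: "sets sym_lborel = sets borel"
  by (simp_all add: sym_lborel_def)

lemma nn_integral_sym_lborel:
  "G \<in> borel_measurable borel \<Longrightarrow> (\<integral>\<^sup>+S. G S \<partial>sym_lborel) = (\<integral>\<^sup>+u. G (sym_matrix u) \<partial>upper_lborel)"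
  unfolding sym_lborel_distr by (rule nn_integral_distr) measurable

lemma AE_sym_lborel_symmetric:
  "AE S in (sym_lborel :: 'p::{finite,linorder} rmat measure). transpose S = S"
proof -
  have "closed {S :: 'p rmat. transpose S = S}"
    by (intro closed_Collect_eq continuous_intros)
  then have "{S :: 'p rmat. transpose S = S} \<in> sets borel" by (rule borel_closed)
  then show ?thesis
    unfolding sym_lborel_distr by (subst AE_distr_iff) auto
qed

text \<open>The Jacobian of a diagonal congruence. Its square is the product over the upper and the
  lower triangle together, which is the whole square with the diagonal counted twice: 2p + 2 factors
  of each d_i.\<close>

lemma prod_upper_pairs:
  fixes d :: "'p::{finite,linorder} \<Rightarrow> real"
  assumes "\<And>i. d i \<ge> 0"
  shows "(\<Prod>(i, j)\<in>upper_pairs. d i * d j) = (\<Prod>i\<in>UNIV. d i) ^ (CARD('p) + 1)"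
proof (rule power2_eq_imp_eq)
  let ?e = "\<lambda>(i, j). d i * d j"
  let ?L = "{(i, j). j \<le> i} :: ('p \<times> 'p) set" and ?D = "{(i, j). i = j} :: ('p \<times> 'p) set"
  have "bij_betw prod.swap upper_pairs ?L"
    by (rule bij_betwI[of _ _ _ prod.swap]) (auto simp: upper_pairs_def)
  then have L: "prod ?e ?L = prod ?e upper_pairs"
    using prod.reindex_bij_betw[of prod.swap upper_pairs ?L ?e] by (simp add: case_prod_beta mult.commute)
  have "upper_pairs \<union> ?L = UNIV" "upper_pairs \<inter> ?L = ?D" by (auto simp: upper_pairs_def)
  then have "prod ?e upper_pairs * prod ?e ?L = prod ?e UNIV * prod ?e ?D"
    using prod.union_inter[of upper_pairs ?L ?e] by simp
  moreover have "prod ?e ?D = (\<Prod>i\<in>UNIV. d i * d i)"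
  proof -
    have "bij_betw (\<lambda>i. (i, i)) UNIV ?D" by (rule bij_betwI[of _ _ _ fst]) auto
    from prod.reindex_bij_betw[OF this, of ?e] show ?thesis by simp
  qed
  moreover have "prod ?e UNIV = (\<Prod>i\<in>UNIV. \<Prod>j\<in>UNIV. d i * d j)"
    by (simp add: prod.cartesian_product case_prod_beta flip: UNIV_Times_UNIV)
  moreover have "\<dots> = (\<Prod>i\<in>UNIV. d i) ^ CARD('p) * (\<Prod>i\<in>UNIV. d i) ^ CARD('p)"
    by (simp add: prod.distrib prod_power_distrib)
  ultimately show "(prod ?e upper_pairs)\<^sup>2 = ((\<Prod>i\<in>UNIV. d i) ^ (CARD('p) + 1))\<^sup>2"
    by (simp add: L power2_eq_square prod.distrib mult_ac)
qed (auto simp: assms intro!: prod_nonneg zero_le_power mult_nonneg_nonneg)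

text \<open>Invertibility stands inside the property so that the induction over elementary matrices
  can pass through singular matrices, for which it holds vacuously.\<close>

definition congr_scales :: "'p::{finite,linorder} rmat \<Rightarrow> bool" where
  "congr_scales B \<longleftrightarrow> (invertible B \<longrightarrow> (\<forall>G\<in>borel_measurable borel.
     (\<integral>\<^sup>+S. G S \<partial>sym_lborel)
       = ennreal (\<bar>det B\<bar> ^ (CARD('p) + 1)) * (\<integral>\<^sup>+S. G (B ** S ** transpose B) \<partial>sym_lborel)))"

lemma congr_scalesD:
  assumes "congr_scales B" "invertible B" "G \<in> borel_measurable borel"
  shows "(\<integral>\<^sup>+S. G S \<partial>sym_lborel)
       = ennreal (\<bar>det B\<bar> ^ (CARD('p) + 1)) * (\<integral>\<^sup>+S. G (B ** S ** transpose B) \<partial>(sym_lborel :: 'p::{finite,linorder} rmat measure))"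
  using assms unfolding congr_scales_def by blast

lemma measurable_congruence [measurable]: "(\<lambda>S :: 'p::finite rmat. B ** S ** transpose B) \<in> borel \<rightarrow>\<^sub>M borel"
  by (intro borel_measurable_continuous_onI continuous_intros)

lemma congr_scales_mult:
  assumes "congr_scales A" "congr_scales B"
  shows "congr_scales (A ** B)"
  unfolding congr_scales_def
proof (intro impI ballI)
  assume "invertible (A ** B)"
  then have inv: "invertible A" "invertible B" by (auto simp: invertible_det_nz det_mul)
  fix G :: "'a rmat \<Rightarrow> ennreal" assume G[measurable]: "G \<in> borel_measurable borel"
  let ?c = "\<lambda>B. ennreal (\<bar>det B\<bar> ^ (CARD('a) + 1))"
  have "(\<integral>\<^sup>+S. G S \<partial>sym_lborel) = ?c A * (\<integral>\<^sup>+S. G (A ** S ** transpose A) \<partial>sym_lborel)"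
    by (rule congr_scalesD[OF assms(1) inv(1) G])
  also have "(\<integral>\<^sup>+S. G (A ** S ** transpose A) \<partial>sym_lborel)
    = ?c B * (\<integral>\<^sup>+S. G (A ** (B ** S ** transpose B) ** transpose A) \<partial>sym_lborel)"
  proof -
    have "(\<lambda>S. G (A ** S ** transpose A)) \<in> borel_measurable borel" by measurable
    then show ?thesis by (rule congr_scalesD[OF assms(2) inv(2)])
  qed
  moreover have eq: "A ** (B ** S ** transpose B) ** transpose A = A ** B ** S ** transpose (A ** B)" for S
    by (simp add: matrix_mul_assoc matrix_transpose_mul)
  moreover have c: "?c (A ** B) = ?c A * ?c B"
    by (simp add: det_mul abs_mult power_mult_distrib ennreal_mult mult_ac)
  ultimately show "(\<integral>\<^sup>+S. G S \<partial>sym_lborel)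
      = ?c (A ** B) * (\<integral>\<^sup>+S. G (A ** B ** S ** transpose (A ** B)) \<partial>sym_lborel)"
    by (simp only: eq c mult.assoc)
qed

lemma congr_scales_diagonal:
  fixes B :: "'p::{finite,linorder} rmat"
  assumes "\<And>i j. i \<noteq> j \<Longrightarrow> B $ i $ j = 0"
  shows "congr_scales B"
  unfolding congr_scales_def
proof (intro impI ballI)
  assume "invertible B"
  define d where "d i = B $ i $ i" for i
  have det: "det B = (\<Prod>i\<in>UNIV. d i)" unfolding d_def by (rule det_diagonal) (rule assms)
  then have d: "d i \<noteq> 0" for i using \<open>invertible B\<close> by (simp add: invertible_det_nz)
  fix G :: "'p rmat \<Rightarrow> ennreal" assume G[measurable]: "G \<in> borel_measurable borel"
  have B: "B $ i $ j = (if i = j then d i else 0)" for i j using assms by (simp add: d_def)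
  have eq: "sym_matrix (\<lambda>k\<in>upper_pairs. 0 + (case k of (i, j) \<Rightarrow> d i * d j) * u k) = B ** sym_matrix u ** transpose B" for u
    by (auto simp: vec_eq_iff matrix_matrix_mult_def transpose_def B if_distrib[of "\<lambda>x. x * _"] if_distrib[of "\<lambda>x. _ * x"]
        min_def max_def cong: if_cong)
  have "(\<integral>\<^sup>+S. G S \<partial>sym_lborel) = (\<integral>\<^sup>+u. G (sym_matrix u) \<partial>upper_lborel)"
    by (rule nn_integral_sym_lborel) measurable
  also have "\<dots> = ennreal (\<Prod>k\<in>upper_pairs. \<bar>case k of (i, j) \<Rightarrow> d i * d j\<bar>)
      * (\<integral>\<^sup>+u. G (sym_matrix (\<lambda>k\<in>upper_pairs. 0 + (case k of (i, j) \<Rightarrow> d i * d j) * u k)) \<partial>upper_lborel)"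
    by (rule nn_integral_PiM_affine[where F = "\<lambda>u. G (sym_matrix u)"]) (auto simp: d)
  also have "(\<Prod>k\<in>upper_pairs. \<bar>case k of (i, j) \<Rightarrow> d i * d j\<bar>) = \<bar>det B\<bar> ^ (CARD('p) + 1)"
    using prod_upper_pairs[of "\<lambda>i. \<bar>d i\<bar>"] by (simp add: det abs_prod case_prod_beta abs_mult)
  also have "(\<integral>\<^sup>+u. G (sym_matrix (\<lambda>k\<in>upper_pairs. 0 + (case k of (i, j) \<Rightarrow> d i * d j) * u k)) \<partial>upper_lborel)
    = (\<integral>\<^sup>+S. G (B ** S ** transpose B) \<partial>sym_lborel)"
    unfolding eq by (rule nn_integral_sym_lborel[symmetric]) measurable
  finally show "(\<integral>\<^sup>+S. G S \<partial>sym_lborel)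
      = ennreal (\<bar>det B\<bar> ^ (CARD('p) + 1)) * (\<integral>\<^sup>+S. G (B ** S ** transpose B) \<partial>sym_lborel)" .
qed

lemma congr_scales_swap:
  fixes m n :: "'p::{finite,linorder}"
  shows "congr_scales (\<chi> i j. mat 1 $ i $ Transposition.transpose m n j)"
  unfolding congr_scales_def
proof (intro impI ballI)
  let ?t = "Transposition.transpose m n"
  let ?B = "(\<chi> i j. mat 1 $ i $ ?t j) :: 'p rmat"
  have "?t permutes UNIV" by (rule permutes_swap_id) auto
  then have "det ?B = of_int (sign ?t) * det (mat 1 :: 'p rmat)"
    by (rule det_permute_columns)
  then have det: "\<bar>det ?B\<bar> = 1" by (simp add: sign_def)
  fix G :: "'p rmat \<Rightarrow> ennreal" assume G[measurable]: "G \<in> borel_measurable borel"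
  \<comment> \<open>Transposing the indices can reverse a pair, so \<open>p\<close> sorts it again;
    the result is an involution on \<open>upper_pairs\<close>.\<close>
  define p where "p k = (min (?t (fst k)) (?t (snd k)), max (?t (fst k)) (?t (snd k)))" for k
  have p2: "p (p k) = k" "p k \<in> upper_pairs" if "k \<in> upper_pairs" for k
    using that by (auto simp: p_def upper_pairs_def min_def max_def split: if_splits)
  have bij: "bij_betw p upper_pairs upper_pairs"
    by (rule bij_betwI[of _ _ _ p]) (auto simp: p2)
  have eq: "sym_matrix (\<lambda>k\<in>upper_pairs. u (p k)) = ?B ** sym_matrix u ** transpose ?B" for u
  proof -
    define Q where "Q = ?B"
    have Q: "Q $ i $ j = (if j = ?t i then 1 else 0)" for i j
      by (auto simp: mat_def Q_def)
    have "(?B ** sym_matrix u ** transpose ?B) $ i $ j = sym_matrix u $ ?t i $ ?t j" for i j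
      unfolding Q_def[symmetric]
      by (simp add: matrix_matrix_mult_def transpose_def Q if_distrib[of "\<lambda>x. x * _"] if_distrib[of "\<lambda>x. _ * x"] cong: if_cong)
    moreover have "(min (?t i) (?t j), max (?t i) (?t j)) = p (min i j, max i j)" for i j
      by (auto simp: p_def min_def max_def)
    ultimately show ?thesis by (simp add: vec_eq_iff)
  qed
  have "(\<integral>\<^sup>+S. G S \<partial>sym_lborel) = (\<integral>\<^sup>+u. G (sym_matrix u) \<partial>upper_lborel)"
    by (rule nn_integral_sym_lborel) measurable
  also have "\<dots> = (\<integral>\<^sup>+u. G (sym_matrix (\<lambda>k\<in>upper_pairs. u (p k))) \<partial>upper_lborel)"
    by (rule nn_integral_PiM_permute[where F = "\<lambda>u. G (sym_matrix u)", symmetric]) (auto simp: bij)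
  also have "\<dots> = (\<integral>\<^sup>+S. G (?B ** S ** transpose ?B) \<partial>sym_lborel)"
    unfolding eq by (rule nn_integral_sym_lborel[symmetric]) measurable
  finally show "(\<integral>\<^sup>+S. G S \<partial>sym_lborel)
      = ennreal (\<bar>det ?B\<bar> ^ (CARD('p) + 1)) * (\<integral>\<^sup>+S. G (?B ** S ** transpose ?B) \<partial>sym_lborel)"
    by (simp add: det)
qed

text \<open>
  The congruence by \<open>I + E\<^bsub>mn\<^esub>\<close> factors into translations of single coordinates \<open>\<sigma>\<^bsub>mk\<^esub>\<close> by
  functions of the remaining coordinates: first \<open>\<sigma>\<^bsub>mm\<^esub>\<close> and then \<open>\<sigma>\<^bsub>mk\<^esub>\<close> for \<open>k \<noteq> m\<close>.
\<close>

lemma congr_scales_shear: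
  fixes m n :: "'p::{finite,linorder}"
  assumes mn: "m \<noteq> n"
  shows "congr_scales (\<chi> i j. of_bool (i = m \<and> j = n \<or> i = j))"
  unfolding congr_scales_def
proof (intro impI ballI)
  let ?B = "(\<chi> i j. of_bool (i = m \<and> j = n \<or> i = j)) :: 'p rmat"
  have "det (\<chi> k. if k = m then row m (mat 1) + 1 *s row n (mat 1) else row k (mat 1)) = det (mat 1 :: 'p rmat)"
    by (rule det_row_operation[OF mn])
  moreover have "(\<chi> k. if k = m then row m (mat 1) + 1 *s row n (mat 1) else row k (mat 1)) = ?B"
    using mn by (auto simp: vec_eq_iff row_def mat_def)
  ultimately have det: "det ?B = 1" by simp
  define key :: "'p \<Rightarrow> 'p \<Rightarrow> 'p \<times> 'p" where "key i j = (min i j, max i j)" for i j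
  have key_eq: "key i j = key k l \<longleftrightarrow> (i = k \<and> j = l) \<or> (i = l \<and> j = k)" for i j k l
    by (auto simp: key_def min_def max_def split: if_splits)
  have key_in[simp]: "key i j \<in> upper_pairs" for i j by (simp add: key_def)
  have sm: "sym_matrix u $ i $ j = u (key i j)" for u i j by (simp add: key_def)
  define upd :: "'p set \<Rightarrow> ('p \<times> 'p \<Rightarrow> real) \<Rightarrow> 'p \<times> 'p \<Rightarrow> real" where
    "upd K u = (\<lambda>k\<in>upper_pairs. u k + (\<Sum>l\<in>K. if k = key m l then u (key n l) else 0))" for K u
  have upd_meas[measurable]: "upd K \<in> upper_lborel \<rightarrow>\<^sub>M upper_lborel" for K
    unfolding upd_def by measurable
  have upd: "(\<integral>\<^sup>+u. F (upd K u) \<partial>upper_lborel) = (\<integral>\<^sup>+u. F u \<partial>upper_lborel)"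
    if F[measurable]: "F \<in> borel_measurable upper_lborel" and "m \<notin> K" for K F
    using finite[of K] \<open>m \<notin> K\<close>
  proof (induction K rule: finite_induct)
    case empty
    have "upd {} u = u" if "u \<in> space upper_lborel" for u
      using that by (auto simp: upd_def fun_eq_iff space_PiM PiE_def extensional_def)
    then show ?case by (intro nn_integral_cong) simp
  next
    case (insert l K)
    define \<phi> where "\<phi> u = u (key n l)" for u :: "'p \<times> 'p \<Rightarrow> real"
    \<comment> \<open>The increments read only entries that do not involve the index m, while every
      shifted entry involves m; hence the shifts can be split off one at a time.\<close>
    have nl: "key n k \<noteq> key m l" if "k \<in> insert l K" for k
      using insert.prems insert.hyps mn that by (auto simp: key_eq)
    have step: "upd (insert l K) u = upd K (\<lambda>k\<in>upper_pairs. u k + (if k = key m l then \<phi> u else 0))" for u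
    proof
      fix k
      show "upd (insert l K) u k = upd K (\<lambda>k\<in>upper_pairs. u k + (if k = key m l then \<phi> u else 0)) k"
        using insert.hyps nl by (auto simp: upd_def \<phi>_def intro!: sum.cong)
    qed
    have "(\<integral>\<^sup>+u. F (upd K (\<lambda>k\<in>upper_pairs. u k + (if k = key m l then \<phi> u else 0))) \<partial>upper_lborel)
      = (\<integral>\<^sup>+u. F (upd K u) \<partial>upper_lborel)"
      using nl[of l] by (intro nn_integral_PiM_shear[where F = "\<lambda>u. F (upd K u)"]) (auto simp: \<phi>_def)
    then show ?case using insert unfolding step by auto
  qed
  \<comment> \<open>The increment of the entry at (m, m) when row n is added to row m and column n
    to column m. It uses the old entry at (m, n), so this shift precedes those in
    \<open>upd\<close>.\<close>
  define \<psi> where "\<psi> u = 2 * u (key m n) + u (key n n)" for u :: "'p \<times> 'p \<Rightarrow> real"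
  define upm :: "('p \<times> 'p \<Rightarrow> real) \<Rightarrow> 'p \<times> 'p \<Rightarrow> real" where
    "upm u = (\<lambda>k\<in>upper_pairs. u k + (if k = key m m then \<psi> u else 0))" for u
  fix G :: "'p rmat \<Rightarrow> ennreal" assume G[measurable]: "G \<in> borel_measurable borel"
  have eq: "sym_matrix (upd (- {m}) (upm u)) = ?B ** sym_matrix u ** transpose ?B" for u
  proof -
    have B: "(\<Sum>k\<in>UNIV. ?B $ i $ k * f k) = f i + (if i = m then f n else 0)" for i and f :: "'p \<Rightarrow> real"
    proof -
      have "(\<Sum>k\<in>UNIV. ?B $ i $ k * f k) = (\<Sum>k\<in>UNIV. (if k = i then f k else 0) + (if k = n then (if i = m then f k else 0) else 0))"
        using mn by (intro sum.cong) auto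
      then show ?thesis by (simp add: sum.distrib)
    qed
    have R: "(?B ** sym_matrix u ** transpose ?B) $ i $ j
      = u (key i j) + (if i = m then u (key n j) else 0) + (if j = m then u (key i n) + (if i = m then u (key n n) else 0) else 0)" for i j
    proof -
      have "(?B ** sym_matrix u) $ i $ j = u (key i j) + (if i = m then u (key n j) else 0)" for i j
        unfolding matrix_matrix_mult_def vec_lambda_beta[of "\<lambda>i. \<chi> j. sum _ _" i] vec_lambda_beta[of "\<lambda>j. sum _ _" j]
        by (subst B) (simp add: sm del: sym_matrix_nth)
      then have "(?B ** sym_matrix u ** transpose ?B) $ i $ j = (\<Sum>k\<in>UNIV. ?B $ j $ k * (u (key i k) + (if i = m then u (key n k) else 0)))"
        by (simp add: matrix_matrix_mult_def[of "_ ** _"] transpose_def mult.commute)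
      then show ?thesis by (subst (asm) B) auto
    qed
    have L: "sym_matrix (upd (- {m}) (upm u)) $ i $ j
      = upm u (key i j) + (\<Sum>l\<in>- {m}. if key i j = key m l then upm u (key n l) else 0)" for i j
      by (simp add: sm upd_def del: sym_matrix_nth)
    have S1: "(\<Sum>l\<in>- {m}. if key i j = key m l then g l else 0)
        = (if i = m \<and> j \<noteq> m then g j else 0) + (if j = m \<and> i \<noteq> m then g i else 0)" for i j and g :: "'p \<Rightarrow> real"
    proof -
      have "(\<Sum>l\<in>- {m}. if key i j = key m l then g l else 0)
        = (\<Sum>l\<in>- {m}. (if l = j then (if i = m then g l else 0) else 0) + (if l = i then (if j = m then g l else 0) else 0))"
        by (intro sum.cong) (auto simp: key_eq)
      then show ?thesis by (simp add: sum.distrib)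
    qed
    have ks: "key i j = key j i" for i j by (simp add: key_eq)
    show ?thesis
      unfolding vec_eq_iff
    proof (intro allI)
      fix i j
      show "sym_matrix (upd (- {m}) (upm u)) $ i $ j = (?B ** sym_matrix u ** transpose ?B) $ i $ j"
        unfolding L R S1 using mn by (auto simp: upm_def \<psi>_def key_eq ks[of n i] ks[of n m] ks[of n j])
    qed
  qed
  have "(\<integral>\<^sup>+S. G S \<partial>sym_lborel) = (\<integral>\<^sup>+u. G (sym_matrix u) \<partial>upper_lborel)"
    by (rule nn_integral_sym_lborel) measurable
  also have "\<dots> = (\<integral>\<^sup>+u. G (sym_matrix (upd (- {m}) u)) \<partial>upper_lborel)"
    by (rule upd[symmetric, where F = "\<lambda>u. G (sym_matrix u)"]) auto
  also have "\<dots> = (\<integral>\<^sup>+u. G (sym_matrix (upd (- {m}) (upm u))) \<partial>upper_lborel)"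
    unfolding upm_def
    using mn by (intro nn_integral_PiM_shear[where F = "\<lambda>u. G (sym_matrix (upd (- {m}) u))", symmetric])
      (auto simp: \<psi>_def[abs_def] key_eq)
  also have "\<dots> = (\<integral>\<^sup>+S. G (?B ** S ** transpose ?B) \<partial>sym_lborel)"
    unfolding eq by (rule nn_integral_sym_lborel[symmetric]) measurable
  finally show "(\<integral>\<^sup>+S. G S \<partial>sym_lborel)
      = ennreal (\<bar>det ?B\<bar> ^ (CARD('p) + 1)) * (\<integral>\<^sup>+S. G (?B ** S ** transpose ?B) \<partial>sym_lborel)"
    by (simp only: det abs_one power_one ennreal_1 mult_1)
qed

text \<open>Factorisation into elementary matrices takes the place of differential calculus: the
  scaling rule is multiplicative and known for each elementary type.\<close>

lemma nn_integral_sym_lborel_congruence: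
  fixes B :: "'p::{finite,linorder} rmat"
  assumes "invertible B" "G \<in> borel_measurable borel"
  shows "(\<integral>\<^sup>+S. G S \<partial>sym_lborel)
       = ennreal (\<bar>det B\<bar> ^ (CARD('p) + 1)) * (\<integral>\<^sup>+S. G (B ** S ** transpose B) \<partial>sym_lborel)"
proof -
  have "congr_scales B"
  proof (induction B rule: induct_matrix_elementary_alt)
    case (2 A i)
    then have "det A = 0" by (rule det_zero_row)
    then show ?case by (simp add: congr_scales_def invertible_det_nz)
  next
    case (5 m n)
    then show ?case by (rule congr_scales_shear)
  next
    case (1 A B)
    then show ?case by (rule congr_scales_mult)
  next
    case (3 A)
    then show ?case by (rule congr_scales_diagonal)
  next
    case (4 m n)
    show ?case by (rule congr_scales_swap)
  qed
  then show ?thesis using assms by (rule congr_scalesD)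
qed

lemma nn_integral_sym_lborel_add_mat:
  fixes G :: "'p::{finite,linorder} rmat \<Rightarrow> ennreal"
  assumes [measurable]: "G \<in> borel_measurable borel"
  shows "(\<integral>\<^sup>+S. G (S + t *\<^sub>R mat 1) \<partial>sym_lborel) = (\<integral>\<^sup>+S. G S \<partial>sym_lborel)"
proof -
  have eq: "sym_matrix (\<lambda>k\<in>upper_pairs. (if fst k = snd k then t else 0) + 1 * u k) = sym_matrix u + t *\<^sub>R mat 1" for u :: "'p \<times> 'p \<Rightarrow> real"
    by (auto simp: vec_eq_iff mat_def min_def max_def)
  have "(\<integral>\<^sup>+S. G (S + t *\<^sub>R mat 1) \<partial>sym_lborel) = (\<integral>\<^sup>+u. G (sym_matrix u + t *\<^sub>R mat 1) \<partial>upper_lborel)"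
    by (rule nn_integral_sym_lborel) measurable
  also have "\<dots> = (\<integral>\<^sup>+u. G (sym_matrix u) \<partial>upper_lborel)"
    unfolding eq[symmetric]
    by (subst (2) nn_integral_PiM_affine[where c = "\<lambda>_. 1" and t = "\<lambda>k. if fst k = snd k then t else 0"]) auto
  finally show ?thesis by (simp add: nn_integral_sym_lborel)
qed

text \<open>Because A is symmetric, the constraints at (i, j) and (j, i) coincide, and the preimage
  in coordinates is a product of intervals.\<close>

lemma emeasure_sym_lborel_box:
  fixes A :: "'p::{finite,linorder} rmat"
  assumes "transpose A = A" "\<delta> > 0"
  shows "emeasure sym_lborel {S. \<forall>i j. \<bar>S $ i $ j - A $ i $ j\<bar> < \<delta>} = ennreal ((2 * \<delta>) ^ card (upper_pairs :: ('p \<times> 'p) set))"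
proof -
  let ?U = "{S :: 'p rmat. \<forall>i j. \<bar>S $ i $ j - A $ i $ j\<bar> < \<delta>}"
  have "?U = (\<Inter>i. \<Inter>j. {S. \<bar>S $ i $ j - A $ i $ j\<bar> < \<delta>})" by auto
  moreover have "open {S :: 'p rmat. \<bar>S $ i $ j - A $ i $ j\<bar> < \<delta>}" for i j
    by (intro open_Collect_less continuous_intros)
  ultimately have "open ?U" by (auto intro!: open_INT)
  then have U: "?U \<in> sets borel" by simp
  let ?I = "\<lambda>(i, j). {A $ i $ j - \<delta> <..< A $ i $ j + \<delta>}"
  have A: "A $ i $ j = A $ j $ i" for i j
    using assms(1) by (metis (no_types, lifting) transpose_def vec_lambda_beta)
  have "sym_matrix -` ?U \<inter> space upper_lborel = Pi\<^sub>E upper_pairs ?I"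
  proof (intro set_eqI iffI)
    fix u assume "u \<in> sym_matrix -` ?U \<inter> space upper_lborel"
    then have u: "\<And>i j. \<bar>u (min i j, max i j) - A $ i $ j\<bar> < \<delta>" "u \<in> extensional upper_pairs"
      by (auto simp: space_PiM PiE_def)
    show "u \<in> Pi\<^sub>E upper_pairs ?I"
    proof (rule PiE_I)
      fix k :: "'p \<times> 'p" assume "k \<in> upper_pairs"
      then obtain i j where k: "k = (i, j)" "i \<le> j" by (auto simp: upper_pairs_def)
      show "u k \<in> ?I k" using u(1)[of i j] k by (auto simp: min_def max_def abs_less_iff)
    qed (use u in \<open>auto simp: extensional_def\<close>)
  next
    fix u assume u: "u \<in> Pi\<^sub>E upper_pairs ?I"
    have "\<bar>u (min i j, max i j) - A $ i $ j\<bar> < \<delta>" for i j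
    proof -
      have "u (min i j, max i j) \<in> ?I (min i j, max i j)" using u by (rule PiE_mem) simp
      then show ?thesis using A[of i j] by (auto simp: min_def max_def abs_less_iff split: if_splits)
    qed
    then show "u \<in> sym_matrix -` ?U \<inter> space upper_lborel" using u by (auto simp: space_PiM PiE_def)
  qed
  then have "emeasure sym_lborel ?U = emeasure upper_lborel (Pi\<^sub>E upper_pairs ?I)"
    unfolding sym_lborel_distr using U by (subst emeasure_distr) auto
  also have "\<dots> = (\<Prod>k\<in>(upper_pairs :: ('p \<times> 'p) set). emeasure lborel (?I k))"
    by (intro lborel_PiM.emeasure_PiM) auto
  also have "\<dots> = (\<Prod>k\<in>(upper_pairs :: ('p \<times> 'p) set). ennreal (2 * \<delta>))"
    using assms(2) by (intro prod.cong) (auto simp: algebra_simps)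
  also have "\<dots> = ennreal ((2 * \<delta>) ^ card (upper_pairs :: ('p \<times> 'p) set))"
    using assms(2) by (simp add: ennreal_power)
  finally show ?thesis .
qed

lemma emeasure_sym_lborel_bounded:
  fixes A :: "'p::{finite,linorder} rmat set"
  assumes "\<And>S i j. S \<in> A \<Longrightarrow> \<bar>S $ i $ j\<bar> < d"
  shows "emeasure sym_lborel A < \<infinity>"
proof (cases "d > 0")
  case True
  have "emeasure sym_lborel A \<le> emeasure sym_lborel {S :: 'p rmat. \<forall>i j. \<bar>S $ i $ j - mat 0 $ i $ j\<bar> < d}"
  proof (rule emeasure_mono)
    show "A \<subseteq> {S :: 'p rmat. \<forall>i j. \<bar>S $ i $ j - mat 0 $ i $ j\<bar> < d}" using assms by (auto simp: mat_def)
    have "{S :: 'p rmat. \<forall>i j. \<bar>S $ i $ j - mat 0 $ i $ j\<bar> < d} = (\<Inter>i. \<Inter>j. {S. \<bar>S $ i $ j - mat 0 $ i $ j\<bar> < d})" by auto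
    moreover have "open {S :: 'p rmat. \<bar>S $ i $ j - mat 0 $ i $ j\<bar> < d}" for i j
      by (intro open_Collect_less continuous_intros)
    ultimately have "open {S :: 'p rmat. \<forall>i j. \<bar>S $ i $ j - mat 0 $ i $ j\<bar> < d}" by (simp only:) (intro open_INT ballI finite)
    then show "{S :: 'p rmat. \<forall>i j. \<bar>S $ i $ j - mat 0 $ i $ j\<bar> < d} \<in> sets sym_lborel" by simp
  qed
  also have "\<dots> < \<infinity>" using True by (subst emeasure_sym_lborel_box) (auto simp: transpose_def vec_eq_iff)
  finally show ?thesis .
next
  case False
  then have "A = {}" using assms by fastforce
  then show ?thesis by simp
qed

text \<open>Sigma-finiteness does not pass to image measures in general; here balls exhaust the
  space and have finite measure because their entries are bounded.\<close>

lemma sigma_finite_sym_lborel: "sigma_finite_measure (sym_lborel :: 'p::{finite,linorder} rmat measure)"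
proof
  define C where "C n = cball (0 :: 'p rmat) (real n)" for n :: nat
  have "\<bar>S $ i $ j\<bar> < real n + 1" if "S \<in> C n" for S n i j
  proof -
    have "\<bar>S $ i $ j\<bar> \<le> norm (S $ i)" by (rule component_le_norm_cart)
    also have "\<dots> \<le> norm S" by (rule Finite_Cartesian_Product.norm_nth_le)
    finally show ?thesis using that by (simp add: C_def)
  qed
  then have "emeasure sym_lborel (C n) < \<infinity>" for n by (rule emeasure_sym_lborel_bounded)
  moreover have "(\<Union>n. C n) = UNIV"
    unfolding C_def by (auto intro: real_arch_simple)
  ultimately show "\<exists>A. countable A \<and> A \<subseteq> sets (sym_lborel :: 'p rmat measure) \<and> \<Union> A = space sym_lborel \<and>
      (\<forall>a\<in>A. emeasure (sym_lborel :: 'p rmat measure) a \<noteq> \<infinity>)"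
    by (intro exI[of _ "range C"]) (auto simp: C_def less_top[symmetric])
qed

interpretation sym_lborel: sigma_finite_measure sym_lborel by (rule sigma_finite_sym_lborel)

text \<open>After division by c, an exponential density and its reflection, each of mass 1, together
  dominate the two-sided exponential.\<close>

lemma nn_integral_exp_abs_finite:
  assumes "c > 0"
  shows "(\<integral>\<^sup>+x. ennreal (exp (- c * \<bar>x\<bar>)) \<partial>lborel) < \<infinity>"
proof -
  have e: "(\<integral>\<^sup>+x. ennreal (exponential_density c x) \<partial>lborel) = 1"
    using prob_space.emeasure_space_1[OF prob_space_exponential_density[OF assms]]
    by (simp add: emeasure_density)
  then have e': "(\<integral>\<^sup>+x. ennreal (exponential_density c (- x)) \<partial>lborel) = 1"
    using nn_integral_real_affine[of "\<lambda>x. ennreal (exponential_density c x)" "-1" 0] by simp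
  have "(\<integral>\<^sup>+x. ennreal (exp (- c * \<bar>x\<bar>)) \<partial>lborel)
    \<le> (\<integral>\<^sup>+x. ennreal (1 / c) * (ennreal (exponential_density c x) + ennreal (exponential_density c (- x))) \<partial>lborel)"
  proof (rule nn_integral_mono)
    fix x :: real
    have "exp (- c * \<bar>x\<bar>) \<le> 1 / c * (exponential_density c x + exponential_density c (- x))"
      using assms by (cases "x = 0") (auto simp: exponential_density_def mult.commute abs_if field_simps)
    then have "ennreal (exp (- c * \<bar>x\<bar>)) \<le> ennreal (1 / c * (exponential_density c x + exponential_density c (- x)))"
      by (rule ennreal_leI)
    moreover have "exponential_density c y \<ge> 0" for y
      using assms by (simp add: exponential_density_def)
    ultimately show "ennreal (exp (- c * \<bar>x\<bar>)) \<le> ennreal (1 / c) * (ennreal (exponential_density c x) + ennreal (exponential_density c (- x)))"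
      using assms by (simp add: ennreal_mult ennreal_plus del: times_divide_eq_left)
  qed
  also have "\<dots> = ennreal (1 / c) * (1 + 1)"
    by (subst nn_integral_cmult, simp, subst nn_integral_add) (simp_all add: e e')
  also have "\<dots> < \<infinity>" by (simp add: ennreal_mult_less_top)
  finally show ?thesis .
qed

lemma nn_integral_sym_exp_entries_finite:
  assumes "c > 0"
  shows "(\<integral>\<^sup>+S. (\<Prod>(i, j)\<in>upper_pairs. ennreal (exp (- c * \<bar>S $ i $ j\<bar>))) \<partial>(sym_lborel :: 'p::{finite,linorder} rmat measure)) < \<infinity>"
proof -
  have "(\<lambda>S :: 'p rmat. (\<Prod>(i, j)\<in>upper_pairs. ennreal (exp (- c * \<bar>S $ i $ j\<bar>)))) \<in> borel_measurable borel"
    unfolding case_prod_beta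
    by (intro borel_measurable_prod_ennreal measurable_compose[OF _ measurable_ennreal]
        borel_measurable_continuous_onI continuous_intros)
  then have "(\<integral>\<^sup>+S. (\<Prod>(i, j)\<in>upper_pairs. ennreal (exp (- c * \<bar>S $ i $ j\<bar>))) \<partial>(sym_lborel :: 'p rmat measure))
    = (\<integral>\<^sup>+u. (\<Prod>(i, j)\<in>upper_pairs. ennreal (exp (- c * \<bar>sym_matrix u $ i $ j\<bar>))) \<partial>(upper_lborel :: ('p \<times> 'p \<Rightarrow> real) measure))"
    by (rule nn_integral_sym_lborel)
  also have "\<dots> = (\<integral>\<^sup>+u. (\<Prod>k\<in>upper_pairs. ennreal (exp (- c * \<bar>u k\<bar>))) \<partial>(upper_lborel :: ('p \<times> 'p \<Rightarrow> real) measure))"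
    by (intro nn_integral_cong prod.cong) (auto simp: upper_pairs_def min_def max_def)
  also have "\<dots> = (\<Prod>k\<in>(upper_pairs :: ('p \<times> 'p) set). \<integral>\<^sup>+x. ennreal (exp (- c * \<bar>x\<bar>)) \<partial>lborel)"
    by (rule lborel_PiM.product_nn_integral_prod) auto
  also have "\<dots> < \<infinity>"
    using nn_integral_exp_abs_finite[OF assms] by (simp add: ennreal_prod_eq_top power_less_top_ennreal less_top)
  finally show ?thesis .
qed

subsection \<open>The Haar integral of the likelihood\<close>

lemma norm_matrix_le:
  fixes A :: "'n::finite rmat"
  assumes "\<And>i j. \<bar>A $ i $ j\<bar> \<le> d"
  shows "norm A \<le> real CARD('n) * d"
proof -
  have d: "d \<ge> 0" using assms[of undefined undefined] by linarith
  have "(norm A)\<^sup>2 \<le> (\<Sum>i\<in>(UNIV::'n set). \<Sum>j\<in>(UNIV::'n set). d\<^sup>2)"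
    unfolding norm_matrix_sq
    by (intro sum_mono) (metis assms abs_ge_zero power2_abs power_mono)
  also have "\<dots> = (real CARD('n) * d)\<^sup>2" by (simp add: power2_eq_square)
  finally show ?thesis by (rule power2_le_imp_le) (simp add: d)
qed

lemma emeasure_sym_lborel_ball:
  fixes A :: "'p::{finite,linorder} rmat"
  assumes "transpose A = A" "e > 0"
  shows "emeasure sym_lborel (ball A e) > 0"
proof -
  define d where "d = e / (real CARD('p) + 1)"
  have d: "d > 0" using assms by (simp add: d_def)
  have "dist A S < e" if "\<forall>i j. \<bar>S $ i $ j - A $ i $ j\<bar> < d" for S
  proof -
    have "norm (S - A) \<le> real CARD('p) * d" using that by (intro norm_matrix_le) (simp add: less_imp_le)
    also have "\<dots> < e" using assms by (simp add: d_def field_simps)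
    finally show ?thesis by (simp add: dist_norm norm_minus_commute)
  qed
  then have "{S. \<forall>i j. \<bar>S $ i $ j - A $ i $ j\<bar> < d} \<subseteq> ball A e" by auto
  then have "emeasure sym_lborel {S. \<forall>i j. \<bar>S $ i $ j - A $ i $ j\<bar> < d} \<le> emeasure sym_lborel (ball A e)"
    by (intro emeasure_mono) auto
  moreover have "emeasure sym_lborel {S. \<forall>i j. \<bar>S $ i $ j - A $ i $ j\<bar> < d} > 0"
    using d by (simp add: emeasure_sym_lborel_box[OF assms(1) d])
  ultimately show ?thesis by order
qed

text \<open>The measure charges every ball around a symmetric matrix. This yields positivity of
  \<open>haar_integral\<close> and \<open>kernel_mass\<close> and, for continuous functions, the
  passage from almost everywhere to everywhere.\<close>

lemma not_AE_near_symmetric: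
  fixes A :: "'p::{finite,linorder} rmat"
  assumes "transpose A = A" "e > 0" "\<And>S. transpose S = S \<Longrightarrow> dist S A < e \<Longrightarrow> \<not> P S"
  shows "\<not> (AE S in sym_lborel. P S)"
proof
  assume "AE S in sym_lborel. P S"
  then have "AE S in sym_lborel. S \<notin> ball A e"
    using AE_sym_lborel_symmetric by eventually_elim (use assms(3) in \<open>auto simp: dist_commute\<close>)
  then have "emeasure sym_lborel (ball A e) = 0"
    by (subst (asm) AE_iff_measurable[where N = "ball A e"]) auto
  then show False using emeasure_sym_lborel_ball[OF assms(1,2)] by simp
qed

lemma powr_square_mult:
  fixes b x k :: real
  assumes "b \<ge> 0" "x \<ge> 0"
  shows "(b powr 2 * x) powr (- k / 2) = b powr (- k) * x powr (- k / 2)"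
  using assms by (simp add: powr_mult powr_powr del: powr_numeral)

text \<open>Up to its constant, the inverse Wishart density with a degrees of freedom and scale
  matrix A: the power -a/2 of the determinant belongs to the likelihood and the power -(p+1)/2 to
  the invariant measure.\<close>

definition haar_weight :: "real \<Rightarrow> 'p::{finite,linorder} rmat \<Rightarrow> 'p rmat \<Rightarrow> real" where
  "haar_weight a A S = indicator {S. posdef S} S *
     (det S powr (- (a + real CARD('p) + 1) / 2) * exp (- trace (matrix_inv S ** A) / 2))"

lemma haar_weight_nonneg: "haar_weight a A S \<ge> 0"
  by (simp add: haar_weight_def)

lemma borel_measurable_haar_weight [measurable]:
  "haar_weight a (A :: 'p::{finite,linorder} rmat) \<in> borel_measurable borel"
proof -
  have "continuous_on {S :: 'p rmat. posdef S}
      (\<lambda>S. det S powr (- (a + real CARD('p) + 1) / 2) * exp (- trace (matrix_inv S ** A) / 2))"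
    by (intro continuous_intros continuous_on_subset[OF continuous_on_matrix_inv])
       (auto simp: posdef_invertible dest: posdef_det_pos)
  from borel_measurable_continuous_on_indicator[OF posdef_borel this] show ?thesis
    by (simp add: haar_weight_def[abs_def])
qed

definition haar_integral :: "real \<Rightarrow> 'p::{finite,linorder} rmat \<Rightarrow> ennreal" where
  "haar_integral a A = (\<integral>\<^sup>+S. ennreal (haar_weight a A S) \<partial>sym_lborel)"

lemma haar_weight_congruence:
  fixes B :: "'p::{finite,linorder} rmat"
  assumes "invertible B"
  shows "haar_weight a (B ** A ** transpose B) (B ** S ** transpose B)
       = \<bar>det B\<bar> powr (- (a + real CARD('p) + 1)) * haar_weight a A S"
proof (cases "posdef S")
  case True
  have inv: "invertible S" "invertible (transpose B)" "invertible (B ** S)"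
    using posdef_det_pos[OF True] assms by (auto simp: invertible_det_nz det_mul)
  have "det (B ** S ** transpose B) = \<bar>det B\<bar> powr 2 * det S"
    using assms by (simp add: det_mul power2_eq_square invertible_det_nz)
  then have "det (B ** S ** transpose B) powr (- (a + real CARD('p) + 1) / 2)
     = \<bar>det B\<bar> powr (- (a + real CARD('p) + 1)) * det S powr (- (a + real CARD('p) + 1) / 2)"
    using posdef_det_pos[OF True] powr_square_mult[of "\<bar>det B\<bar>" "det S" "a + real CARD('p) + 1"]
    by (simp only: abs_ge_zero less_imp_le)
  moreover have "trace (matrix_inv (B ** S ** transpose B) ** (B ** A ** transpose B)) = trace (matrix_inv S ** A)"
  proof -
    let ?C = "matrix_inv B"
    have "matrix_inv (B ** S ** transpose B) ** (B ** A ** transpose B)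
      = transpose ?C ** matrix_inv S ** (?C ** B) ** A ** transpose B"
      using inv assms by (simp add: matrix_inv_prod matrix_inv_transpose matrix_mul_assoc)
    also have "\<dots> = transpose ?C ** (matrix_inv S ** A ** transpose B)"
      by (simp add: matrix_inv_mult assms matrix_mul_assoc)
    finally have eq: "matrix_inv (B ** S ** transpose B) ** (B ** A ** transpose B)
      = transpose ?C ** (matrix_inv S ** A ** transpose B)" .
    have "trace (matrix_inv (B ** S ** transpose B) ** (B ** A ** transpose B))
      = trace (matrix_inv S ** A ** (transpose B ** transpose ?C))"
      unfolding eq using trace_mul_sym[of "transpose ?C" "matrix_inv S ** A ** transpose B"]
      by (simp only: matrix_mul_assoc)
    also have "transpose B ** transpose ?C = mat 1"
      using assms by (metis matrix_inv_mult(2) matrix_transpose_mul transpose_mat)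
    finally show ?thesis by simp
  qed
  ultimately show ?thesis using True by (simp add: haar_weight_def posdef_congruence_iff[OF assms])
qed (simp add: haar_weight_def posdef_congruence_iff[OF assms])

text \<open>The Jacobian cancels the part of the weight that belongs to the invariant measure, which
  leaves the power -a of |det B|.\<close>

lemma haar_integral_congruence:
  fixes B :: "'p::{finite,linorder} rmat"
  assumes "invertible B"
  shows "haar_integral a (B ** A ** transpose B) = ennreal (\<bar>det B\<bar> powr (- a)) * haar_integral a A"
proof -
  let ?d = "\<bar>det B\<bar>"
  have d: "?d > 0" using assms by (simp add: invertible_det_nz)
  have "haar_integral a (B ** A ** transpose B)
      = ennreal (?d ^ (CARD('p) + 1)) * (\<integral>\<^sup>+S. ennreal (?d powr (- (a + real CARD('p) + 1))) * ennreal (haar_weight a A S) \<partial>sym_lborel)"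
    unfolding haar_integral_def
    by (subst nn_integral_sym_lborel_congruence[OF assms])
       (simp_all add: haar_weight_congruence[OF assms] ennreal_mult haar_weight_nonneg del: power_Suc)
  also have "\<dots> = ennreal (?d ^ (CARD('p) + 1)) * ennreal (?d powr (- (a + real CARD('p) + 1))) * haar_integral a A"
    unfolding haar_integral_def by (subst nn_integral_cmult) (auto simp: mult.assoc)
  also have "ennreal (?d ^ (CARD('p) + 1)) * ennreal (?d powr (- (a + real CARD('p) + 1))) = ennreal (?d powr (- a))"
  proof -
    have "?d ^ (CARD('p) + 1) = ?d powr (real CARD('p) + 1)" using d by (simp add: powr_add powr_realpow)
    then show ?thesis using d by (simp add: ennreal_mult'[symmetric] powr_add[symmetric] del: power_Suc)
  qed
  finally show ?thesis .
qed

lemma haar_integral_eq: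
  fixes A :: "'p::{finite,linorder} rmat"
  assumes "posdef A"
  shows "haar_integral a A = ennreal (det A powr (- a / 2)) * haar_integral a (mat 1 :: 'p rmat)"
proof -
  obtain B :: "'p rmat" where B: "invertible B" "A = B ** transpose B" using posdef_factor[OF assms] .
  have "det A = \<bar>det B\<bar> powr 2" using B(1) by (simp add: B(2) det_mul power2_eq_square invertible_det_nz)
  then have "det A powr (- a / 2) = \<bar>det B\<bar> powr (- a)" by (simp add: powr_powr del: powr_numeral)
  then show ?thesis using haar_integral_congruence[OF B(1), of a "mat 1"] by (simp add: B(2))
qed

lemma haar_integral_pos:
  "haar_integral a (mat 1 :: 'p::{finite,linorder} rmat) > 0"
proof -
  obtain e where e: "e > 0" "\<And>S. transpose S = S \<Longrightarrow> dist S (mat 1 :: 'p rmat) < e \<Longrightarrow> posdef S"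
    using posdef_open_in_symmetric[OF posdef_mat_1] by blast
  have "\<not> (AE S in sym_lborel. haar_weight a (mat 1 :: 'p rmat) S \<le> 0)"
  proof (rule not_AE_near_symmetric[OF _ e(1)])
    fix S :: "'p rmat" assume "transpose S = S" "dist S (mat 1) < e"
    then have "posdef S" by (rule e(2))
    then show "\<not> haar_weight a (mat 1) S \<le> 0"
      using posdef_det_pos[of S] by (simp add: haar_weight_def mult_le_0_iff not_le)
  qed (simp add: transpose_mat)
  then show ?thesis
    unfolding haar_integral_def zero_less_iff_neq_zero
    by (subst nn_integral_0_iff_AE) (auto simp: ennreal_eq_0_iff)
qed

text \<open>
  Finiteness of the Haar integral does not need an explicit evaluation: with the invariant kernel
  \<open>k(S,V) = 1{tr (S V) \<le> p + 1, det (S V) \<ge> 1/2}\<close>, whose integral against the invariant measure in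
  either variable is the same constant \<open>c \<in> (0,\<infinity>)\<close>, Tonelli's theorem turns \<open>c\<close> times the integral of
  \<open>|S|\<^sup>-\<^sup>a\<^sup>/\<^sup>2 exp (- tr S\<^sup>-\<^sup>1 / 2)\<close> into at most \<open>c\<close> times an integral of \<open>|V|\<^sup>a\<^sup>/\<^sup>2 exp (- \<epsilon> tr V)\<close>, whose
  convergence is plain for \<open>a \<ge> p + 1\<close>. The kernel replaces the change of variables \<open>V = S\<^sup>-\<^sup>1\<close>.
\<close>

definition inv_density :: "'p::{finite,linorder} rmat \<Rightarrow> real" where
  "inv_density S = indicator {S. posdef S} S * det S powr (- (real CARD('p) + 1) / 2)"

text \<open>The constants leave slack: the identity, with trace p and determinant 1, satisfies both
  inequalities strictly, so the mass is positive, while the two inequalities bound the entries and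
  the density, so it is finite. Trace and determinant are invariant under similarity and make sense
  for SV, which need not be symmetric.\<close>

definition kernel_set :: "'p::{finite,linorder} rmat set" where
  "kernel_set = {W. trace W \<le> real CARD('p) + 1 \<and> 1 / 2 \<le> det W}"

definition kernel_mass :: "'p::{finite,linorder} itself \<Rightarrow> ennreal" where
  "kernel_mass _ = (\<integral>\<^sup>+W. ennreal (inv_density W * indicator kernel_set W) \<partial>(sym_lborel :: 'p rmat measure))"

lemma inv_density_nonneg: "inv_density S \<ge> 0"
  by (simp add: inv_density_def)

lemma borel_measurable_inv_density [measurable]:
  "(inv_density :: 'p::{finite,linorder} rmat \<Rightarrow> real) \<in> borel_measurable borel"
proof -
  have "continuous_on {S :: 'p rmat. posdef S} (\<lambda>S. det S powr (- (real CARD('p) + 1) / 2))"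
    by (intro continuous_intros) (auto dest: posdef_det_pos)
  from borel_measurable_continuous_on_indicator[OF posdef_borel this] show ?thesis
    by (simp add: inv_density_def[abs_def])
qed

lemma closed_kernel_set: "closed (kernel_set :: 'p::{finite,linorder} rmat set)"
  unfolding kernel_set_def by (intro closed_Collect_conj closed_Collect_le continuous_intros)

lemma kernel_set_borel [measurable]: "kernel_set \<in> sets borel"
  by (rule borel_closed[OF closed_kernel_set])

lemma kernel_pair_borel [measurable]:
  "{(S :: 'p::{finite,linorder} rmat, V). S ** V \<in> kernel_set} \<in> sets (borel \<Otimes>\<^sub>M borel)"
proof -
  have "closed {x :: 'p rmat \<times> 'p rmat. fst x ** snd x \<in> kernel_set}"
    unfolding kernel_set_def mem_Collect_eq
    by (intro closed_Collect_conj closed_Collect_le continuous_intros)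
  moreover have "{(S :: 'p rmat, V). S ** V \<in> kernel_set} = {x. fst x ** snd x \<in> kernel_set}" by auto
  ultimately show ?thesis unfolding borel_prod by (simp only: borel_closed)
qed

text \<open>With S = TT' and B the inverse of T', substituting V = BWB' turns SV into T W T^{-1},
  which is similar to W, and preserves the invariant measure.\<close>

lemma kernel_integral:
  fixes S :: "'p::{finite,linorder} rmat"
  assumes "posdef S"
  shows "(\<integral>\<^sup>+V. ennreal (inv_density V * indicator kernel_set (S ** V)) \<partial>sym_lborel) = kernel_mass TYPE('p)"
proof -
  obtain T :: "'p rmat" where T: "invertible T" "S = T ** transpose T" using posdef_factor[OF assms] .
  define B where "B = matrix_inv (transpose T)"
  have B: "invertible B" using T by (simp add: B_def invertible_matrix_inv transpose_invertible)
  have tB: "transpose T ** B = mat 1" "transpose B ** T = mat 1"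
  proof -
    show "transpose T ** B = mat 1"
      unfolding B_def by (rule matrix_inv_mult) (rule transpose_invertible[OF T(1)])
    have "transpose B = matrix_inv T" by (simp add: B_def matrix_inv_transpose T(1))
    then show "transpose B ** T = mat 1" by (simp add: matrix_inv_mult T(1))
  qed
  have "det (transpose T) * det B = 1" using tB(1) by (metis det_I det_mul)
  then have dTB: "det T * det B = 1" by simp
  let ?d = "\<bar>det B\<bar>"
  have d: "?d > 0" using B by (simp add: invertible_det_nz)
  have ker: "S ** (B ** W ** transpose B) \<in> kernel_set \<longleftrightarrow> W \<in> kernel_set" for W
  proof -
    have "S ** (B ** W ** transpose B) = T ** ((transpose T ** B) ** W ** transpose B)"
      by (simp add: T(2) matrix_mul_assoc)
    then have "S ** (B ** W ** transpose B) = T ** (W ** transpose B)" by (simp add: tB)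
    then have "trace (S ** (B ** W ** transpose B)) = trace (W ** (transpose B ** T))"
      using trace_mul_sym[of T "W ** transpose B"] by (simp only: matrix_mul_assoc)
    moreover have "det (S ** (B ** W ** transpose B)) = (det T * det B)\<^sup>2 * det W"
      by (simp add: T(2) det_mul power2_eq_square mult_ac)
    ultimately show ?thesis by (simp add: kernel_set_def tB dTB)
  qed
  have dens: "inv_density (B ** W ** transpose B) = ?d powr (- (real CARD('p) + 1)) * inv_density W" for W
  proof (cases "posdef W")
    case True
    have "det (B ** W ** transpose B) = ?d powr 2 * det W"
      using d by (simp add: det_mul power2_eq_square)
    then have "det (B ** W ** transpose B) powr (- (real CARD('p) + 1) / 2)
      = ?d powr (- (real CARD('p) + 1)) * det W powr (- (real CARD('p) + 1) / 2)"
      using posdef_det_pos[OF True] powr_square_mult[of ?d "det W" "real CARD('p) + 1"]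
      by (simp only: abs_ge_zero less_imp_le)
    then show ?thesis using True by (simp add: inv_density_def posdef_congruence_iff[OF B])
  qed (simp add: inv_density_def posdef_congruence_iff[OF B])
  have [measurable]: "(\<lambda>V. S ** V) \<in> borel \<rightarrow>\<^sub>M borel"
    by (intro borel_measurable_continuous_onI continuous_intros)
  have "(\<integral>\<^sup>+V. ennreal (inv_density V * indicator kernel_set (S ** V)) \<partial>sym_lborel)
    = ennreal (?d ^ (CARD('p) + 1)) *
      (\<integral>\<^sup>+W. ennreal (?d powr (- (real CARD('p) + 1))) * ennreal (inv_density W * indicator kernel_set W) \<partial>(sym_lborel :: 'p rmat measure))"
  proof (subst nn_integral_sym_lborel_congruence[OF B])
    have "ennreal (inv_density (B ** W ** transpose B) * indicator kernel_set (S ** (B ** W ** transpose B)))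
      = ennreal (?d powr (- (real CARD('p) + 1))) * ennreal (inv_density W * indicator kernel_set W)" for W
      unfolding dens by (subst ennreal_mult[symmetric]) (auto simp: inv_density_nonneg ker indicator_def)
    then show "ennreal (?d ^ (CARD('p) + 1)) *
      (\<integral>\<^sup>+W. ennreal (inv_density (B ** W ** transpose B) * indicator kernel_set (S ** (B ** W ** transpose B))) \<partial>sym_lborel)
      = ennreal (?d ^ (CARD('p) + 1)) *
      (\<integral>\<^sup>+W. ennreal (?d powr (- (real CARD('p) + 1))) * ennreal (inv_density W * indicator kernel_set W) \<partial>(sym_lborel :: 'p rmat measure))"
      by simp
  qed measurable
  also have "\<dots> = ennreal (?d ^ (CARD('p) + 1)) * ennreal (?d powr (- (real CARD('p) + 1))) * kernel_mass TYPE('p)"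
    unfolding kernel_mass_def by (subst nn_integral_cmult) (auto simp: mult.assoc)
  also have "ennreal (?d ^ (CARD('p) + 1)) * ennreal (?d powr (- (real CARD('p) + 1))) = 1"
  proof -
    have "?d ^ (CARD('p) + 1) = ?d powr (real CARD('p) + 1)" using d by (simp add: powr_add powr_realpow)
    then show ?thesis using d by (simp add: ennreal_mult'[symmetric] powr_add[symmetric] del: power_Suc)
  qed
  finally show ?thesis by simp
qed

lemma kernel_mass_finite: "kernel_mass TYPE('p::{finite,linorder}) < \<infinity>"
proof -
  let ?A = "{W :: 'p rmat. posdef W} \<inter> kernel_set"
  let ?c = "(1 / 2 :: real) powr (- (real CARD('p) + 1) / 2)"
  have "kernel_mass TYPE('p) \<le> (\<integral>\<^sup>+W. ennreal ?c * indicator ?A W \<partial>(sym_lborel :: 'p rmat measure))"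
    unfolding kernel_mass_def
  proof (rule nn_integral_mono)
    fix W :: "'p rmat"
    have "det W powr (- (real CARD('p) + 1) / 2) \<le> ?c" if "1 / 2 \<le> det W"
      using that by (intro powr_mono2') auto
    then show "ennreal (inv_density W * indicator kernel_set W) \<le> ennreal ?c * indicator ?A W"
      by (auto simp: inv_density_def kernel_set_def indicator_def intro!: ennreal_leI)
  qed
  also have "\<dots> = ennreal ?c * emeasure sym_lborel ?A"
    by (rule nn_integral_cmult_indicator) auto
  also have "\<dots> < \<infinity>"
  proof -
    have "emeasure sym_lborel ?A < \<infinity>"
    proof (rule emeasure_sym_lborel_bounded)
      fix W :: "'p rmat" and i j assume "W \<in> ?A"
      then show "\<bar>W $ i $ j\<bar> < real CARD('p) + 2"
        using posdef_entry_le_trace[of W i j] by (auto simp: kernel_set_def)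
    qed
    then show ?thesis by (simp add: ennreal_mult_less_top)
  qed
  finally show ?thesis .
qed

lemma kernel_mass_pos: "kernel_mass TYPE('p::{finite,linorder}) > 0"
proof -
  obtain e where e: "e > 0" "\<And>S. transpose S = S \<Longrightarrow> dist S (mat 1 :: 'p rmat) < e \<Longrightarrow> posdef S"
    using posdef_open_in_symmetric[OF posdef_mat_1] by blast
  have "open {W :: 'p rmat. trace W < real CARD('p) + 1 \<and> 1 / 2 < det W}"
    by (intro open_Collect_conj open_Collect_less continuous_intros)
  moreover have "mat 1 \<in> {W :: 'p rmat. trace W < real CARD('p) + 1 \<and> 1 / 2 < det W}"
    by (simp add: trace_I)
  ultimately obtain e' where e': "e' > 0" "\<And>W. dist W (mat 1 :: 'p rmat) < e' \<Longrightarrow> trace W < real CARD('p) + 1 \<and> 1 / 2 < det W"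
    unfolding open_dist by blast
  have "\<not> (AE S in (sym_lborel :: 'p rmat measure). inv_density S * indicator kernel_set S \<le> 0)"
  proof (rule not_AE_near_symmetric[where e = "min e e'" and A = "mat 1"])
    fix S :: "'p rmat" assume S: "transpose S = S" "dist S (mat 1) < min e e'"
    then have "posdef S" by (intro e(2)) auto
    moreover have "S \<in> kernel_set" using e'(2)[of S] S by (auto simp: kernel_set_def)
    ultimately show "\<not> inv_density S * indicator kernel_set S \<le> 0"
      using posdef_det_pos[of S] by (simp add: inv_density_def)
  qed (use e e' in \<open>auto simp: transpose_mat\<close>)
  then show ?thesis
    unfolding kernel_mass_def zero_less_iff_neq_zero
    by (subst nn_integral_0_iff_AE) (auto simp: ennreal_eq_0_iff)
qed

text \<open>The determinant is at most p! tr(V)^p. Half of the exponential absorbs the resulting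
  power of the trace, and the other half is spread over the entries, which leaves a product of
  one-dimensional integrals.\<close>

lemma gamma_integral_finite:
  assumes "a \<ge> 0" "c > 0"
  shows "(\<integral>\<^sup>+V. ennreal (indicator {V. posdef V} V * (det V powr a * exp (- c * trace V)))
           \<partial>(sym_lborel :: 'p::{finite,linorder} rmat measure)) < \<infinity>"
proof -
  let ?p = "CARD('p)" and ?N = "real (card (upper_pairs :: ('p \<times> 'p) set))"
  \<comment> \<open>Chosen so that b p a \<le> c/2: the bound tr V \<le> exp(b tr V)/b makes |V|^a
    at most a constant times exp(b p a tr V). The summand 1 covers a = 0.\<close>
  define b where "b = c / (2 * (real ?p * a + 1))"
  have b: "b > 0" unfolding b_def using assms by (intro divide_pos_pos mult_pos_pos add_nonneg_pos) auto
  have ba: "b * real ?p * a \<le> c / 2"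
  proof -
    have pos: "real ?p * a + 1 > 0" using assms(1) by (intro add_nonneg_pos) auto
    have "b * real ?p * a = c / 2 * ((real ?p * a) / (real ?p * a + 1))"
      unfolding b_def by (simp only: times_divide_eq_left times_divide_eq_right divide_divide_eq_left)
    also have "\<dots> \<le> c / 2 * 1" using assms pos by (intro mult_left_mono) (auto simp: divide_le_eq_1)
    finally show ?thesis by simp
  qed
  define C where "C = (fact ?p / b ^ ?p :: real) powr a"
  \<comment> \<open>An equal share of the remaining c/2 for each entry on or above the diagonal,
    every such entry being at most the trace in absolute value.\<close>
  define c' where "c' = c / 2 / (?N + 1)"
  have N: "?N \<ge> 0" by simp
  have c': "c' > 0" unfolding c'_def using assms by (intro divide_pos_pos) auto
  have le: "indicator {V. posdef V} V * (det V powr a * exp (- c * trace V))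
    \<le> C * (\<Prod>(i, j)\<in>upper_pairs. exp (- c' * \<bar>V $ i $ j\<bar>))" for V :: "'p rmat"
  proof (cases "posdef V")
    case True
    let ?t = "trace V"
    have t: "?t \<ge> 0" by (rule posdef_trace_nonneg[OF True])
    have "b * ?t \<le> exp (b * ?t)" using exp_ge_add_one_self[of "b * ?t"] by linarith
    then have tb: "?t \<le> exp (b * ?t) / b" using b by (simp add: pos_le_divide_eq mult.commute)
    have "det V \<le> fact ?p * ?t ^ ?p"
      using abs_det_le[of V ?t] posdef_entry_le_trace[OF True] by force
    also have "fact ?p * ?t ^ ?p \<le> fact ?p * (exp (b * ?t) / b) ^ ?p"
      using t tb by (intro mult_left_mono power_mono) auto
    also have "\<dots> = fact ?p / b ^ ?p * exp (b * real ?p * ?t)"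
      by (simp add: power_divide exp_of_nat_mult[symmetric] mult_ac)
    finally have "det V powr a \<le> (fact ?p / b ^ ?p * exp (b * real ?p * ?t)) powr a"
      using posdef_det_pos[OF True] assms(1) by (intro powr_mono2) auto
    also have "\<dots> = C * exp (b * real ?p * a * ?t)"
    proof -
      have "(fact ?p / b ^ ?p * exp y) powr a = (fact ?p / b ^ ?p) powr a * exp (y * a)" for y :: real
        using b by (subst powr_mult) (simp_all add: exp_powr_real)
      from this[of "b * real ?p * ?t"] show ?thesis by (simp add: C_def mult_ac)
    qed
    also have "\<dots> \<le> C * exp (c / 2 * ?t)"
      using mult_right_mono[OF ba t] by (intro mult_left_mono) (auto simp: C_def)
    finally have "det V powr a * exp (- c * ?t) \<le> C * exp (c / 2 * ?t) * exp (- c * ?t)"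
      by (intro mult_right_mono) auto
    also have "\<dots> = C * exp (- (c / 2) * ?t)"
      by (simp add: mult.assoc exp_add[symmetric] algebra_simps)
    also have "\<dots> \<le> C * exp (\<Sum>(i, j)\<in>upper_pairs. - c' * \<bar>V $ i $ j\<bar>)"
    proof -
      have "(\<Sum>(i, j)\<in>upper_pairs. \<bar>V $ i $ j\<bar>) \<le> (\<Sum>k\<in>(upper_pairs :: ('p \<times> 'p) set). ?t)"
        by (intro sum_mono) (auto intro: posdef_entry_le_trace[OF True])
      also have "\<dots> \<le> (?N + 1) * ?t" using t by (simp add: algebra_simps)
      finally have "c' * (\<Sum>(i, j)\<in>upper_pairs. \<bar>V $ i $ j\<bar>) \<le> c' * ((?N + 1) * ?t)"
        using c' by (intro mult_left_mono) auto
      also have "c' * ((?N + 1) * ?t) = c / 2 * ?t"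
        using N by (simp add: c'_def field_simps)
      finally have "- (c / 2) * ?t \<le> (\<Sum>(i, j)\<in>upper_pairs. - c' * \<bar>V $ i $ j\<bar>)"
        by (simp add: case_prod_beta sum_distrib_left sum_negf)
      then show ?thesis by (intro mult_left_mono) (auto simp: C_def)
    qed
    also have "\<dots> = C * (\<Prod>(i, j)\<in>upper_pairs. exp (- c' * \<bar>V $ i $ j\<bar>))"
      by (simp add: exp_sum case_prod_beta)
    finally show ?thesis using True by simp
  qed (auto simp: C_def intro!: mult_nonneg_nonneg prod_nonneg)
  have "(\<integral>\<^sup>+V. ennreal (indicator {V. posdef V} V * (det V powr a * exp (- c * trace V))) \<partial>(sym_lborel :: 'p rmat measure))
    \<le> (\<integral>\<^sup>+V. ennreal C * (\<Prod>(i, j)\<in>upper_pairs. ennreal (exp (- c' * \<bar>V $ i $ j\<bar>))) \<partial>(sym_lborel :: 'p rmat measure))"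
  proof (rule nn_integral_mono)
    fix V :: "'p rmat"
    have "ennreal C * (\<Prod>(i, j)\<in>upper_pairs. ennreal (exp (- c' * \<bar>V $ i $ j\<bar>)))
      = ennreal (C * (\<Prod>(i, j)\<in>upper_pairs. exp (- c' * \<bar>V $ i $ j\<bar>)))"
      by (subst ennreal_mult) (auto simp: C_def case_prod_beta prod_ennreal intro!: prod_nonneg)
    then show "ennreal (indicator {V. posdef V} V * (det V powr a * exp (- c * trace V)))
      \<le> ennreal C * (\<Prod>(i, j)\<in>upper_pairs. ennreal (exp (- c' * \<bar>V $ i $ j\<bar>)))"
      using le[of V] by (simp only: ennreal_leI)
  qed
  also have "\<dots> = ennreal C * (\<integral>\<^sup>+V. (\<Prod>(i, j)\<in>upper_pairs. ennreal (exp (- c' * \<bar>V $ i $ j\<bar>))) \<partial>(sym_lborel :: 'p rmat measure))"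
  proof (rule nn_integral_cmult)
    have "(\<lambda>V :: 'p rmat. (\<Prod>(i, j)\<in>upper_pairs. ennreal (exp (- c' * \<bar>V $ i $ j\<bar>)))) \<in> borel_measurable borel"
      unfolding case_prod_beta
      by (intro borel_measurable_prod_ennreal measurable_compose[OF _ measurable_ennreal]
          borel_measurable_continuous_onI continuous_intros)
    then show "(\<lambda>V :: 'p rmat. (\<Prod>(i, j)\<in>upper_pairs. ennreal (exp (- c' * \<bar>V $ i $ j\<bar>)))) \<in> borel_measurable sym_lborel"
      by (simp only: measurable_cong_sets[OF sets_sym_lborel refl])
  qed
  also have "\<dots> < \<infinity>"
    using nn_integral_sym_exp_entries_finite[OF c', where 'p = 'p] by (simp add: ennreal_mult_less_top)
  finally show ?thesis .
qed

text \<open>On the kernel, tr V \<le> tr(S^{-1}) tr(SV) replaces exp(-tr(S^{-1})/2) by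
  exp(-tr(V)/(2K)), and det(SV) \<ge> 1/2 replaces |S|^{-a/2} by (2|V|)^{a/2}. The kernel on the
  right is written with VS, the order in which \<open>kernel_integral\<close> integrates S
  out.\<close>

lemma haar_weight_kernel_le:
  fixes S V :: "'p::{finite,linorder} rmat"
  assumes "a \<ge> 0"
  defines "K \<equiv> real CARD('p) + 1"
  shows "haar_weight a (mat 1) S * (inv_density V * indicator kernel_set (S ** V))
    \<le> 2 powr (a / 2) * (indicator {V. posdef V} V * (det V powr ((a - K) / 2) * exp (- (1 / (2 * K)) * trace V)))
        * (inv_density S * indicator kernel_set (V ** S))"
proof (cases "posdef S \<and> posdef V \<and> S ** V \<in> kernel_set")
  case False
  then show ?thesis
    by (auto simp: haar_weight_def inv_density_def indicator_def intro!: mult_nonneg_nonneg)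
next
  case True
  then have S: "posdef S" and V: "posdef V" and SV: "trace (S ** V) \<le> K" "1 / 2 \<le> det S * det V"
    by (auto simp: kernel_set_def K_def det_mul)
  have dS: "det S > 0" and dV: "det V > 0" using S V by (auto dest: posdef_det_pos)
  have VS: "V ** S \<in> kernel_set" using SV by (simp add: kernel_set_def K_def det_mul trace_mul_sym[of V] mult.commute)
  have K: "K > 0" by (simp add: K_def)
  have "trace V \<le> trace (matrix_inv S) * trace (S ** V)" by (rule trace_le_trace_inv_mult[OF S V])
  also have "\<dots> \<le> trace (matrix_inv S) * K"
    using SV(1) posdef_trace_nonneg[OF posdef_matrix_inv[OF S]] by (intro mult_left_mono)
  finally have tr: "exp (- trace (matrix_inv S) / 2) \<le> exp (- (1 / (2 * K)) * trace V)"
    using K by (simp add: field_simps)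
  have "1 / det S \<le> 2 * det V" using SV(2) dS by (simp add: field_simps)
  then have "(1 / det S) powr (a / 2) \<le> (2 * det V) powr (a / 2)"
    using dS assms(1) by (intro powr_mono2) auto
  then have det: "det S powr (- a / 2) \<le> 2 powr (a / 2) * det V powr (a / 2)"
    using dS dV by (simp add: powr_mult powr_divide powr_minus_divide)
  have splitS: "det S powr (- (a + real CARD('p) + 1) / 2) = det S powr (- a / 2) * det S powr (- K / 2)"
    using dS by (simp add: powr_add[symmetric] K_def add_divide_distrib diff_divide_distrib algebra_simps)
  have splitV: "det V powr ((a - K) / 2) = det V powr (a / 2) * det V powr (- K / 2)"
    using dV by (simp add: powr_add[symmetric] diff_divide_distrib)
  have "(det S powr (- a / 2) * exp (- trace (matrix_inv S) / 2)) * (det S powr (- K / 2) * det V powr (- K / 2))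
    \<le> ((2 powr (a / 2) * det V powr (a / 2)) * exp (- (1 / (2 * K)) * trace V)) * (det S powr (- K / 2) * det V powr (- K / 2))"
    using det tr by (intro mult_right_mono mult_mono) auto
  moreover have "haar_weight a (mat 1) S = det S powr (- a / 2) * det S powr (- K / 2) * exp (- trace (matrix_inv S) / 2)"
    unfolding haar_weight_def splitS by (simp add: S)
  moreover have "inv_density S = det S powr (- K / 2)" "inv_density V = det V powr (- K / 2)"
    unfolding inv_density_def K_def using S V by simp_all
  ultimately show ?thesis
    unfolding splitV using True VS by (simp add: mult_ac)
qed

lemma haar_integral_finite:
  assumes "a \<ge> real CARD('p::{finite,linorder}) + 1"
  shows "haar_integral a (mat 1 :: 'p rmat) < \<infinity>"
proof -
  let ?L = "sym_lborel :: 'p rmat measure"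
  interpret pair_sigma_finite ?L ?L
    by (rule pair_sigma_finite.intro) (rule sigma_finite_sym_lborel)+
  let ?K = "real CARD('p) + 1"
  define h :: "'p rmat \<Rightarrow> real" where
    "h V = indicator {V. posdef V} V * (det V powr ((a - ?K) / 2) * exp (- (1 / (2 * ?K)) * trace V))" for V
  have hnn: "h V \<ge> 0" for V by (simp add: h_def)
  have [measurable]: "h \<in> borel_measurable borel"
  proof -
    have "continuous_on {S :: 'p rmat. posdef S} (\<lambda>V. det V powr ((a - ?K) / 2) * exp (- (1 / (2 * ?K)) * trace V))"
      by (intro continuous_intros) (auto dest: posdef_det_pos)
    from borel_measurable_continuous_on_indicator[OF posdef_borel this] show ?thesis
      by (simp add: h_def[abs_def])
  qed
  have a: "a \<ge> 0" using assms by linarith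
  let ?k = "\<lambda>(S :: 'p rmat) (V :: 'p rmat). indicator kernel_set (S ** V) :: real"
  have km[measurable]: "(\<lambda>(S, V). ?k S V) \<in> borel_measurable (?L \<Otimes>\<^sub>M ?L)" "(\<lambda>(S, V). ?k V S) \<in> borel_measurable (?L \<Otimes>\<^sub>M ?L)"
  proof -
    have eq: "(\<lambda>(S, V). ?k S V) = indicator {(S :: 'p rmat, V). S ** V \<in> kernel_set}"
      by (auto simp: fun_eq_iff indicator_def)
    have "(\<lambda>(S, V). ?k S V) \<in> borel_measurable (borel \<Otimes>\<^sub>M borel)"
      unfolding eq by (rule borel_measurable_indicator) (rule kernel_pair_borel)
    then show 1: "(\<lambda>(S, V). ?k S V) \<in> borel_measurable (?L \<Otimes>\<^sub>M ?L)"
      by (simp cong: measurable_cong_sets sets_pair_measure_cong)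
    show "(\<lambda>(S, V). ?k V S) \<in> borel_measurable (?L \<Otimes>\<^sub>M ?L)"
      using measurable_pair_swap[OF 1] by (simp add: case_prod_beta)
  qed
  note km' = km[unfolded case_prod_beta, measurable]
  have hw[measurable]: "haar_weight a (mat 1 :: 'p rmat) \<in> borel_measurable ?L" "(inv_density :: 'p rmat \<Rightarrow> real) \<in> borel_measurable ?L"
    "h \<in> borel_measurable ?L" by simp_all
  have "haar_integral a (mat 1 :: 'p rmat) * kernel_mass TYPE('p)
    = (\<integral>\<^sup>+S. ennreal (haar_weight a (mat 1) S) * kernel_mass TYPE('p) \<partial>?L)"
    unfolding haar_integral_def by (rule nn_integral_multc[symmetric]) simp
  also have "\<dots> = (\<integral>\<^sup>+S. (\<integral>\<^sup>+V. ennreal (haar_weight a (mat 1) S * (inv_density V * ?k S V)) \<partial>?L) \<partial>?L)"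
  proof (rule nn_integral_cong)
    fix S :: "'p rmat"
    have [measurable]: "(\<lambda>V. S ** V) \<in> borel \<rightarrow>\<^sub>M borel"
      by (intro borel_measurable_continuous_onI continuous_intros)
    have "(\<integral>\<^sup>+V. ennreal (haar_weight a (mat 1) S * (inv_density V * ?k S V)) \<partial>?L)
      = ennreal (haar_weight a (mat 1) S) * (\<integral>\<^sup>+V. ennreal (inv_density V * ?k S V) \<partial>?L)"
      by (subst nn_integral_cmult[symmetric])
         (auto simp: ennreal_mult haar_weight_nonneg inv_density_nonneg)
    then show "ennreal (haar_weight a (mat 1) S) * kernel_mass TYPE('p)
      = (\<integral>\<^sup>+V. ennreal (haar_weight a (mat 1) S * (inv_density V * ?k S V)) \<partial>?L)"
      \<comment> \<open>Off the positive definite cone the weight is 0 and both sides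
        vanish.\<close>
      using kernel_integral[of S] by (cases "posdef S") (auto simp: haar_weight_def)
  qed
  also have "\<dots> \<le> (\<integral>\<^sup>+S. (\<integral>\<^sup>+V. ennreal (2 powr (a / 2) * h V * (inv_density S * ?k V S)) \<partial>?L) \<partial>?L)"
    unfolding h_def by (intro nn_integral_mono ennreal_leI haar_weight_kernel_le[OF a])
  also have "\<dots> = (\<integral>\<^sup>+V. (\<integral>\<^sup>+S. ennreal (2 powr (a / 2) * h V * (inv_density S * ?k V S)) \<partial>?L) \<partial>?L)"
    by (rule Fubini'[symmetric]) (unfold case_prod_beta, measurable)
  also have "\<dots> = (\<integral>\<^sup>+V. ennreal (2 powr (a / 2)) * ennreal (h V) * kernel_mass TYPE('p) \<partial>?L)"
  proof (rule nn_integral_cong)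
    fix V :: "'p rmat"
    have [measurable]: "(\<lambda>S. V ** S) \<in> borel \<rightarrow>\<^sub>M borel"
      by (intro borel_measurable_continuous_onI continuous_intros)
    have "(\<integral>\<^sup>+S. ennreal (2 powr (a / 2) * h V * (inv_density S * ?k V S)) \<partial>?L)
      = ennreal (2 powr (a / 2) * h V) * (\<integral>\<^sup>+S. ennreal (inv_density S * ?k V S) \<partial>?L)"
      by (subst nn_integral_cmult[symmetric])
         (auto simp: ennreal_mult hnn inv_density_nonneg)
    then show "(\<integral>\<^sup>+S. ennreal (2 powr (a / 2) * h V * (inv_density S * ?k V S)) \<partial>?L)
      = ennreal (2 powr (a / 2)) * ennreal (h V) * kernel_mass TYPE('p)"
      using kernel_integral[of V] by (cases "posdef V") (auto simp: h_def ennreal_mult)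
  qed
  also have "\<dots> = ennreal (2 powr (a / 2)) * (\<integral>\<^sup>+V. ennreal (h V) \<partial>?L) * kernel_mass TYPE('p)"
    by (simp add: nn_integral_multc nn_integral_cmult)
  finally have le: "haar_integral a (mat 1 :: 'p rmat) * kernel_mass TYPE('p)
    \<le> ennreal (2 powr (a / 2)) * (\<integral>\<^sup>+V. ennreal (h V) \<partial>?L) * kernel_mass TYPE('p)" .
  have "(\<integral>\<^sup>+V. ennreal (h V) \<partial>?L) < \<infinity>"
    \<comment> \<open>The bound on a makes the exponent (a - p - 1)/2 nonnegative, as
      \<open>gamma_integral_finite\<close> demands.\<close>
    unfolding h_def using assms by (intro gamma_integral_finite) auto
  then have "haar_integral a (mat 1 :: 'p rmat) * kernel_mass TYPE('p) < \<infinity>"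
    using le kernel_mass_finite[where 'p = 'p] by (intro order.strict_trans1[OF le]) (simp add: ennreal_mult_less_top)
  then show ?thesis using kernel_mass_pos[where 'p = 'p] by (auto simp: ennreal_mult_less_top)
qed

subsection \<open>Sufficiency and the sampling distribution\<close>

lemma trace_mult_outer:
  "trace (M ** (\<chi> i j. d $ i * d $ j)) = d \<bullet> (M *v (d :: real^'n))"
  by (simp add: trace_def matrix_matrix_mult_def inner_vec_def matrix_vector_mult_def sum_distrib_left mult_ac)

lemma trace_mult_add_scaled_outer:
  "trace (M ** (S + c *\<^sub>R (\<chi> i j. d $ i * d $ j))) = trace (M ** S) + c * (d \<bullet> (M *v (d :: real^'n)))"
  by (simp add: matrix_add_ldistrib trace_add trace_mult_outer[symmetric] matrix_scalar_ac scalar_matrix_assoc)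
     (simp add: trace_def matrix_matrix_mult_def sum_distrib_left mult_ac)

lemma scatter_quadratic:
  "x \<bullet> (scatter n xs *v x) = (\<Sum>i=1..n. (x \<bullet> (xs i - sample_mean n xs))\<^sup>2)"
proof -
  let ?y = "\<lambda>i. xs i - sample_mean n xs"
  have "(scatter n xs *v x) $ j = (\<Sum>i=1..n. ?y i $ j * (x \<bullet> ?y i))" for j
    unfolding matrix_vector_mult_def scatter_def inner_vec_def
    by (simp add: sum_distrib_left sum_distrib_right) (subst sum.swap, simp add: mult_ac)
  then have "x \<bullet> (scatter n xs *v x) = (\<Sum>j\<in>UNIV. \<Sum>i=1..n. x $ j * (?y i $ j * (x \<bullet> ?y i)))"
    by (simp add: inner_vec_def[of x "_ *v _"] sum_distrib_left)
  also have "\<dots> = (\<Sum>i=1..n. (\<Sum>j\<in>UNIV. x $ j * ?y i $ j) * (x \<bullet> ?y i))"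
    by (subst sum.swap) (simp add: sum_distrib_left sum_distrib_right mult_ac)
  finally show ?thesis by (simp add: inner_vec_def power2_eq_square)
qed

lemma psd_scatter: "psd (scatter n xs)"
proof -
  have "transpose (scatter n xs) = scatter n xs"
    by (simp add: scatter_def transpose_def vec_eq_iff mult.commute)
  then show ?thesis by (simp add: psd_def scatter_quadratic sum_nonneg)
qed

lemma trace_mult_scatter:
  "trace (M ** scatter n xs) = (\<Sum>i=1..n. (xs i - sample_mean n xs) \<bullet> (M *v (xs i - sample_mean n xs)))"
proof -
  have "scatter n xs = (\<Sum>i=1..n. (\<chi> j k. (xs i - sample_mean n xs) $ j * (xs i - sample_mean n xs) $ k))"
    by (simp add: scatter_def vec_eq_iff)
  moreover have "trace (M ** (\<Sum>i\<in>I. B i)) = (\<Sum>i\<in>I. trace (M ** B i))" if "finite I" for I and B :: "nat \<Rightarrow> 'a rmat"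
    using that by (induction I rule: finite_induct)
      (simp_all add: matrix_add_ldistrib trace_add, simp add: trace_def matrix_matrix_mult_def)
  ultimately show ?thesis by (simp only: finite_atLeastAtMost trace_mult_outer)
qed

text \<open>Deviations from the sample mean sum to zero, which removes both cross terms. Taken with
  M = I and M = \<Sigma>^{-1}, it shows that mean and scatter matrix are sufficient.\<close>

lemma sum_quadratic_split:
  assumes "n > 0"
  shows "(\<Sum>i=1..n. (xs i - t) \<bullet> (M *v (xs i - t)))
    = trace (M ** scatter n xs) + real n * ((sample_mean n xs - t) \<bullet> (M *v (sample_mean n xs - t)))"
proof -
  let ?m = "sample_mean n xs"
  let ?y = "\<lambda>i. xs i - ?m"
  have m: "real n *\<^sub>R ?m = (\<Sum>i=1..n. xs i)" using assms by (simp add: sample_mean_def)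
  have y0: "(\<Sum>i=1..n. ?y i) = 0"
    by (simp add: sum_subtractf sum_constant_scaleR m del: sum_constant)
  have "(xs i - t) \<bullet> (M *v (xs i - t))
    = ?y i \<bullet> (M *v ?y i) + ?y i \<bullet> (M *v (?m - t)) + ((transpose M *v (?m - t)) \<bullet> ?y i + (?m - t) \<bullet> (M *v (?m - t)))" for i
  proof -
    have "xs i - t = ?y i + (?m - t)" by simp
    then show ?thesis
      using dot_matrix_transpose[of "?m - t" M "?y i"]
      by (simp only: matrix_vector_right_distrib inner_add_left inner_add_right)
  qed
  then have "(\<Sum>i=1..n. (xs i - t) \<bullet> (M *v (xs i - t)))
    = (\<Sum>i=1..n. ?y i \<bullet> (M *v ?y i)) + (\<Sum>i=1..n. ?y i) \<bullet> (M *v (?m - t))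
      + ((transpose M *v (?m - t)) \<bullet> (\<Sum>i=1..n. ?y i) + (\<Sum>i=1..n. (?m - t) \<bullet> (M *v (?m - t))))"
    by (simp only: sum.distrib inner_sum_left inner_sum_right)
  then show ?thesis unfolding y0 trace_mult_scatter by simp
qed

text \<open>
  The likelihood ratio of \<open>(\<theta>,\<Sigma>)\<close> against \<open>(0,I)\<close>, as a function of mean and scatter matrix. By
  sufficiency it relates the densities \<open>f\<close> at the two parameters, so that the explicit Wishart
  density is not needed.
\<close>

definition lik_ratio :: "nat \<Rightarrow> ('p::finite) rvec \<Rightarrow> 'p rmat \<Rightarrow> 'p rvec \<Rightarrow> 'p rmat \<Rightarrow> real" where
  "lik_ratio n \<theta> \<Sigma> x S = det \<Sigma> powr (- real n / 2)
     * exp (- (trace (matrix_inv \<Sigma> ** S) + real n * ((x - \<theta>) \<bullet> (matrix_inv \<Sigma> *v (x - \<theta>)))) / 2)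
     * exp ((trace S + real n * (x \<bullet> x)) / 2)"

definition mvn_ratio :: "('p::finite) rvec \<Rightarrow> 'p rmat \<Rightarrow> 'p rvec \<Rightarrow> real" where
  "mvn_ratio \<theta> \<Sigma> x = det \<Sigma> powr (- 1 / 2) * exp (- ((x - \<theta>) \<bullet> (matrix_inv \<Sigma> *v (x - \<theta>))) / 2) * exp ((x \<bullet> x) / 2)"

lemma matrix_inv_mat_1: "matrix_inv (mat 1 :: real^'n^'n) = mat 1"
  by (rule matrix_inv_eqI) simp

lemma mvn_density_ratio:
  assumes "posdef \<Sigma>"
  shows "mvn_density \<theta> \<Sigma> x = mvn_density 0 (mat 1) x * mvn_ratio \<theta> \<Sigma> x"
proof -
  have d: "det \<Sigma> > 0" by (rule posdef_det_pos[OF assms])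
  have "exp (- (x \<bullet> x) / 2) * exp ((x \<bullet> x) / 2) = 1" by (simp add: exp_add[symmetric])
  then show ?thesis
    using d by (simp add: mvn_density_def mvn_ratio_def matrix_inv_mat_1 real_sqrt_mult powr_minus_divide powr_half_sqrt)
qed

lemma mvn_density_nonneg: "posdef \<Sigma> \<Longrightarrow> mvn_density \<theta> \<Sigma> x \<ge> 0"
  using posdef_det_pos[of \<Sigma>] by (auto simp: mvn_density_def intro!: divide_nonneg_nonneg mult_nonneg_nonneg)

lemma mvn_ratio_nonneg: "mvn_ratio \<theta> \<Sigma> x \<ge> 0"
  by (simp add: mvn_ratio_def)

lemma borel_measurable_mvn [measurable]:
  "mvn_density \<theta> (\<Sigma> :: 'p::finite rmat) \<in> borel_measurable borel" "mvn_ratio \<theta> \<Sigma> \<in> borel_measurable borel"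
  unfolding mvn_density_def[abs_def] mvn_ratio_def[abs_def] divide_inverse
  by (intro borel_measurable_continuous_onI continuous_intros)+

lemma prod_mvn_ratio:
  assumes "n > 0"
  shows "(\<Prod>i=1..n. mvn_ratio \<theta> \<Sigma> (xs i)) = lik_ratio n \<theta> \<Sigma> (sample_mean n xs) (scatter n xs)"
proof -
  have "(\<Sum>i=1..n. xs i \<bullet> xs i) = trace (scatter n xs) + real n * (sample_mean n xs \<bullet> sample_mean n xs)"
    using sum_quadratic_split[OF assms, of xs 0 "mat 1"] by simp
  moreover have "(det \<Sigma> powr (- 1 / 2)) ^ n = det \<Sigma> powr (- real n / 2)"
    by (cases "det \<Sigma> = 0") (use assms in \<open>simp_all add: powr_realpow[symmetric] powr_powr\<close>)
  ultimately show ?thesis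
    using sum_quadratic_split[OF assms, of xs \<theta> "matrix_inv \<Sigma>"]
    by (simp add: mvn_ratio_def lik_ratio_def prod.distrib exp_sum[symmetric] sum_negf sum_divide_distrib[symmetric])
       (auto simp: field_simps)
qed

section \<open>Change of parameter in the law of the sample\<close>

lemma PiM_density:
  assumes "finite I" and [measurable]: "r \<in> borel_measurable N"
    and "sigma_finite_measure N" "sigma_finite_measure (density N r)"
  shows "PiM I (\<lambda>_. density N r) = density (PiM I (\<lambda>_. N)) (\<lambda>x. \<Prod>i\<in>I. r (x i))"
proof -
  interpret N: product_sigma_finite "\<lambda>_ :: 'a. N" by (rule product_sigma_finite.intro) (rule assms(3))
  interpret D: product_sigma_finite "\<lambda>_ :: 'a. density N r" by (rule product_sigma_finite.intro) (rule assms(4))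
  have m[measurable]: "(\<lambda>x. \<Prod>i\<in>I. r (x i)) \<in> borel_measurable (PiM I (\<lambda>_. N))" by measurable
  have "density (PiM I (\<lambda>_. N)) (\<lambda>x. \<Prod>i\<in>I. r (x i)) = PiM I (\<lambda>_. density N r)"
  proof (rule D.PiM_eqI[OF assms(1)])
    show "sets (density (PiM I (\<lambda>_. N)) (\<lambda>x. \<Prod>i\<in>I. r (x i))) = sets (PiM I (\<lambda>_. density N r))"
      by (simp cong: sets_PiM_cong)
    fix A assume A: "\<And>i. i \<in> I \<Longrightarrow> A i \<in> sets (density N r)"
    then have A': "Pi\<^sub>E I A \<in> sets (PiM I (\<lambda>_. N))" using assms(1) by (intro sets_PiM_I_finite) auto
    have "emeasure (density (PiM I (\<lambda>_. N)) (\<lambda>x. \<Prod>i\<in>I. r (x i))) (Pi\<^sub>E I A)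
      = (\<integral>\<^sup>+x. (\<Prod>i\<in>I. r (x i)) * indicator (Pi\<^sub>E I A) x \<partial>PiM I (\<lambda>_. N))"
      by (rule emeasure_density[OF m A'])
    also have "\<dots> = (\<integral>\<^sup>+x. (\<Prod>i\<in>I. r (x i) * indicator (A i) (x i)) \<partial>PiM I (\<lambda>_. N))"
    proof (rule nn_integral_cong)
      fix x assume "x \<in> space (PiM I (\<lambda>_. N))"
      then have "(indicator (Pi\<^sub>E I A) x :: ennreal) = (\<Prod>i\<in>I. indicator (A i) (x i))"
        using assms(1) by (auto simp: space_PiM PiE_def indicator_def Pi_iff prod_zero_iff)
      then show "(\<Prod>i\<in>I. r (x i)) * indicator (Pi\<^sub>E I A) x = (\<Prod>i\<in>I. r (x i) * indicator (A i) (x i))"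
        by (simp add: prod.distrib)
    qed
    also have "\<dots> = (\<Prod>i\<in>I. \<integral>\<^sup>+x. r x * indicator (A i) x \<partial>N)"
      using A by (intro N.product_nn_integral_prod assms(1)) auto
    also have "\<dots> = (\<Prod>i\<in>I. emeasure (density N r) (A i))"
      using A by (intro prod.cong) (auto simp: emeasure_density)
    finally show "emeasure (density (PiM I (\<lambda>_. N)) (\<lambda>x. \<Prod>i\<in>I. r (x i))) (Pi\<^sub>E I A)
      = (\<Prod>i\<in>I. emeasure (density N r) (A i))" .
  qed
  then show ?thesis ..
qed

abbreviation sample_law :: "nat \<Rightarrow> ('p::finite) rvec \<Rightarrow> 'p rmat \<Rightarrow> (nat \<Rightarrow> 'p rvec) measure" where
  "sample_law n \<theta> \<Sigma> \<equiv> PiM {1..n} (\<lambda>_. density lborel (\<lambda>x. ennreal (mvn_density \<theta> \<Sigma> x)))"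

lemma sigma_finite_mvn: "sigma_finite_measure (density lborel (\<lambda>x. ennreal (mvn_density \<theta> (\<Sigma> :: 'p::finite rmat) x)))"
  by (subst sigma_finite_measure.sigma_finite_iff_density_finite[OF sigma_finite_lborel]) auto

text \<open>Sufficiency: the density of one sample law relative to another is a function of mean and
  scatter matrix, so it can be pushed forward to their joint law.\<close>

lemma sample_law_density:
  fixes \<Sigma> :: "'p::finite rmat"
  assumes "posdef \<Sigma>" "n > 0"
  shows "sample_law n \<theta> \<Sigma> = density (sample_law n 0 (mat 1))
     (\<lambda>xs. ennreal (lik_ratio n \<theta> \<Sigma> (sample_mean n xs) (scatter n xs)))"
proof -
  let ?N = "density lborel (\<lambda>x. ennreal (mvn_density 0 (mat 1 :: 'p rmat) x))"
  have eq: "density lborel (\<lambda>x. ennreal (mvn_density \<theta> \<Sigma> x)) = density ?N (\<lambda>x. ennreal (mvn_ratio \<theta> \<Sigma> x))"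
    by (subst density_density_eq)
       (auto simp: mvn_density_ratio[OF assms(1), of \<theta>] ennreal_mult mvn_density_nonneg posdef_mat_1 mvn_ratio_nonneg)
  have "sample_law n \<theta> \<Sigma> = density (sample_law n 0 (mat 1)) (\<lambda>xs. \<Prod>i\<in>{1..n}. ennreal (mvn_ratio \<theta> \<Sigma> (xs i)))"
    unfolding eq
  proof (rule PiM_density)
    show "sigma_finite_measure (density ?N (\<lambda>x. ennreal (mvn_ratio \<theta> \<Sigma> x)))"
      unfolding eq[symmetric] by (rule sigma_finite_mvn)
  qed (auto intro: sigma_finite_mvn)
  also have "(\<lambda>xs. \<Prod>i\<in>{1..n}. ennreal (mvn_ratio \<theta> \<Sigma> (xs i)))
    = (\<lambda>xs. ennreal (lik_ratio n \<theta> \<Sigma> (sample_mean n xs) (scatter n xs)))"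
    by (simp add: prod_ennreal mvn_ratio_nonneg flip: prod_mvn_ratio[OF assms(2)])
  finally show ?thesis .
qed

lemma continuous_on_lik_ratio:
  "continuous_on A (\<lambda>(x, S). lik_ratio n \<theta> \<Sigma> x S)"
  unfolding lik_ratio_def case_prod_beta by (intro continuous_intros) auto

interpretation lborel_sym: pair_sigma_finite lborel sym_lborel
  by (rule pair_sigma_finite.intro) (rule lborel.sigma_finite_measure_axioms sigma_finite_sym_lborel)+

lemma not_AE_lborel_ball:
  fixes x :: "'a::euclidean_space"
  assumes "e > 0"
  shows "\<not> (AE y in lborel. y \<notin> ball x e)"
proof
  assume "AE y in lborel. y \<notin> ball x e"
  then have "emeasure lborel (ball x e) = 0"
    by (subst (asm) AE_iff_measurable[where N = "ball x e"]) auto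
  then show False using assms unit_ball_vol_pos[of "real DIM('a)"] by (simp add: emeasure_ball)
qed

text \<open>If the functions differed at (x, S), continuity would keep them apart over a ball around
  x and all symmetric matrices near S, so every slice over that ball would violate almost-everywhere
  equality.\<close>

lemma AE_eq_imp_eq_posdef:
  fixes g h :: "'p::{finite,linorder} rvec \<Rightarrow> 'p rmat \<Rightarrow> real"
  assumes g: "continuous_on (UNIV \<times> {S. posdef S}) (\<lambda>(x, S). g x S)"
    and h: "continuous_on (UNIV \<times> {S. posdef S}) (\<lambda>(x, S). h x S)"
    and ae: "AE z in lborel \<Otimes>\<^sub>M sym_lborel. g (fst z) (snd z) = h (fst z) (snd z)"
    and S: "posdef S"
  shows "g x S = h x S"
proof (rule ccontr)
  assume ne: "g x S \<noteq> h x S"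
  define D where "D z = (case z of (x, S) \<Rightarrow> g x S) - (case z of (x, S) \<Rightarrow> h x S)" for z
  have "continuous_on (UNIV \<times> {S. posdef S}) D"
    unfolding D_def by (intro continuous_on_diff g h)
  moreover have "D (x, S) \<noteq> 0" using ne by (simp add: D_def)
  ultimately obtain d where d: "d > 0" "\<And>z. z \<in> UNIV \<times> {S. posdef S} \<Longrightarrow> dist z (x, S) < d \<Longrightarrow> dist (D z) (D (x, S)) < \<bar>D (x, S)\<bar>"
    using S unfolding continuous_on_iff by (metis SigmaI UNIV_I mem_Collect_eq zero_less_abs_iff)
  obtain e where e: "e > 0" "\<And>S'. transpose S' = S' \<Longrightarrow> dist S' S < e \<Longrightarrow> posdef S'"
    using posdef_open_in_symmetric[OF S] by blast
  have "AE y in lborel. AE S' in sym_lborel. g y S' = h y S'"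
    using lborel_sym.AE_pair[OF ae] by simp
  then have "AE y in lborel. y \<notin> ball x (d / 2)"
  proof eventually_elim
    fix y assume ae: "AE S' in sym_lborel. g y S' = h y S'"
    have "\<not> (AE S' in sym_lborel. g y S' = h y S')" if y: "y \<in> ball x (d / 2)"
    \<comment> \<open>Radius d/2 in each factor keeps the pair within d in the product metric, and e
      keeps S' positive definite.\<close>
    proof (rule not_AE_near_symmetric[where e = "min e (d / 2)"])
      show "transpose S = S" by (rule posdef_sym[OF S])
      show "min e (d / 2) > 0" using e d by simp
      fix S' assume S': "transpose S' = S'" "dist S' S < min e (d / 2)"
      have "dist (y, S') (x, S) \<le> dist y x + dist S' S"
        unfolding dist_prod_def fst_conv snd_conv by (rule sqrt_sum_squares_le_sum) auto
      also have "\<dots> < d" using y S' by (simp add: dist_commute)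
      finally have "dist (D (y, S')) (D (x, S)) < \<bar>D (x, S)\<bar>"
        using e(2) S' by (intro d(2)) auto
      then have "D (y, S') \<noteq> 0" by (auto simp: dist_real_def)
      then show "\<not> g y S' = h y S'" by (simp add: D_def)
    qed
    then show "y \<notin> ball x (d / 2)" using ae by blast
  qed
  then show False using not_AE_lborel_ball[of "d / 2" x] d(1) by simp
qed

text \<open>Uniqueness of densities gives the identity almost everywhere for fixed \<theta> and
  \<Sigma>. Continuity extends it to every positive definite S, so that \<Sigma> can be integrated
  and \<theta> maximised at one fixed (x, S).\<close>

lemma joint_density_factor:
  fixes f :: "'p::{finite,linorder} rvec \<Rightarrow> 'p rmat \<Rightarrow> 'p rvec \<Rightarrow> 'p rmat \<Rightarrow> real"
  assumes f: "joint_density n f" and "n > 0" and \<Sigma>: "posdef \<Sigma>" and S: "posdef S"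
  shows "f x S \<theta> \<Sigma> = f x S 0 (mat 1) * lik_ratio n \<theta> \<Sigma> x S"
proof -
  let ?L = "lborel \<Otimes>\<^sub>M sym_lborel :: ('p rvec \<times> 'p rmat) measure"
  let ?T = "\<lambda>xs :: nat \<Rightarrow> 'p rvec. (sample_mean n xs, scatter n xs)"
  have fD: "\<And>x S. f x S t C \<ge> 0" "continuous_on (UNIV \<times> {S. posdef S}) (\<lambda>(x, S). f x S t C)"
    "distributed (sample_law n t C) ?L ?T (\<lambda>(x, S). ennreal (f x S t C))"
    if "posdef C" for t C
    using f that unfolding joint_density_def by blast+
  let ?r = "\<lambda>z. lik_ratio n \<theta> \<Sigma> (fst z) (snd z)"
  have rnn: "?r z \<ge> 0" for z by (simp add: lik_ratio_def)
  have r: "(\<lambda>z. ennreal (?r z)) \<in> borel_measurable ?L"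
  proof -
    have "?r \<in> borel_measurable borel"
      using continuous_on_lik_ratio[of UNIV n \<theta> \<Sigma>] by (intro borel_measurable_continuous_onI) (simp add: case_prod_beta)
    then have "?r \<in> borel_measurable (borel \<Otimes>\<^sub>M borel)" by (simp only: borel_prod)
    then show ?thesis by (simp cong: measurable_cong_sets sets_pair_measure_cong)
  qed
  note d0 = fD(3)[OF posdef_mat_1, of 0] and d1 = fD(3)[OF \<Sigma>, of \<theta>]
  have f0: "(\<lambda>(x, S). ennreal (f x S 0 (mat 1))) \<in> borel_measurable ?L"
    and f1: "(\<lambda>(x, S). ennreal (f x S \<theta> \<Sigma>)) \<in> borel_measurable ?L"
    using distributed_borel_measurable[OF d0] distributed_borel_measurable[OF d1] .
  have "density ?L (\<lambda>(x, S). ennreal (f x S \<theta> \<Sigma>)) = distr (sample_law n \<theta> \<Sigma>) ?L ?T"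
    by (rule distributed_distr_eq_density[OF d1, symmetric])
  also have "\<dots> = distr (density (sample_law n 0 (mat 1)) (\<lambda>xs. ennreal (?r (?T xs)))) ?L ?T"
    by (simp only: sample_law_density[OF \<Sigma> assms(2), of \<theta>] fst_conv snd_conv)
  also have "\<dots> = density (distr (sample_law n 0 (mat 1)) ?L ?T) (\<lambda>z. ennreal (?r z))"
    by (rule density_distr[OF r distributed_measurable[OF d0], symmetric])
  also have "\<dots> = density (density ?L (\<lambda>(x, S). ennreal (f x S 0 (mat 1)))) (\<lambda>z. ennreal (?r z))"
    by (simp only: distributed_distr_eq_density[OF d0])
  also have "\<dots> = density ?L (\<lambda>z. (case z of (x, S) \<Rightarrow> ennreal (f x S 0 (mat 1))) * ennreal (?r z))"
    by (rule density_density_eq[OF f0 r])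
  finally have "AE z in ?L. (case z of (x, S) \<Rightarrow> ennreal (f x S \<theta> \<Sigma>))
      = (case z of (x, S) \<Rightarrow> ennreal (f x S 0 (mat 1))) * ennreal (?r z)"
    by (rule lborel_sym.P.density_unique[OF f1 borel_measurable_times_ennreal[OF f0 r]])
  then have "AE z in ?L. f (fst z) (snd z) \<theta> \<Sigma> = f (fst z) (snd z) 0 (mat 1) * lik_ratio n \<theta> \<Sigma> (fst z) (snd z)"
  proof eventually_elim
    fix z assume "(case z of (x, S) \<Rightarrow> ennreal (f x S \<theta> \<Sigma>))
      = (case z of (x, S) \<Rightarrow> ennreal (f x S 0 (mat 1))) * ennreal (?r z)"
    then have "ennreal (f (fst z) (snd z) \<theta> \<Sigma>) = ennreal (f (fst z) (snd z) 0 (mat 1) * ?r z)"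
      using fD(1)[OF posdef_mat_1] rnn by (simp add: case_prod_beta ennreal_mult)
    then show "f (fst z) (snd z) \<theta> \<Sigma> = f (fst z) (snd z) 0 (mat 1) * lik_ratio n \<theta> \<Sigma> (fst z) (snd z)"
      using fD(1)[OF posdef_mat_1] fD(1)[OF \<Sigma>] rnn by (subst (asm) ennreal_inj) auto
  qed
  moreover have "continuous_on (UNIV \<times> {S. posdef S}) (\<lambda>(x, S). f x S 0 (mat 1) * lik_ratio n \<theta> \<Sigma> x S)"
    using continuous_on_mult[OF fD(2)[OF posdef_mat_1, of 0] continuous_on_lik_ratio[of _ n \<theta> \<Sigma>]]
    by (simp add: case_prod_beta)
  ultimately show ?thesis
    using fD(2)[OF \<Sigma>, of \<theta>] S by (intro AE_eq_imp_eq_posdef[where g = "\<lambda>x S. f x S \<theta> \<Sigma>"]) auto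
qed

text \<open>All dependence on \<theta> sits in the last factor, so the others cancel in the
  likelihood ratio as soon as they are known to be nonzero.\<close>

lemma integrated_lik_eq:
  fixes f :: "'p::{finite,linorder} rvec \<Rightarrow> 'p rmat \<Rightarrow> 'p rvec \<Rightarrow> 'p rmat \<Rightarrow> real"
  assumes f: "joint_density n f" and n: "n > CARD('p)" and S: "posdef S"
  shows "integrated_lik f \<theta> x S = f x S 0 (mat 1) * exp ((trace S + real n * (x \<bullet> x)) / 2)
    * enn2real (haar_integral (real n) (mat 1 :: 'p rmat)) * det S powr (- real n / 2)
    * (1 + real n * ((x - \<theta>) \<bullet> (matrix_inv S *v (x - \<theta>)))) powr (- real n / 2)"
proof -
  have n0: "n > 0" using n by simp
  define A where "A = S + real n *\<^sub>R (\<chi> i j. (x - \<theta>) $ i * (x - \<theta>) $ j)"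
  define c where "c = f x S 0 (mat 1) * exp ((trace S + real n * (x \<bullet> x)) / 2)"
  have A: "posdef A" "det A = det S * (1 + real n * ((x - \<theta>) \<bullet> (matrix_inv S *v (x - \<theta>))))"
    unfolding A_def using det_add_rank_one[OF S, of "real n" "x - \<theta>"] by simp_all
  have eq: "indicator {\<Sigma>. posdef \<Sigma>} \<Sigma> *\<^sub>R (f x S \<theta> \<Sigma> * det \<Sigma> powr (- (real CARD('p) + 1) / 2))
    = c * haar_weight (real n) A \<Sigma>" for \<Sigma>
  proof (cases "posdef \<Sigma>")
    case True
    have "trace (matrix_inv \<Sigma> ** A) = trace (matrix_inv \<Sigma> ** S) + real n * ((x - \<theta>) \<bullet> (matrix_inv \<Sigma> *v (x - \<theta>)))"
      unfolding A_def by (rule trace_mult_add_scaled_outer)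
    moreover have "det \<Sigma> powr (- (real n + real CARD('p) + 1) / 2)
      = det \<Sigma> powr (- real n / 2) * det \<Sigma> powr (- (real CARD('p) + 1) / 2)"
      using posdef_det_pos[OF True] by (simp add: powr_add[symmetric] add_divide_distrib diff_divide_distrib algebra_simps)
    ultimately show ?thesis
      using True by (simp only: haar_weight_def c_def joint_density_factor[OF f n0 True S, of x \<theta>] lik_ratio_def)
        (simp add: mult_ac)
  qed (simp add: haar_weight_def)
  have "integrated_lik f \<theta> x S = (\<integral>\<Sigma>. c * haar_weight (real n) A \<Sigma> \<partial>sym_lborel)"
    unfolding integrated_lik_def set_lebesgue_integral_def eq ..
  also have "\<dots> = c * (\<integral>\<Sigma>. haar_weight (real n) A \<Sigma> \<partial>sym_lborel)"
    by simp
  also have "(\<integral>\<Sigma>. haar_weight (real n) A \<Sigma> \<partial>sym_lborel) = enn2real (haar_integral (real n) A)"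
    unfolding haar_integral_def by (rule integral_eq_nn_integral) (auto simp: haar_weight_nonneg)
  also have "\<dots> = det A powr (- real n / 2) * enn2real (haar_integral (real n) (mat 1 :: 'p rmat))"
    unfolding haar_integral_eq[OF A(1)] by (simp add: enn2real_mult)
  also have "det A powr (- real n / 2) = det S powr (- real n / 2)
    * (1 + real n * ((x - \<theta>) \<bullet> (matrix_inv S *v (x - \<theta>)))) powr (- real n / 2)"
    unfolding A(2) using posdef_det_pos[OF S] posdef_nonneg[OF posdef_matrix_inv[OF S]]
    by (intro powr_mult)
  finally show ?thesis by (simp add: c_def mult_ac)
qed

lemma integrated_LRT_eq:
  fixes f :: "'p::{finite,linorder} rvec \<Rightarrow> 'p rmat \<Rightarrow> 'p rvec \<Rightarrow> 'p rmat \<Rightarrow> real"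
  assumes f: "joint_density n f" and n: "n > CARD('p)" and S: "posdef S" and pos: "f x S 0 (mat 1) > 0"
  shows "integrated_LRT K f x S = (1 + LRT K n x S) powr (real n / 2)"
proof -
  let ?q = "\<lambda>\<theta>. 1 + real n * ((x - \<theta>) \<bullet> (matrix_inv S *v (x - \<theta>)))"
  have q: "?q \<theta> > 0" for \<theta>
    using posdef_nonneg[OF posdef_matrix_inv[OF S]] by (intro add_pos_nonneg) auto
  have "haar_integral (real n) (mat 1 :: 'p rmat) < \<infinity>"
    using n by (intro haar_integral_finite) simp
  \<comment> \<open>Both bounds on the Haar integral matter, because \<open>enn2real\<close> is 0 at
    0 and at infinity.\<close>
  then have J: "enn2real (haar_integral (real n) (mat 1 :: 'p rmat)) > 0"
    using haar_integral_pos[of "real n", where 'p = 'p] by (simp add: enn2real_positive_iff)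
  have "integrated_lik f \<theta> x S / integrated_lik f 0 x S
    = (?q \<theta> / (1 + real n * (x \<bullet> (matrix_inv S *v x)))) powr (- real n / 2)" for \<theta>
    unfolding integrated_lik_eq[OF f n S] using J pos posdef_det_pos[OF S] q[of \<theta>] q[of 0]
    by (simp add: powr_divide)
  then show ?thesis unfolding integrated_LRT_def LRT_sup(1)[OF S, symmetric] by simp
qed

text \<open>The translates \<open>S + t I\<close>, \<open>t > 0\<close>, of a positive semidefinite matrix are positive definite, so each
  line in direction \<open>I\<close> meets the boundary of the cone at most once.\<close>

lemma AE_psd_imp_posdef:
  "AE S in (sym_lborel :: 'p::{finite,linorder} rmat measure). psd S \<longrightarrow> posdef S"
proof -
  let ?L = "sym_lborel :: 'p rmat measure"
  define N where "N = {S :: 'p rmat. psd S} - {S. posdef S}"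
  have N[measurable]: "N \<in> sets borel" unfolding N_def by (rule sets.Diff[OF borel_closed[OF closed_psd] posdef_borel])
  have once: "t = t'" if "S + t *\<^sub>R mat 1 \<in> N" "S + t' *\<^sub>R mat 1 \<in> N" for S t t'
  proof -
    have *: False if "s < s'" "S + s *\<^sub>R mat 1 \<in> N" "S + s' *\<^sub>R mat 1 \<in> N" for s s'
    proof -
      have "x \<bullet> ((S + s' *\<^sub>R mat 1) *v x) > 0" if "x \<noteq> 0" for x
      proof -
        have "x \<bullet> ((S + s' *\<^sub>R mat 1) *v x) = x \<bullet> ((S + s *\<^sub>R mat 1) *v x) + (s' - s) * (x \<bullet> x)"
          by (simp add: matrix_vector_mult_add_rdistrib scaleR_matrix_vector_assoc[symmetric] inner_add_right algebra_simps)
        moreover have "x \<bullet> ((S + s *\<^sub>R mat 1) *v x) \<ge> 0"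
          using \<open>S + s *\<^sub>R mat 1 \<in> N\<close> by (simp add: N_def psd_def)
        moreover have "(s' - s) * (x \<bullet> x) > 0" using \<open>s < s'\<close> that by simp
        ultimately show ?thesis by linarith
      qed
      then have "posdef (S + s' *\<^sub>R mat 1)"
        using \<open>S + s' *\<^sub>R mat 1 \<in> N\<close> by (simp add: posdef_def N_def psd_def)
      then show False using \<open>S + s' *\<^sub>R mat 1 \<in> N\<close> by (simp add: N_def)
    qed
    show ?thesis using *[of t t'] *[of t' t] that by (cases t t' rule: linorder_cases) auto
  qed
  let ?g = "\<lambda>t S. indicator {0..1::real} t * indicator N (S + t *\<^sub>R mat 1) :: ennreal"
  have m: "(\<lambda>(t, S). ?g t S) \<in> borel_measurable (lborel \<Otimes>\<^sub>M ?L)"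
  proof -
    have "(\<lambda>z :: real \<times> 'p rmat. snd z + fst z *\<^sub>R mat 1) \<in> borel \<rightarrow>\<^sub>M borel"
      by (intro borel_measurable_continuous_onI continuous_intros)
    then have "(\<lambda>z :: real \<times> 'p rmat. snd z + fst z *\<^sub>R mat 1) \<in> borel \<Otimes>\<^sub>M borel \<rightarrow>\<^sub>M borel"
      by (simp only: borel_prod)
    then have [measurable]: "(\<lambda>z :: real \<times> 'p rmat. snd z + fst z *\<^sub>R mat 1) \<in> lborel \<Otimes>\<^sub>M ?L \<rightarrow>\<^sub>M borel"
      by (simp cong: measurable_cong_sets sets_pair_measure_cong)
    show ?thesis unfolding case_prod_beta by measurable
  qed
  have shift[measurable]: "(\<lambda>S :: 'p rmat. S + t *\<^sub>R mat 1) \<in> borel \<rightarrow>\<^sub>M borel" for t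
    by (intro borel_measurable_continuous_onI continuous_intros)
  \<comment> \<open>Translation along the identity preserves the measure, so the measure of N is its
    average over shifts t in [0, 1]. Tonelli then integrates along each line first, where at most
    one t counts.\<close>
  have "emeasure ?L N = (\<integral>\<^sup>+t. indicator {0..1::real} t * emeasure ?L N \<partial>lborel)"
    by (subst nn_integral_multc) auto
  also have "\<dots> = (\<integral>\<^sup>+t. (\<integral>\<^sup>+S. ?g t S \<partial>?L) \<partial>lborel)"
  proof (rule nn_integral_cong)
    fix t :: real
    have "(\<integral>\<^sup>+S. ?g t S \<partial>?L) = indicator {0..1} t * (\<integral>\<^sup>+S. indicator N (S + t *\<^sub>R mat 1) \<partial>?L)"
      by (rule nn_integral_cmult) simp
    also have "(\<integral>\<^sup>+S. indicator N (S + t *\<^sub>R mat 1) \<partial>?L) = (\<integral>\<^sup>+S. indicator N S \<partial>?L)"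
      by (rule nn_integral_sym_lborel_add_mat) simp
    finally show "indicator {0..1} t * emeasure ?L N = (\<integral>\<^sup>+S. ?g t S \<partial>?L)" by simp
  qed
  also have "\<dots> = (\<integral>\<^sup>+S. (\<integral>\<^sup>+t. ?g t S \<partial>lborel) \<partial>?L)"
    by (rule lborel_sym.Fubini'[symmetric, OF m])
  also have "\<dots> = (\<integral>\<^sup>+S. 0 \<partial>?L)"
  proof (rule nn_integral_cong)
    fix S :: "'p rmat"
    have "AE t in lborel. S + t *\<^sub>R mat 1 \<notin> N"
    proof (cases "\<exists>s. S + s *\<^sub>R mat 1 \<in> N")
      case True
      then obtain s where s: "S + s *\<^sub>R mat 1 \<in> N" ..
      have "AE t in lborel. t \<noteq> s" by (rule AE_lborel_singleton)
      then show ?thesis by eventually_elim (use once s in blast)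
    qed auto
    then have "AE t in lborel. ?g t S = 0" by eventually_elim simp
    then show "(\<integral>\<^sup>+t. ?g t S \<partial>lborel) = 0" by (subst nn_integral_cong_AE[where v = "\<lambda>_. 0"]) auto
  qed
  finally have "emeasure ?L N = 0" by simp
  then have "AE S in ?L. S \<notin> N" by (intro AE_not_in) (auto simp: null_sets_def)
  then show ?thesis by eventually_elim (auto simp: N_def)
qed

text \<open>A scatter matrix is always positive semidefinite, and its boundary case is null under a
  law with a density. A density is positive almost surely under its own law; the factorisation
  carries this from (\<theta>, \<Sigma>) to (0, I), where \<open>integrated_LRT_eq\<close> needs
  it.\<close>

lemma AE_sample_regular:
  fixes f :: "'p::{finite,linorder} rvec \<Rightarrow> 'p rmat \<Rightarrow> 'p rvec \<Rightarrow> 'p rmat \<Rightarrow> real"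
  assumes f: "joint_density n f" and n: "n > 0" and \<Sigma>: "posdef \<Sigma>" and X: "iid_normal n \<theta> \<Sigma> M X"
  shows "AE \<omega> in M. posdef (scatter n (\<lambda>i. X i \<omega>)) \<and> f (sample_mean n (\<lambda>i. X i \<omega>)) (scatter n (\<lambda>i. X i \<omega>)) 0 (mat 1) > 0"
proof -
  let ?L = "lborel \<Otimes>\<^sub>M sym_lborel :: ('p rvec \<times> 'p rmat) measure"
  let ?T = "\<lambda>xs :: nat \<Rightarrow> 'p rvec. (sample_mean n xs, scatter n xs)"
  let ?f = "\<lambda>(x, S). ennreal (f x S \<theta> \<Sigma>)"
  have d: "distributed (sample_law n \<theta> \<Sigma>) ?L ?T ?f"
    using f \<Sigma> unfolding joint_density_def by blast
  have psd_ae: "AE z in ?L. psd (snd z) \<longrightarrow> posdef (snd z)"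
  proof (rule lborel_sym.AE_pair_measure)
    have "{S :: 'p rmat. psd S \<longrightarrow> posdef S} \<in> sets borel"
    proof -
      have "{S :: 'p rmat. psd S \<longrightarrow> posdef S} = - {S. psd S} \<union> {S. posdef S}" by auto
      then show ?thesis using sets.Un[OF borel_comp[OF borel_closed[OF closed_psd]] posdef_borel] by simp
    qed
    then have "snd -` {S :: 'p rmat. psd S \<longrightarrow> posdef S} \<inter> space ?L \<in> sets ?L"
      by (intro measurable_sets[OF measurable_snd]) simp
    then show "{z \<in> space ?L. psd (snd z) \<longrightarrow> posdef (snd z)} \<in> sets ?L"
      by (simp add: vimage_def Int_def conj_commute)
    show "AE x in lborel. AE S in sym_lborel. psd (snd (x, S)) \<longrightarrow> posdef (snd (x, S))"
      by (rule AE_I2) (use AE_psd_imp_posdef in simp)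
  qed
  have fb: "?f \<in> borel_measurable ?L" by (rule distributed_borel_measurable[OF d])
  have "AE z in density ?L ?f. (psd (snd z) \<longrightarrow> posdef (snd z)) \<and> f (fst z) (snd z) \<theta> \<Sigma> > 0"
    unfolding AE_density[OF fb] using psd_ae
    by eventually_elim (auto simp: case_prod_beta)
  then have "AE z in distr (sample_law n \<theta> \<Sigma>) ?L ?T. (psd (snd z) \<longrightarrow> posdef (snd z)) \<and> f (fst z) (snd z) \<theta> \<Sigma> > 0"
    by (simp only: distributed_distr_eq_density[OF d])
  from AE_distrD[OF distributed_measurable[OF d] this]
  have ae: "AE xs in sample_law n \<theta> \<Sigma>. posdef (scatter n xs) \<and> f (sample_mean n xs) (scatter n xs) \<theta> \<Sigma> > 0"
    by eventually_elim (simp add: psd_scatter)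
  interpret prob_space M using X by (simp add: iid_normal_def)
  have ind: "indep_vars (\<lambda>_. borel) X {1..n}" and dX: "\<And>i. i \<in> {1..n} \<Longrightarrow> distributed M lborel (X i) (\<lambda>x. ennreal (mvn_density \<theta> \<Sigma> x))"
    using X by (auto simp: iid_normal_def)
  have Xm: "X i \<in> borel_measurable M" if "i \<in> {1..n}" for i
    using distributed_measurable[OF dX[OF that]] by simp
  have "distr M (PiM {1..n} (\<lambda>_. borel)) (\<lambda>\<omega>. \<lambda>i\<in>{1..n}. X i \<omega>) = PiM {1..n} (\<lambda>i. distr M borel (X i))"
    using ind n Xm by (subst (asm) indep_vars_iff_distr_eq_PiM') auto
  also have "\<dots> = sample_law n \<theta> \<Sigma>"
  proof (rule PiM_cong)
    fix i assume i: "i \<in> {1..n}"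
    have "distr M borel (X i) = distr M lborel (X i)" by (rule distr_cong) auto
    then show "distr M borel (X i) = density lborel (\<lambda>x. ennreal (mvn_density \<theta> \<Sigma> x))"
      using distributed_distr_eq_density[OF dX[OF i]] by simp
  qed simp
  finally have law: "distr M (PiM {1..n} (\<lambda>_. borel)) (\<lambda>\<omega>. \<lambda>i\<in>{1..n}. X i \<omega>) = sample_law n \<theta> \<Sigma>" .
  have ae': "AE xs in distr M (PiM {1..n} (\<lambda>_. borel)) (\<lambda>\<omega>. \<lambda>i\<in>{1..n}. X i \<omega>).
      posdef (scatter n xs) \<and> f (sample_mean n xs) (scatter n xs) \<theta> \<Sigma> > 0"
    unfolding law by (rule ae)
  have "(\<lambda>\<omega>. \<lambda>i\<in>{1..n}. X i \<omega>) \<in> M \<rightarrow>\<^sub>M PiM {1..n} (\<lambda>_. borel)"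
    using Xm by (intro measurable_restrict) auto
  from AE_distrD[OF this ae'] have "AE \<omega> in M. posdef (scatter n (\<lambda>i\<in>{1..n}. X i \<omega>))
      \<and> f (sample_mean n (\<lambda>i\<in>{1..n}. X i \<omega>)) (scatter n (\<lambda>i\<in>{1..n}. X i \<omega>)) \<theta> \<Sigma> > 0" .
  then show ?thesis
  proof eventually_elim
    fix \<omega>
    \<comment> \<open>The product space consists of functions restricted to {1..n}; both statistics
      read only these indices.\<close>
    have m: "sample_mean n (\<lambda>i\<in>{1..n}. X i \<omega>) = sample_mean n (\<lambda>i. X i \<omega>)"
      by (simp add: sample_mean_def)
    then have s: "scatter n (\<lambda>i\<in>{1..n}. X i \<omega>) = scatter n (\<lambda>i. X i \<omega>)"
      by (simp add: scatter_def)
    assume "posdef (scatter n (\<lambda>i\<in>{1..n}. X i \<omega>))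
      \<and> f (sample_mean n (\<lambda>i\<in>{1..n}. X i \<omega>)) (scatter n (\<lambda>i\<in>{1..n}. X i \<omega>)) \<theta> \<Sigma> > 0"
    then have S: "posdef (scatter n (\<lambda>i. X i \<omega>))" and pos: "f (sample_mean n (\<lambda>i. X i \<omega>)) (scatter n (\<lambda>i. X i \<omega>)) \<theta> \<Sigma> > 0"
      unfolding m s by auto
    have nn: "lik_ratio n \<theta> \<Sigma> (sample_mean n (\<lambda>i. X i \<omega>)) (scatter n (\<lambda>i. X i \<omega>)) \<ge> 0"
      by (simp add: lik_ratio_def)
    show "posdef (scatter n (\<lambda>i. X i \<omega>)) \<and> f (sample_mean n (\<lambda>i. X i \<omega>)) (scatter n (\<lambda>i. X i \<omega>)) 0 (mat 1) > 0"
      using S pos nn unfolding joint_density_factor[OF f n \<Sigma> S] by (auto simp: zero_less_mult_iff)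
  qed
qed

theorem theorem2p3:
  fixes n :: nat and K :: alternative
    and f :: "('p::{finite,linorder}) rvec \<Rightarrow> 'p rmat \<Rightarrow> 'p rvec \<Rightarrow> 'p rmat \<Rightarrow> real"
  assumes "n > CARD('p)"
    and "joint_density n f"
  shows "\<exists>g h :: real \<Rightarrow> real. strict_mono g \<and> strict_mono h \<and>
    (\<forall>(M :: 'w measure) (X :: nat \<Rightarrow> 'w \<Rightarrow> 'p rvec) \<theta> \<Sigma>.
       posdef \<Sigma> \<and> iid_normal n \<theta> \<Sigma> M X \<longrightarrow>
       (AE \<omega> in M.
          let x = sample_mean n (\<lambda>i. X i \<omega>); S = scatter n (\<lambda>i. X i \<omega>) in
            integrated_LRT K f x S = g (LRT K n x S) \<and>
            integrated_UIT K n x S = h (UIT K n x S)))"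
proof -
  have n: "n > 0" using assms(1) by simp
  \<comment> \<open>Both statistics are nonnegative, so only the power branch is evaluated on data;
    the identity branch makes the function strictly increasing on the whole line. The same function
    serves both tests.\<close>
  define g :: "real \<Rightarrow> real" where "g u = (if u \<ge> 0 then (1 + u) powr (real n / 2) else u)" for u
  have "strict_mono g"
  proof (rule strict_monoI)
    fix u v :: real assume "u < v"
    consider "u \<ge> 0" | "u < 0" "v \<ge> 0" | "v < 0" by linarith
    then show "g u < g v"
    proof cases
      case 1
      then show ?thesis using \<open>u < v\<close> n by (simp add: g_def powr_less_mono2)
    next
      case 2
      then have "g v > 0" by (simp add: g_def)
      moreover have "g u = u" using 2 by (simp add: g_def)
      ultimately show ?thesis using 2 by linarith
    next
      case 3
      then show ?thesis using \<open>u < v\<close> by (simp add: g_def)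
    qed
  qed
  moreover have "AE \<omega> in M. let x = sample_mean n (\<lambda>i. X i \<omega>); S = scatter n (\<lambda>i. X i \<omega>) in
            integrated_LRT K f x S = g (LRT K n x S) \<and> integrated_UIT K n x S = g (UIT K n x S)"
    if "posdef \<Sigma>" "iid_normal n \<theta> \<Sigma> M X" for M :: "'w measure" and X :: "nat \<Rightarrow> 'w \<Rightarrow> 'p rvec" and \<theta> \<Sigma>
    using AE_sample_regular[OF assms(2) n that]
    by eventually_elim
       (simp add: Let_def g_def integrated_LRT_eq[OF assms(2,1)] LRT_sup(2) integrated_UIT_eq)
  ultimately show ?thesis by blast
qed

end
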